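(* Let $\mathscr{R}$ be a finite factor and $\phi: GL_1(\mathscr{R})^{+}\to GL_1(\mathscr{R})^{+}$ be a bijective map. Then $$\Delta(\phi(A)+\phi(B))=\Delta(\phi(I))\cdot \Delta(A+B) \quad \text{for all } A,B \in GL_1(\mathscr{R})^{+}$$ if and only if there is a map $\theta:\mathscr{R}\to\mathscr{R}$ that is either a $*$-automorphism or a $*$-anti-automorphism of $\mathscr{R}$, and a positive invertible element $T\in GL_1(\mathscr{R})^{+}$, such that $$\phi(A)=T\theta(A)T \quad \text{for all } A\in GL_1(\mathscr{R})^{+}.$$
   Context: A finite factor is a finite von Neumann algebra with trivial center $\mathbb{C}I$; here $\mathscr{R}$ acts on a complex (separable) Hilbert space and contains the identity operator $I$. $\tau$ is a faithful tracial state on $\mathscr{R}$: a linear functional $\tau:\mathscr{R}\to\mathbb{C}$ such that $\tau(AB)=\tau(BA)$ for all $A,B \in \mathscr{R}$, $\tau(A^*A)\ge 0$ with equality if and only if $A=0$, and $\tau(I)=1$. $GL_1(\mathscr{R})^{+}$ denotes the set of invertible positive operators in $\mathscr{R}$. $\Delta$ is the Fuglede-Kadison determinant associated with $\tau$: for invertible $A\in\mathscr{R}$, $\Delta(A)=\exp(\tau(\log\sqrt{A^*A}))$. A $*$-automorphism (respectively $*$-anti-automorphism) of $\mathscr{R}$ is a bijective linear map $\theta:\mathscr{R}\to\mathscr{R}$ with $\theta(A^* )=\theta(A)^*$ and $\theta(AB)=\theta(A)\theta(B)$ (respectively $\theta(AB)=\theta(B)\theta(A)$) for all $A,B\in\mathscr{R}$.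 *)

theory Defs
  imports "HOL-Analysis.Analysis"
begin

section \<open>Complex Hilbert spaces\<close>

text \<open>
  A complex inner product space is a real inner product space whose real structure (norm,
  topology, real scalar multiplication, real inner product) is the one underlying a complex
  structure: the real inner product is the real part of the complex one, so
  \<open>norm x = sqrt (Re (cinner x x))\<close>. The complex inner product is linear in the first argument.
\<close>

class complex_inner = real_inner +
  fixes scaleC :: "complex \<Rightarrow> 'a \<Rightarrow> 'a" (infixr "*\<^sub>C" 75)
    and cinner :: "'a \<Rightarrow> 'a \<Rightarrow> complex"
  assumes scaleC_of_real: "complex_of_real r *\<^sub>C x = r *\<^sub>R x"
    and scaleC_add_right: "c *\<^sub>C (x + y) = c *\<^sub>C x + c *\<^sub>C y"
    and scaleC_add_left: "(c + d) *\<^sub>C x = c *\<^sub>C x + d *\<^sub>C x"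
    and scaleC_scaleC: "c *\<^sub>C d *\<^sub>C x = (c * d) *\<^sub>C x"
    and cinner_commute: "cinner x y = cnj (cinner y x)"
    and cinner_add_left: "cinner (x + y) z = cinner x z + cinner y z"
    and cinner_scaleC_left: "cinner (c *\<^sub>C x) y = c * cinner x y"
    and inner_eq_Re_cinner: "inner x y = Re (cinner x y)"

class chilbert_space = complex_inner + banach

lemma cinner_scaleC_right: "cinner x (c *\<^sub>C y) = cnj c * cinner x y"
  by (metis cinner_commute cinner_scaleC_left complex_cnj_cnj complex_cnj_mult)

lemma norm_scaleC: "norm (c *\<^sub>C x) = cmod c * norm (x :: 'a :: complex_inner)"
proof -
  have "inner (c *\<^sub>C x) (c *\<^sub>C x) = Re ((c * cnj c) * cinner x x)"
    by (simp add: inner_eq_Re_cinner cinner_scaleC_left cinner_scaleC_right algebra_simps)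
  also have "\<dots> = (cmod c)\<^sup>2 * inner x x"
    unfolding complex_norm_square [symmetric]
    by (simp add: inner_eq_Re_cinner flip: of_real_power)
  finally show ?thesis
    by (simp add: norm_eq_sqrt_inner real_sqrt_mult)
qed

lemma bounded_linear_scaleC: "bounded_linear ((*\<^sub>C) c :: 'a :: complex_inner \<Rightarrow> 'a)"
proof (rule bounded_linear_intro)
  show "c *\<^sub>C (r *\<^sub>R x) = r *\<^sub>R (c *\<^sub>C x)" for r and x :: 'a
    by (simp add: scaleC_of_real [symmetric] scaleC_scaleC mult.commute)
  show "norm (c *\<^sub>C x) \<le> norm x * cmod c" for x :: 'a
    by (simp add: norm_scaleC)
qed (rule scaleC_add_right)

section \<open>Bounded operators\<close>

text \<open>
  The type \<open>'h \<Rightarrow>\<^sub>L 'h\<close> consists of the bounded real-linear maps with the operator norm; the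
  operators on the complex Hilbert space are those among them that are complex-linear.
\<close>

definition complex_linear_op :: "('h :: chilbert_space \<Rightarrow>\<^sub>L 'h) \<Rightarrow> bool" where
  "complex_linear_op A \<longleftrightarrow> (\<forall>c x. blinfun_apply A (c *\<^sub>C x) = c *\<^sub>C blinfun_apply A x)"

lift_definition scale_op :: "complex \<Rightarrow> ('h :: chilbert_space \<Rightarrow>\<^sub>L 'h) \<Rightarrow> 'h \<Rightarrow>\<^sub>L 'h" is
  "\<lambda>c A x. c *\<^sub>C A x"
  by (rule bounded_linear_compose [OF bounded_linear_scaleC])

definition adj_op :: "('h :: chilbert_space \<Rightarrow>\<^sub>L 'h) \<Rightarrow> 'h \<Rightarrow>\<^sub>L 'h" where
  "adj_op A = (THE B. \<forall>x y. cinner (blinfun_apply A x) y = cinner x (blinfun_apply B y))"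

definition positive_op :: "('h :: chilbert_space \<Rightarrow>\<^sub>L 'h) \<Rightarrow> bool" where
  "positive_op A \<longleftrightarrow> complex_linear_op A \<and> (\<forall>x. cinner (blinfun_apply A x) x \<in> \<real>\<^sub>\<ge>\<^sub>0)"

definition op_spectrum :: "('h :: chilbert_space \<Rightarrow>\<^sub>L 'h) \<Rightarrow> complex set" where
  "op_spectrum A = {c. \<not> (\<exists>B. complex_linear_op B \<and>
     B o\<^sub>L (A - scale_op c id_blinfun) = id_blinfun \<and>
     (A - scale_op c id_blinfun) o\<^sub>L B = id_blinfun)}"

definition op_poly :: "real poly \<Rightarrow> ('h :: chilbert_space \<Rightarrow>\<^sub>L 'h) \<Rightarrow> 'h \<Rightarrow>\<^sub>L 'h" where
  "op_poly p A = (\<Sum>i\<le>degree p. coeff p i *\<^sub>R (((o\<^sub>L) A ^^ i) id_blinfun))"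

text \<open>
  Continuous functional calculus for a self-adjoint operator \<open>A\<close> and a real function \<open>f\<close> that is
  continuous on the spectrum of \<open>A\<close>: \<open>f(A)\<close> is the norm limit of \<open>p\<^sub>n(A)\<close> for polynomials \<open>p\<^sub>n\<close>
  converging to \<open>f\<close> uniformly on the spectrum. For other \<open>A\<close> or \<open>f\<close> the value is meaningless.
\<close>

definition fun_calc :: "(real \<Rightarrow> real) \<Rightarrow> ('h :: chilbert_space \<Rightarrow>\<^sub>L 'h) \<Rightarrow> 'h \<Rightarrow>\<^sub>L 'h" where
  "fun_calc f A = (THE B. \<forall>p :: nat \<Rightarrow> real poly.
     uniform_limit {t. complex_of_real t \<in> op_spectrum A} (\<lambda>n. poly (p n)) f sequentially \<longrightarrow>
     (\<lambda>n. op_poly (p n) A) \<longlonglongrightarrow> B)"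

section \<open>Finite factors\<close>

definition von_neumann_algebra :: "('h :: chilbert_space \<Rightarrow>\<^sub>L 'h) set \<Rightarrow> bool" where
  "von_neumann_algebra R \<longleftrightarrow>
     (\<forall>A\<in>R. complex_linear_op A) \<and>
     id_blinfun \<in> R \<and>
     (\<forall>A\<in>R. \<forall>B\<in>R. A + B \<in> R) \<and>
     (\<forall>c. \<forall>A\<in>R. scale_op c A \<in> R) \<and>
     (\<forall>A\<in>R. \<forall>B\<in>R. A o\<^sub>L B \<in> R) \<and>
     (\<forall>A\<in>R. adj_op A \<in> R) \<and>
     closedin strong_operator_topology R"

definition center_op :: "('h :: chilbert_space \<Rightarrow>\<^sub>L 'h) set \<Rightarrow> ('h \<Rightarrow>\<^sub>L 'h) set" where
  "center_op R = {A \<in> R. \<forall>B\<in>R. A o\<^sub>L B = B o\<^sub>L A}"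

text \<open>Finiteness: the identity is a finite projection, i.e. every isometry in \<open>R\<close> is unitary.\<close>

definition finite_factor :: "('h :: chilbert_space \<Rightarrow>\<^sub>L 'h) set \<Rightarrow> bool" where
  "finite_factor R \<longleftrightarrow>
     von_neumann_algebra R \<and>
     (\<forall>V\<in>R. adj_op V o\<^sub>L V = id_blinfun \<longrightarrow> V o\<^sub>L adj_op V = id_blinfun) \<and>
     center_op R = range (\<lambda>c. scale_op c id_blinfun)"

definition GL1_pos :: "('h :: chilbert_space \<Rightarrow>\<^sub>L 'h) set \<Rightarrow> ('h \<Rightarrow>\<^sub>L 'h) set" where
  "GL1_pos R = {A \<in> R. positive_op A \<and>
     (\<exists>B\<in>R. A o\<^sub>L B = id_blinfun \<and> B o\<^sub>L A = id_blinfun)}"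

definition faithful_tracial_state ::
    "('h :: chilbert_space \<Rightarrow>\<^sub>L 'h) set \<Rightarrow> (('h \<Rightarrow>\<^sub>L 'h) \<Rightarrow> complex) \<Rightarrow> bool" where
  "faithful_tracial_state R \<tau> \<longleftrightarrow>
     (\<forall>A\<in>R. \<forall>B\<in>R. \<tau> (A + B) = \<tau> A + \<tau> B) \<and>
     (\<forall>c. \<forall>A\<in>R. \<tau> (scale_op c A) = c * \<tau> A) \<and>
     (\<forall>A\<in>R. \<forall>B\<in>R. \<tau> (A o\<^sub>L B) = \<tau> (B o\<^sub>L A)) \<and>
     (\<forall>A\<in>R. \<tau> (adj_op A o\<^sub>L A) \<in> \<real>\<^sub>\<ge>\<^sub>0) \<and>
     (\<forall>A\<in>R. \<tau> (adj_op A o\<^sub>L A) = 0 \<longleftrightarrow> A = 0) \<and>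
     \<tau> id_blinfun = 1"

text \<open>Fuglede--Kadison determinant of an invertible operator.\<close>

definition FK_det ::
    "(('h :: chilbert_space \<Rightarrow>\<^sub>L 'h) \<Rightarrow> complex) \<Rightarrow> ('h \<Rightarrow>\<^sub>L 'h) \<Rightarrow> complex" where
  "FK_det \<tau> A = exp (\<tau> (fun_calc ln (fun_calc sqrt (adj_op A o\<^sub>L A))))"

section \<open>Automorphisms and anti-automorphisms\<close>

definition star_linear_bij ::
    "('h :: chilbert_space \<Rightarrow>\<^sub>L 'h) set \<Rightarrow> (('h \<Rightarrow>\<^sub>L 'h) \<Rightarrow> 'h \<Rightarrow>\<^sub>L 'h) \<Rightarrow> bool" where
  "star_linear_bij R \<theta> \<longleftrightarrow>
     bij_betw \<theta> R R \<and>
     (\<forall>A\<in>R. \<forall>B\<in>R. \<theta> (A + B) = \<theta> A + \<theta> B) \<and>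
     (\<forall>c. \<forall>A\<in>R. \<theta> (scale_op c A) = scale_op c (\<theta> A)) \<and>
     (\<forall>A\<in>R. \<theta> (adj_op A) = adj_op (\<theta> A))"

definition star_automorphism ::
    "('h :: chilbert_space \<Rightarrow>\<^sub>L 'h) set \<Rightarrow> (('h \<Rightarrow>\<^sub>L 'h) \<Rightarrow> 'h \<Rightarrow>\<^sub>L 'h) \<Rightarrow> bool" where
  "star_automorphism R \<theta> \<longleftrightarrow>
     star_linear_bij R \<theta> \<and> (\<forall>A\<in>R. \<forall>B\<in>R. \<theta> (A o\<^sub>L B) = \<theta> A o\<^sub>L \<theta> B)"

definition star_anti_automorphism ::
    "('h :: chilbert_space \<Rightarrow>\<^sub>L 'h) set \<Rightarrow> (('h \<Rightarrow>\<^sub>L 'h) \<Rightarrow> 'h \<Rightarrow>\<^sub>L 'h) \<Rightarrow> bool" where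
  "star_anti_automorphism R \<theta> \<longleftrightarrow>
     star_linear_bij R \<theta> \<and> (\<forall>A\<in>R. \<forall>B\<in>R. \<theta> (A o\<^sub>L B) = \<theta> B o\<^sub>L \<theta> A)"

end

theory Submission
  imports Defs "HOL-Computational_Algebra.Fundamental_Theorem_Algebra"
begin

text \<open>
  Let \<open>t = Re \<tau>\<close> and \<open>L(A) = t(ln A)\<close>, so that \<open>\<Delta> = exp L\<close> on positive invertible operators, and
  \<open>L(T A T) = 2 L(T) + L(A)\<close>.

  \<open>\<Longrightarrow>\<close>: The map \<open>f(A) = \<phi>(I)\<^sup>-\<^sup>1\<^sup>/\<^sup>2 \<phi>(A) \<phi>(I)\<^sup>-\<^sup>1\<^sup>/\<^sup>2\<close> satisfies \<open>L(f(A) + f(B)) = L(A + B)\<close>. The equality case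
  of Minkowski's inequality for \<open>\<Delta>\<close> makes \<open>f\<close> positively homogeneous. Differentiating \<open>L(A + s B)\<close> at
  \<open>s = 0\<close> gives \<open>t(f(A)\<^sup>-\<^sup>1 f(B)) = t(A\<^sup>-\<^sup>1 B)\<close>; since \<open>f\<close> is onto and \<open>t\<close> is faithful, \<open>f\<close> is additive, and
  expanding \<open>f((I + s A)\<^sup>-\<^sup>1)\<close> to second order in \<open>s\<close> shows that its complex-linear extension \<open>\<theta>\<close> is a Jordan isomorphism. A factor is
  prime, so by Herstein's argument \<open>\<theta>\<close> is multiplicative or antimultiplicative; \<open>T = \<phi>(I)\<^sup>1\<^sup>/\<^sup>2\<close>.

  \<open>\<Longleftarrow>\<close>: \<open>\<theta>\<close> commutes with the functional calculus, and \<open>t \<circ> \<theta> = t\<close> because a factor has at most one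
  normalized trace. The latter needs no dimension theory: the comparability of two projections already
  bounds the difference of two traces by a fraction of itself.
\<close>

section \<open>Hilbert space\<close>

text \<open>The hypothesis sees only sums of two elements, so products must be extracted from a
  trace pairing. With h(A) = f(A^-1)^-1 the differentiated identity reads t(h(A) f(B)) = t(A B): a
  duality between f and h that makes both of them additive. Their comparison is what brings
  inverses, and hence squares, into play.

  Noncommutativity blocks the usual calculus of logarithms: the derivative of ln X(s) has no simple
  form, but under the trace it becomes t(X^-1 X'). This is proved for polynomials and carried to the
  logarithm by a limit in which the derivatives converge too.

  Primeness comes from the fact that the kernel projection of a right ideal is central. It is needed
  twice: for the Jordan map, and for the comparison of projections behind the uniqueness of the
  trace. Strong closure supplies just two kinds of limits, kernel projections and sums of orthogonal
  partial isometries; everything else is a norm limit of polynomials, controlled by scalar bounds of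
  the operator rather than by its exact spectrum.\<close>

lemma scaleC_zero_right [simp]: "c *\<^sub>C (0::'a::complex_inner) = 0"
  using scaleC_add_right[of c "0::'a" 0] by simp

lemma scaleC_minus_right: "c *\<^sub>C (- x) = - (c *\<^sub>C (x::'a::complex_inner))"
  using scaleC_add_right[of c x "- x"] by (simp add: add_eq_0_iff)

lemma scaleC_zero_left [simp]: "0 *\<^sub>C (x::'a::complex_inner) = 0"
  using scaleC_of_real[of 0 x] by simp

lemma scaleC_minus_left: "(- c) *\<^sub>C x = - (c *\<^sub>C (x::'a::complex_inner))"
  using scaleC_add_left[of c "- c" x] by (simp add: add_eq_0_iff)

lemma cinner_add_right: "cinner x (y + z) = cinner x y + cinner x z"
  by (metis cinner_commute cinner_add_left complex_cnj_add)

lemma scaleR_scaleC_commute: "r *\<^sub>R c *\<^sub>C x = c *\<^sub>C r *\<^sub>R (x::'a::complex_inner)"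
  by (simp add: scaleC_of_real [symmetric] scaleC_scaleC mult.commute)

lemma Re_cinner: "Re (cinner x y) = inner x y"
  by (simp add: inner_eq_Re_cinner)

text \<open>Multiplying \<open>y\<close> by the scalar \<open>cinner x y\<close> makes the inner
  product with \<open>x\<close> real and nonnegative, so the real Cauchy-Schwarz inequality
  applies.\<close>

lemma cinner_bound: "cmod (cinner x y) \<le> norm x * norm y"
proof (cases "cinner x y = 0")
  case False
  let ?c = "cinner x y"
  have "cinner x (?c *\<^sub>C y) = of_real ((cmod ?c)\<^sup>2)"
    by (simp add: cinner_scaleC_right complex_norm_square mult.commute del: of_real_power)
  then have "(cmod ?c)\<^sup>2 = inner x (?c *\<^sub>C y)"
    by (metis Re_cinner Re_complex_of_real)
  also have "\<dots> \<le> norm x * (cmod ?c * norm y)"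
    using norm_cauchy_schwarz[of x "?c *\<^sub>C y"] by (simp add: norm_scaleC)
  finally show ?thesis using False
    by (simp add: power2_eq_square mult.left_commute[of _ "cmod ?c"] )
qed auto

lemma bounded_bilinear_cinner: "bounded_bilinear (cinner :: 'a::complex_inner \<Rightarrow> 'a \<Rightarrow> complex)"
proof
  fix r :: real and a b :: 'a
  show "cinner (r *\<^sub>R a) b = r *\<^sub>R cinner a b"
    by (simp add: scaleC_of_real [symmetric] cinner_scaleC_left scaleR_conv_of_real)
  show "cinner a (r *\<^sub>R b) = r *\<^sub>R cinner a b"
    by (simp add: scaleC_of_real [symmetric] cinner_scaleC_right scaleR_conv_of_real)
  show "\<exists>K. \<forall>a b :: 'a. cmod (cinner a b) \<le> norm a * norm b * K"
    using cinner_bound by (intro exI[of _ 1]) auto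
qed (auto simp: cinner_add_left cinner_add_right)

interpretation cinner: bounded_bilinear cinner
  by (rule bounded_bilinear_cinner)

section \<open>Orthogonality: projection theorem, Riesz representation, adjoints\<close>

lemma cinner_ext: "(\<And>x. cinner x y = cinner x z) \<Longrightarrow> y = z"
proof -
  assume "\<And>x. cinner x y = cinner x z"
  then have "inner (y - z) (y - z) = 0"
    by (simp add: inner_eq_Re_cinner cinner.diff_right)
  then show ?thesis by simp
qed

text \<open>The parallelogram identity, applied with midpoints that stay in \<open>M\<close>, makes
  a minimizing sequence for the distance Cauchy. At the minimizer no step along \<open>z\<close>
  shortens the distance, which forces orthogonality.\<close>

lemma hilbert_projection:
  fixes M :: "'a::{real_inner,banach} set"
  assumes "subspace M" "closed M"
  shows "\<exists>y\<in>M. \<forall>z\<in>M. inner (x - y) z = 0"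
proof -
  let ?S = "(\<lambda>y. (norm (x - y))\<^sup>2) ` M"
  define d where "d = Inf ?S"
  have bb: "bdd_below ?S" by (rule bdd_belowI[of _ 0]) auto
  have ne: "?S \<noteq> {}" using subspace_0[OF assms(1)] by auto
  have d_le: "d \<le> (norm (x - y))\<^sup>2" if "y \<in> M" for y
    unfolding d_def by (rule cInf_lower[OF _ bb]) (use that in auto)
  have "\<exists>y\<in>M. (norm (x - y))\<^sup>2 < d + 1 / real (Suc n)" for n
    using cInf_lessD[OF ne, of "d + 1 / real (Suc n)"] unfolding d_def by force
  then obtain y where y: "\<And>n. y n \<in> M" "\<And>n. (norm (x - y n))\<^sup>2 < d + 1 / real (Suc n)"
    by metis
  have dist: "(norm (y m - y n))\<^sup>2 \<le> 2 / real (Suc m) + 2 / real (Suc n)" for m n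
  proof -
    have mid: "(1/2) *\<^sub>R (y m + y n) \<in> M"
      using y(1) assms(1) by (simp add: subspace_add subspace_scale)
    have "(norm (y m - y n))\<^sup>2 = 2 * (norm (x - y m))\<^sup>2 + 2 * (norm (x - y n))\<^sup>2
       - 4 * (norm (x - (1/2) *\<^sub>R (y m + y n)))\<^sup>2"
      by (simp add: power2_norm_eq_inner inner_diff inner_add inner_commute algebra_simps)
    also have "\<dots> \<le> 2 * (d + 1 / real (Suc m)) + 2 * (d + 1 / real (Suc n)) - 4 * d"
      by (rule diff_mono[OF add_mono]) (use y(2)[of m] y(2)[of n] d_le[OF mid] in auto)
    finally show ?thesis by simp
  qed
  have "Cauchy y"
  proof (rule metric_CauchyI)
    fix e :: real assume e: "0 < e"
    obtain N where N: "4 / e\<^sup>2 < real N" using reals_Archimedean2 by blast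
    have "dist (y m) (y n) < e" if "m \<ge> N" "n \<ge> N" for m n
    proof -
      have Np: "real N > 0" using N e by (smt (verit) divide_pos_pos zero_less_power)
      have "2 / real (Suc m) \<le> 2 / real N" "2 / real (Suc n) \<le> 2 / real N"
        using that Np by (auto intro!: divide_left_mono)
      then have "(norm (y m - y n))\<^sup>2 \<le> 4 / real N" using dist[of m n] by simp
      also have "\<dots> < e\<^sup>2" using N e Np by (simp add: field_simps)
      finally show ?thesis using e by (simp add: dist_norm power_less_imp_less_base)
    qed
    then show "\<exists>M. \<forall>m\<ge>M. \<forall>n\<ge>M. dist (y m) (y n) < e" by blast
  qed
  then obtain l where l: "y \<longlonglongrightarrow> l" using Cauchy_convergent convergent_def by blast
  have lM: "l \<in> M" using closed_sequentially[OF assms(2)] y(1) l by blast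
  have lim1: "(\<lambda>n. (norm (x - y n))\<^sup>2) \<longlonglongrightarrow> (norm (x - l))\<^sup>2"
    by (intro tendsto_intros l)
  have "(\<lambda>n. d + 1 / real (Suc n)) \<longlonglongrightarrow> d + 0"
    using LIMSEQ_inverse_real_of_nat by (intro tendsto_intros) (simp add: inverse_eq_divide)
  then have lim2: "(\<lambda>n. d + 1 / real (Suc n)) \<longlonglongrightarrow> d" by simp
  have l_le: "(norm (x - l))\<^sup>2 \<le> d"
    using y(2) by (intro LIMSEQ_le[OF lim1 lim2]) (auto intro!: less_imp_le exI[of _ 0] simp del: of_nat_Suc)
  have "inner (x - l) z = 0" if z: "z \<in> M" for z
  proof (cases "z = 0")
    case False
    \<comment> \<open>The step length that minimizes the distance along the direction
      \<open>z\<close>.\<close>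
    define t where "t = inner (x - l) z / (norm z)\<^sup>2"
    have "l + t *\<^sub>R z \<in> M" using lM z assms(1) by (simp add: subspace_add subspace_scale)
    then have "(norm (x - l))\<^sup>2 \<le> (norm ((x - l) - t *\<^sub>R z))\<^sup>2"
      using d_le l_le by (smt (verit) diff_diff_eq)
    also have "\<dots> = (norm (x - l))\<^sup>2 - 2 * t * inner (x - l) z + t\<^sup>2 * (norm z)\<^sup>2"
      unfolding power2_norm_eq_inner
      by (simp only: inner_diff_left inner_diff_right inner_scaleR_left inner_scaleR_right)
         (simp add: inner_commute algebra_simps power2_eq_square)
    also have "\<dots> = (norm (x - l))\<^sup>2 - (inner (x - l) z)\<^sup>2 / (norm z)\<^sup>2"
      using False unfolding t_def by (simp add: field_simps power2_eq_square)
    finally have "(inner (x - l) z)\<^sup>2 / (norm z)\<^sup>2 \<le> 0" by simp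
    then show ?thesis using False by (simp add: divide_le_0_iff)
  qed auto
  then show ?thesis using lM by blast
qed

text \<open>Take the component \<open>w\<close>, orthogonal to the kernel \<open>M\<close>, of a
  vector outside \<open>M\<close>. Subtracting the multiple \<open>f x / f w\<close> of
  \<open>w\<close> from \<open>x\<close> lands in \<open>M\<close>, and pairing the result with
  \<open>w\<close> yields \<open>f x\<close>.\<close>

lemma riesz_representation:
  fixes f :: "'a::{real_inner,banach} \<Rightarrow> real"
  assumes "bounded_linear f"
  shows "\<exists>y. \<forall>x. f x = inner x y"
proof (cases "\<forall>x. f x = 0")
  case False
  interpret f: bounded_linear f by fact
  define M where "M = {x. f x = 0}"
  have M: "subspace M" "closed M"
    unfolding M_def
    by (auto simp: subspace_def f.add f.scaleR intro!: closed_Collect_eq f.continuous_on continuous_intros)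
  obtain x0 where x0: "f x0 \<noteq> 0" using False by blast
  obtain p where p: "p \<in> M" "\<forall>z\<in>M. inner (x0 - p) z = 0"
    using hilbert_projection[OF M] by blast
  define w where "w = x0 - p"
  have fw: "f w \<noteq> 0" using x0 p(1) by (simp add: w_def f.diff M_def)
  then have w0: "norm w \<noteq> 0" using f.zero by auto
  have "f x = inner x ((f w / (norm w)\<^sup>2) *\<^sub>R w)" for x
  proof -
    have "x - (f x / f w) *\<^sub>R w \<in> M" using fw by (simp add: M_def f.diff f.scaleR)
    then have "inner w (x - (f x / f w) *\<^sub>R w) = 0" using p(2) by (simp add: w_def)
    then have "inner x w = f x / f w * (norm w)\<^sup>2"
      by (simp add: inner_diff_right power2_norm_eq_inner inner_commute)
    then show ?thesis using fw w0 by (simp add: field_simps)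
  qed
  then show ?thesis by blast
qed (auto intro: exI[of _ 0])

text \<open>Riesz representation is applied to the real inner product. Complex-linearity of
  \<open>A\<close> recovers the imaginary part, since the imaginary part at \<open>x\<close> is
  minus the real part at \<open>\<i>\<close> times \<open>x\<close>.\<close>

lemma adjoint_exists:
  fixes A :: "'h::chilbert_space \<Rightarrow>\<^sub>L 'h"
  assumes "complex_linear_op A"
  shows "\<exists>B. complex_linear_op B \<and> (\<forall>x y. cinner (blinfun_apply A x) y = cinner x (blinfun_apply B y))"
proof -
  have "\<exists>z. \<forall>x. inner (blinfun_apply A x) y = inner x z" for y
    by (rule riesz_representation) (intro bounded_linear_intros)
  then obtain B where B: "\<And>x y. inner (blinfun_apply A x) y = inner x (B y)" by metis
  have c: "cinner (blinfun_apply A x) y = cinner x (B y)" for x y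
  proof (rule complex_eqI)
    show "Re (cinner (blinfun_apply A x) y) = Re (cinner x (B y))" by (simp add: Re_cinner B)
    have "Im (cinner (blinfun_apply A x) y) = - Re (cinner (blinfun_apply A (\<i> *\<^sub>C x)) y)"
      using assms by (simp add: complex_linear_op_def cinner_scaleC_left)
    also have "\<dots> = - Re (cinner (\<i> *\<^sub>C x) (B y))" by (simp add: Re_cinner B)
    finally show "Im (cinner (blinfun_apply A x) y) = Im (cinner x (B y))"
      by (simp add: cinner_scaleC_left)
  qed
  have bl: "bounded_linear B"
  proof (rule bounded_linear_intro[where K = "norm A"])
    show "B (x + y) = B x + B y" for x y
      by (rule cinner_ext) (simp add: c[symmetric] cinner_add_right)
    show "B (r *\<^sub>R x) = r *\<^sub>R B x" for r x
      by (rule cinner_ext) (simp add: c[symmetric] cinner.scaleR_right)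
    show "norm (B y) \<le> norm y * norm A" for y
    proof (cases "B y = 0")
      case False
      have "(norm (B y))\<^sup>2 = inner (blinfun_apply A (B y)) y"
        by (simp add: B power2_norm_eq_inner)
      also have "\<dots> \<le> norm (blinfun_apply A (B y)) * norm y" by (rule norm_cauchy_schwarz)
      also have "\<dots> \<le> norm A * norm (B y) * norm y"
        by (intro mult_right_mono norm_blinfun) auto
      finally show ?thesis using False by (simp add: power2_eq_square mult_ac)
    qed auto
  qed
  have "B (c *\<^sub>C y) = c *\<^sub>C B y" for c y
    by (rule cinner_ext) (simp add: c[symmetric] cinner_scaleC_right)
  then show ?thesis using bl c
    by (intro exI[of _ "Blinfun B"]) (simp add: complex_linear_op_def bounded_linear_Blinfun_apply)
qed

section \<open>The algebra of complex-linear operators\<close>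

text \<open>There is no \<open>ring_1\<close> instance because the Hilbert space may be trivial, in which case \<open>0 = 1\<close>.\<close>

typedef (overloaded) 'h cop = "{A :: 'h::chilbert_space \<Rightarrow>\<^sub>L 'h. complex_linear_op A}"
  morphisms blin Cop
  by (rule exI[of _ 0]) (simp add: complex_linear_op_def)

setup_lifting type_definition_cop

lift_definition app :: "'h::chilbert_space cop \<Rightarrow> 'h \<Rightarrow> 'h"  (infixr "\<cdot>" 75) is blinfun_apply .

lemma blin_complex_linear: "complex_linear_op (blin a)"
  using blin by auto

instantiation cop :: (chilbert_space) real_algebra
begin
lift_definition zero_cop :: "'a cop" is 0 by (simp add: complex_linear_op_def)
lift_definition plus_cop :: "'a cop \<Rightarrow> 'a cop \<Rightarrow> 'a cop" is "(+)"
  by (simp add: complex_linear_op_def blinfun.add_left scaleC_add_right)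
lift_definition uminus_cop :: "'a cop \<Rightarrow> 'a cop" is uminus
  by (simp add: complex_linear_op_def blinfun.minus_left)
     (metis scaleR_scaleC_commute scaleR_minus1_left)
lift_definition minus_cop :: "'a cop \<Rightarrow> 'a cop \<Rightarrow> 'a cop" is "(-)"
  by (simp add: complex_linear_op_def blinfun.diff_left)
     (metis (no_types, lifting) add_diff_cancel diff_add_cancel scaleC_add_right)
lift_definition scaleR_cop :: "real \<Rightarrow> 'a cop \<Rightarrow> 'a cop" is "scaleR"
  by (simp add: complex_linear_op_def blinfun.scaleR_left scaleR_scaleC_commute)
lift_definition times_cop :: "'a cop \<Rightarrow> 'a cop \<Rightarrow> 'a cop" is "(o\<^sub>L)"
  by (simp add: complex_linear_op_def)
instance
proof
  fix a b c :: "'a cop" and r s :: real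
  show "a * b * c = a * (b * c)"
    by transfer (rule blinfun_eqI, simp)
  show "(a + b) * c = a * c + b * c"
    by transfer (rule blinfun_eqI, simp add: blinfun.add_left)
  show "a * (b + c) = a * b + a * c"
    by transfer (rule blinfun_eqI, simp add: blinfun.add_left blinfun.add_right)
  show "r *\<^sub>R a * b = r *\<^sub>R (a * b)"
    by transfer (rule blinfun_eqI, simp add: blinfun.scaleR_left)
  show "a * r *\<^sub>R b = r *\<^sub>R (a * b)"
    by transfer (rule blinfun_eqI, simp add: blinfun.scaleR_left blinfun.scaleR_right)
qed (transfer, simp add: algebra_simps)+
end

instantiation cop :: (chilbert_space) real_normed_algebra
begin
lift_definition norm_cop :: "'a cop \<Rightarrow> real" is norm .
definition dist_cop :: "'a cop \<Rightarrow> 'a cop \<Rightarrow> real" where "dist_cop a b = norm (a - b)"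
definition sgn_cop :: "'a cop \<Rightarrow> 'a cop" where "sgn_cop a = a /\<^sub>R norm a"
definition uniformity_cop :: "('a cop \<times> 'a cop) filter"
  where "uniformity_cop = (INF e\<in>{0 <..}. principal {(x, y). dist x y < e})"
definition open_cop :: "'a cop set \<Rightarrow> bool"
  where "open_cop S = (\<forall>x\<in>S. \<forall>\<^sub>F (x', y) in uniformity. x' = x \<longrightarrow> y \<in> S)"
instance
proof
  fix a b :: "'a cop" and r :: real
  show "norm (a * b) \<le> norm a * norm b"
    by transfer (rule norm_blinfun_compose)
  show "norm (a + b) \<le> norm a + norm b"
    by transfer (rule norm_triangle_ineq)
  show "norm a = 0 \<longleftrightarrow> a = 0"
    by transfer simp
  show "norm (r *\<^sub>R a) = \<bar>r\<bar> * norm a"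
    by transfer simp
qed (simp_all add: dist_cop_def sgn_cop_def uniformity_cop_def open_cop_def)
end

instantiation cop :: (chilbert_space) monoid_mult
begin
lift_definition one_cop :: "'a cop" is id_blinfun by (simp add: complex_linear_op_def)
instance
  by standard (transfer, rule blinfun_eqI, simp)+
end

lemma app_simps [simp]:
  "0 \<cdot> x = 0" "1 \<cdot> x = x" "(a + b) \<cdot> x = a \<cdot> x + b \<cdot> x" "(a - b) \<cdot> x = a \<cdot> x - b \<cdot> x"
  "(- a) \<cdot> x = - (a \<cdot> x)" "(r *\<^sub>R a) \<cdot> x = r *\<^sub>R (a \<cdot> x)" "(a * b) \<cdot> x = a \<cdot> b \<cdot> x"
  by (transfer, simp add: blinfun.bilinear_simps)+

lemma app_right_simps:
  "a \<cdot> 0 = 0" "a \<cdot> (x + y) = a \<cdot> x + a \<cdot> y" "a \<cdot> (x - y) = a \<cdot> x - a \<cdot> y"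
  "a \<cdot> (- x) = - (a \<cdot> x)" "a \<cdot> (r *\<^sub>R x) = r *\<^sub>R (a \<cdot> x)" "a \<cdot> (c *\<^sub>C x) = c *\<^sub>C (a \<cdot> x)"
  by (transfer, simp add: blinfun.bilinear_simps complex_linear_op_def)+

lemma app_ext: "(\<And>x. a \<cdot> x = b \<cdot> x) \<Longrightarrow> a = b"
  by transfer (rule blinfun_eqI)

lemma norm_app: "norm (a \<cdot> x) \<le> norm a * norm x"
  by transfer (rule norm_blinfun)

lemma norm_cop_bound: "0 \<le> c \<Longrightarrow> (\<And>x. norm (a \<cdot> x) \<le> c * norm x) \<Longrightarrow> norm a \<le> c"
  by transfer (rule norm_blinfun_bound)

lemma norm_one_le: "norm (1::'a::chilbert_space cop) \<le> 1"
  by (rule norm_cop_bound) auto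

lemma bounded_bilinear_app: "bounded_bilinear ((\<cdot>) :: 'a::chilbert_space cop \<Rightarrow> _)"
  by standard (auto simp: app_right_simps norm_app intro!: exI[of _ 1])

interpretation app: bounded_bilinear "(\<cdot>)"
  by (rule bounded_bilinear_app)

lemma dist_blin: "dist (blin a) (blin b) = dist a b"
  unfolding dist_norm by (transfer, rule refl)

text \<open>A Cauchy sequence converges among the real-linear operators, and evaluation at a vector
  is continuous, so complex-linearity passes to the limit.\<close>

instance cop :: (chilbert_space) banach
proof
  fix X :: "nat \<Rightarrow> 'a cop"
  assume "Cauchy X"
  then have "Cauchy (\<lambda>n. blin (X n))" by (simp add: Cauchy_def dist_blin)
  then obtain L where L: "(\<lambda>n. blin (X n)) \<longlonglongrightarrow> L"
    using Cauchy_convergent convergent_def by blast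
  have "complex_linear_op L"
    unfolding complex_linear_op_def
  proof (intro allI)
    fix c x
    have "(\<lambda>n. blinfun_apply (blin (X n)) (c *\<^sub>C x)) \<longlonglongrightarrow> blinfun_apply L (c *\<^sub>C x)"
      by (intro tendsto_intros L)
    moreover have "(\<lambda>n. c *\<^sub>C blinfun_apply (blin (X n)) x) \<longlonglongrightarrow> c *\<^sub>C blinfun_apply L x"
      by (intro bounded_linear.tendsto[OF bounded_linear_scaleC] tendsto_intros L)
    moreover have "blinfun_apply (blin (X n)) (c *\<^sub>C x) = c *\<^sub>C blinfun_apply (blin (X n)) x" for n
      using blin_complex_linear[of "X n"] by (auto simp: complex_linear_op_def)
    ultimately show "blinfun_apply L (c *\<^sub>C x) = c *\<^sub>C blinfun_apply L x"
      by (simp add: LIMSEQ_unique)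
  qed
  then have "L = blin (Cop L)" by (simp add: Cop_inverse)
  then have "dist (X n) (Cop L) = dist (blin (X n)) L" for n by (simp flip: dist_blin)
  then have "X \<longlonglongrightarrow> Cop L" using L by (simp add: tendsto_iff)
  then show "convergent X" by (auto simp: convergent_def)
qed

lift_definition cscale :: "complex \<Rightarrow> 'h::chilbert_space cop \<Rightarrow> 'h cop" is scale_op
  by (simp add: complex_linear_op_def scale_op.rep_eq scaleC_scaleC mult.commute)

lemma app_cscale [simp]: "cscale c a \<cdot> x = c *\<^sub>C (a \<cdot> x)"
  by transfer (simp add: scale_op.rep_eq)

lemma cscale_simps:
  "cscale c (a + b) = cscale c a + cscale c b" "cscale (c + d) a = cscale c a + cscale d a"
  "cscale c (cscale d a) = cscale (c * d) a" "cscale c a * b = cscale c (a * b)"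
  "a * cscale c b = cscale c (a * b)"
  by (rule app_ext, simp add: scaleC_add_right scaleC_add_left scaleC_scaleC app_right_simps)+

lemma cscale_minus: "cscale c (- a) = - cscale c a" "cscale (- c) a = - cscale c a"
  by (rule app_ext, simp add: scaleC_minus_left scaleC_minus_right)+

lemma cscale_diff: "cscale c (a - b) = cscale c a - cscale c b"
  using cscale_simps(1)[of c a "- b"] by (simp add: cscale_minus)

lemma cscale_of_real: "cscale (of_real r) a = r *\<^sub>R a"
  by (rule app_ext) (simp add: scaleC_of_real)

lemma cscale_one: "cscale 1 a = a"
  using cscale_of_real[of 1 a] by simp

subsection \<open>Adjoints\<close>

definition adj :: "'h::chilbert_space cop \<Rightarrow> 'h cop" where
  "adj a = (THE b. \<forall>x y. cinner (a \<cdot> x) y = cinner x (b \<cdot> y))"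

lemma adj_unique: "(\<And>x y. cinner (a \<cdot> x) y = cinner x (b \<cdot> y)) \<Longrightarrow> adj a = b"
  unfolding adj_def by (rule the_equality, simp, rule app_ext, rule cinner_ext, metis)

lemma adj_ex: "\<exists>b. \<forall>x y. cinner (a \<cdot> x) y = cinner x (b \<cdot> y)"
proof -
  obtain B where B: "complex_linear_op B"
      "\<forall>x y. cinner (blinfun_apply (blin a) x) y = cinner x (blinfun_apply B y)"
    using adjoint_exists[OF blin_complex_linear[of a]] by blast
  then show ?thesis
    by (intro exI[of _ "Cop B"]) (simp add: app.rep_eq Cop_inverse)
qed

lemma cinner_adj: "cinner (a \<cdot> x) y = cinner x (adj a \<cdot> y)"
proof -
  obtain b where "\<forall>x y. cinner (a \<cdot> x) y = cinner x (b \<cdot> y)" using adj_ex by blast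
  then show ?thesis using adj_unique[of a b] by simp
qed

lemma cinner_adj': "cinner (adj a \<cdot> x) y = cinner x (a \<cdot> y)"
  by (metis cinner_adj cinner_commute)

lemma inner_adj: "inner (a \<cdot> x) y = inner x (adj a \<cdot> y)"
  by (simp add: inner_eq_Re_cinner cinner_adj)

lemma adj_op_blin: "adj_op (blin a) = blin (adj a)"
  unfolding adj_op_def
proof (rule the_equality)
  show "\<forall>x y. cinner (blinfun_apply (blin a) x) y = cinner x (blinfun_apply (blin (adj a)) y)"
    using cinner_adj[of a] by (simp add: app.rep_eq)
  show "B = blin (adj a)"
    if "\<forall>x y. cinner (blinfun_apply (blin a) x) y = cinner x (blinfun_apply B y)" for B
    by (rule blinfun_eqI, rule cinner_ext) (metis that cinner_adj app.rep_eq)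
qed

lemma adj_adj [simp]: "adj (adj a) = a"
  by (rule adj_unique) (rule cinner_adj')

lemma adj_simps [simp]:
  "adj (a + b) = adj a + adj b" "adj (a - b) = adj a - adj b"
  "adj (- a) = - adj a" "adj 0 = 0" "adj 1 = 1" "adj (a * b) = adj b * adj a"
  "adj (r *\<^sub>R a) = r *\<^sub>R adj a" "adj (cscale c a) = cscale (cnj c) (adj a)"
  by (rule adj_unique, simp add: cinner_adj cinner_add_left cinner_add_right
      cinner.diff_left cinner.diff_right cinner.minus_left cinner.minus_right
      cinner.zero_left cinner.zero_right
      cinner.scaleR_left cinner.scaleR_right cinner_scaleC_left cinner_scaleC_right)+

lemma adj_power: "adj (a ^ n) = adj a ^ n"
  by (induct n) (auto simp: power_commutes)

lemma adj_sum: "adj (sum f A) = (\<Sum>i\<in>A. adj (f i))"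
  by (induct A rule: infinite_finite_induct) auto

lemma norm_adj_le: "norm (adj a) \<le> norm a"
proof (rule norm_cop_bound)
  fix y
  show "norm (adj a \<cdot> y) \<le> norm a * norm y"
  proof (cases "adj a \<cdot> y = 0")
    case False
    have "(norm (adj a \<cdot> y))\<^sup>2 = inner (a \<cdot> adj a \<cdot> y) y"
      by (simp add: inner_adj power2_norm_eq_inner)
    also have "\<dots> \<le> norm (a \<cdot> adj a \<cdot> y) * norm y" by (rule norm_cauchy_schwarz)
    also have "\<dots> \<le> norm a * norm (adj a \<cdot> y) * norm y"
      by (intro mult_right_mono norm_app) auto
    finally show ?thesis using False by (simp add: power2_eq_square mult_ac)
  qed auto
qed auto

lemma norm_adj [simp]: "norm (adj a) = norm a"
  using norm_adj_le[of a] norm_adj_le[of "adj a"] by simp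

lemma bounded_linear_adj: "bounded_linear adj"
  by (rule bounded_linear_intro[where K = 1]) auto

lemma tendsto_adj [tendsto_intros]: "(f \<longlongrightarrow> l) F \<Longrightarrow> ((\<lambda>x. adj (f x)) \<longlongrightarrow> adj l) F"
  by (rule bounded_linear.tendsto[OF bounded_linear_adj])

lemma norm_app_sq: "(norm (a \<cdot> x))\<^sup>2 = inner (adj a \<cdot> a \<cdot> x) x"
  using inner_adj[of "adj a" "a \<cdot> x" x] by (simp add: power2_norm_eq_inner)

lemma adj_mult_eq_0: "adj a * a = 0 \<Longrightarrow> a = 0"
proof (rule app_ext)
  fix x assume "adj a * a = 0"
  then have "adj a \<cdot> a \<cdot> x = 0" by (metis app_simps(1,7))
  then show "a \<cdot> x = 0 \<cdot> x" using norm_app_sq[of a x] by simp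
qed

subsection \<open>The operator order\<close>

text \<open>Polarization at \<open>x\<close> and \<open>a \<cdot> x\<close>: the cross term of the
  form is twice the squared norm of \<open>a \<cdot> x\<close>, and all other terms vanish.\<close>

lemma sa_eq_0:
  assumes "adj a = a" "\<And>x. inner (a \<cdot> x) x = 0"
  shows "a = 0"
proof (rule app_ext)
  fix x
  let ?y = "a \<cdot> x"
  have "inner (a \<cdot> (x + ?y)) (x + ?y) = inner (a \<cdot> x) x + inner (a \<cdot> ?y) ?y + 2 * inner (a \<cdot> x) ?y"
    using inner_adj[of a ?y x] assms(1)
    by (simp add: app_right_simps inner_add inner_commute)
  then show "a \<cdot> x = 0 \<cdot> x" by (simp add: assms(2))
qed

instantiation cop :: (chilbert_space) ordered_real_vector
begin
text \<open>The real inner product is blind to the skew-adjoint part of an operator, so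
  self-adjointness of the difference is demanded separately; antisymmetry depends on it.\<close>

definition less_eq_cop :: "'a cop \<Rightarrow> 'a cop \<Rightarrow> bool" where
  "a \<le> b \<longleftrightarrow> adj (b - a) = b - a \<and> (\<forall>x. 0 \<le> inner ((b - a) \<cdot> x) x)"
definition less_cop :: "'a cop \<Rightarrow> 'a cop \<Rightarrow> bool" where
  "a < b \<longleftrightarrow> a \<le> b \<and> \<not> b \<le> (a::'a cop)"
instance
proof
  fix a b c :: "'a cop" and r s :: real
  show "a < b \<longleftrightarrow> a \<le> b \<and> \<not> b \<le> a" by (rule less_cop_def)
  show "a \<le> a" by (simp add: less_eq_cop_def)
  show "a \<le> c" if "a \<le> b" "b \<le> c"
  proof -
    have "c - a = (c - b) + (b - a)" by simp
    then show ?thesis using that unfolding less_eq_cop_def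
      by (metis (no_types, lifting) add_nonneg_nonneg adj_simps(1) app_simps(3) inner_add_left)
  qed
  show "a = b" if "a \<le> b" "b \<le> a"
  proof -
    have "b - a = 0" using that
      by (intro sa_eq_0) (auto simp: less_eq_cop_def inner_diff_left intro!: antisym)
    then show ?thesis by simp
  qed
  show "c + a \<le> c + b" if "a \<le> b" using that by (simp add: less_eq_cop_def)
  show "r *\<^sub>R a \<le> r *\<^sub>R b" if "a \<le> b" "0 \<le> r"
  proof -
    have "r *\<^sub>R b - r *\<^sub>R a = r *\<^sub>R (b - a)" by (simp add: scaleR_diff_right)
    then show ?thesis using that unfolding less_eq_cop_def
      by (metis adj_simps(7) app_simps(6) inner_scaleR_left mult_nonneg_nonneg)
  qed
  show "r *\<^sub>R a \<le> s *\<^sub>R a" if "r \<le> s" "0 \<le> a"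
  proof -
    have "s *\<^sub>R a - r *\<^sub>R a = (s - r) *\<^sub>R a" by (simp add: scaleR_diff_left)
    then show ?thesis using that unfolding less_eq_cop_def
      by (metis adj_simps(7) app_simps(6) diff_ge_0_iff_ge diff_zero inner_scaleR_left mult_nonneg_nonneg)
  qed
qed
end

lemma nonneg_iff: "0 \<le> a \<longleftrightarrow> adj a = a \<and> (\<forall>x. 0 \<le> inner (a \<cdot> x) x)"
  by (simp add: less_eq_cop_def)

lemma nonneg_sa: "0 \<le> a \<Longrightarrow> adj a = a"
  by (simp add: nonneg_iff)

lemma le_iff: "adj a = a \<Longrightarrow> adj b = b \<Longrightarrow> a \<le> b \<longleftrightarrow> (\<forall>x. inner (a \<cdot> x) x \<le> inner (b \<cdot> x) x)"
  by (simp add: less_eq_cop_def inner_diff_left)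

text \<open>\<open>positive_op\<close> does not mention adjoints. Self-adjointness follows because
  \<open>\<i>\<close> times \<open>a - adj a\<close> is self-adjoint and its form vanishes as soon
  as the complex form of \<open>a\<close> is real.\<close>

lemma positive_op_blin: "positive_op (blin a) \<longleftrightarrow> 0 \<le> a"
proof
  assume "positive_op (blin a)"
  then have p: "cinner (a \<cdot> x) x \<in> \<real>\<^sub>\<ge>\<^sub>0" for x
    by (simp add: positive_op_def app.rep_eq)
  define d where "d = cscale \<i> (a - adj a)"
  have d: "adj d = d"
    unfolding d_def by (simp add: cscale_minus cscale_diff)
  have "inner (d \<cdot> x) x = 0" for x
  proof -
    have "cinner (adj a \<cdot> x) x = cnj (cinner (a \<cdot> x) x)"
      by (metis cinner_adj' cinner_commute)
    also have "\<dots> = cinner (a \<cdot> x) x"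
      using p[of x] nonneg_Reals_subset_Reals Reals_cnj_iff by blast
    finally show ?thesis
      by (simp add: d_def inner_eq_Re_cinner cinner_scaleC_left cinner.diff_left)
  qed
  then have "d = 0" using d sa_eq_0 by blast
  then have "cscale (- \<i>) d = 0" by (intro app_ext) simp
  then have "a - adj a = 0" unfolding d_def by (simp add: cscale_simps cscale_one)
  moreover have "0 \<le> inner (a \<cdot> x) x" for x
    using p[of x] by (simp add: inner_eq_Re_cinner complex_nonneg_Reals_iff)
  ultimately show "0 \<le> a" by (simp add: nonneg_iff)
next
  assume a: "0 \<le> a"
  have "cnj (cinner (a \<cdot> x) x) = cinner (a \<cdot> x) x" for x
    using nonneg_sa[OF a] by (metis cinner_adj cinner_commute)
  then have "cinner (a \<cdot> x) x \<in> \<real>" for x using Reals_cnj_iff by blast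
  then show "positive_op (blin a)"
    using a unfolding positive_op_def
    by (auto simp: blin_complex_linear complex_nonneg_Reals_iff nonneg_iff complex_is_Real_iff
        inner_eq_Re_cinner app.rep_eq)
qed

lemma sandwich_nonneg: "0 \<le> a \<Longrightarrow> 0 \<le> adj c * a * c"
  by (simp add: nonneg_iff mult.assoc) (metis adj_adj inner_adj)

lemma sandwich_mono: "a \<le> b \<Longrightarrow> adj c * a * c \<le> adj c * b * c"
  using sandwich_nonneg[of "b - a" c] by (simp add: algebra_simps)

lemma adj_mult_nonneg: "0 \<le> adj a * a"
  using sandwich_nonneg[of 1 a] by (simp add: nonneg_iff)

lemma one_nonneg: "0 \<le> (1::'a::chilbert_space cop)"
  by (simp add: nonneg_iff)

lemma scal_mono: "r \<le> s \<Longrightarrow> r *\<^sub>R 1 \<le> s *\<^sub>R (1::'a::chilbert_space cop)"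
  by (rule scaleR_right_mono) (simp_all add: one_nonneg)

lemma abs_inner_app_le: "\<bar>inner (a \<cdot> x) x\<bar> \<le> norm a * (norm x)\<^sup>2"
proof -
  have "\<bar>inner (a \<cdot> x) x\<bar> \<le> norm (a \<cdot> x) * norm x" by (rule Cauchy_Schwarz_ineq2)
  also have "\<dots> \<le> norm a * norm x * norm x" by (intro mult_right_mono norm_app) auto
  finally show ?thesis by (simp add: power2_eq_square mult.assoc)
qed

lemma sa_le_norm:
  assumes "adj a = a" "norm a \<le> c"
  shows "a \<le> c *\<^sub>R 1"
proof (subst le_iff)
  have "inner (a \<cdot> x) x \<le> c * (norm x)\<^sup>2" for x
    using abs_inner_app_le[of a x] mult_right_mono[OF assms(2), of "(norm x)\<^sup>2"] by simp
  then show "\<forall>x. inner (a \<cdot> x) x \<le> inner ((c *\<^sub>R 1) \<cdot> x) x"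
    by (simp add: power2_norm_eq_inner)
qed (use assms in auto)

text \<open>The norm of a self-adjoint operator is its numerical radius, by polarization and the
  parallelogram law. The absolute value in the conclusion spares the callers a sign condition on
  \<open>c\<close>.\<close>

lemma norm_le_of_le:
  assumes "- (c *\<^sub>R 1) \<le> a" "a \<le> c *\<^sub>R 1"
  shows "norm (a :: 'a::chilbert_space cop) \<le> \<bar>c\<bar>"
proof -
  have "0 \<le> c *\<^sub>R 1 - a" using assms by simp
  then have "adj (c *\<^sub>R 1 - a) = c *\<^sub>R 1 - a" by (rule nonneg_sa)
  then have sa: "adj a = a" by simp
  have b: "\<bar>inner (a \<cdot> x) x\<bar> \<le> \<bar>c\<bar> * (norm x)\<^sup>2" for x
  proof -
    have "inner (a \<cdot> x) x \<le> c * (norm x)\<^sup>2"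
      using assms(2) by (subst (asm) le_iff) (auto simp: sa power2_norm_eq_inner)
    moreover have "- (c * (norm x)\<^sup>2) \<le> inner (a \<cdot> x) x"
      using assms(1) by (subst (asm) le_iff) (auto simp: sa power2_norm_eq_inner)
    ultimately have "\<bar>inner (a \<cdot> x) x\<bar> \<le> c * (norm x)\<^sup>2" by linarith
    also have "\<dots> \<le> \<bar>c\<bar> * (norm x)\<^sup>2" by (intro mult_right_mono) auto
    finally show ?thesis .
  qed
  show ?thesis
  proof (rule norm_cop_bound)
    fix x
    show "norm (a \<cdot> x) \<le> \<bar>c\<bar> * norm x"
    proof (cases "a \<cdot> x = 0 \<or> x = 0")
      case False
      \<comment> \<open>\<open>a \<cdot> x\<close> rescaled to the length of \<open>x\<close>, so
        that the pairing of \<open>a \<cdot> x\<close> with it is the product of the two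
        norms.\<close>
      define y where "y = (norm x / norm (a \<cdot> x)) *\<^sub>R (a \<cdot> x)"
      have ny: "norm y = norm x" using False by (simp add: y_def)
      have "4 * inner (a \<cdot> x) y = inner (a \<cdot> (x + y)) (x + y) - inner (a \<cdot> (x - y)) (x - y)"
        using inner_adj[of a y x] sa
        by (simp add: app_right_simps inner_add inner_diff inner_commute)
      also have "\<dots> \<le> \<bar>c\<bar> * (norm (x + y))\<^sup>2 + \<bar>c\<bar> * (norm (x - y))\<^sup>2"
        using b[of "x + y"] b[of "x - y"] by linarith
      also have "\<dots> = \<bar>c\<bar> * (2 * (norm x)\<^sup>2 + 2 * (norm y)\<^sup>2)"
        unfolding power2_norm_eq_inner
        by (simp add: inner_add inner_diff inner_commute algebra_simps)
      finally have "inner (a \<cdot> x) y \<le> \<bar>c\<bar> * (norm x)\<^sup>2" by (simp add: ny)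
      moreover have "inner (a \<cdot> x) y = norm x * norm (a \<cdot> x)"
        using False by (simp add: y_def power2_norm_eq_inner[symmetric] power2_eq_square)
      ultimately show ?thesis using False by (simp add: power2_eq_square mult_ac)
    qed (auto simp: app_right_simps)
  qed auto
qed

lemma closed_nonneg: "closed {a :: 'a::chilbert_space cop. 0 \<le> a}"
proof -
  have "{a :: 'a cop. 0 \<le> a} = {a. adj a = a} \<inter> (\<Inter>x. {a. 0 \<le> inner (a \<cdot> x) x})"
    by (auto simp: nonneg_iff)
  moreover have "closed {a :: 'a cop. adj a = a}"
    by (intro closed_Collect_eq continuous_on_id linear_continuous_on bounded_linear_adj)
  moreover have "closed {a :: 'a cop. 0 \<le> inner (a \<cdot> x) x}" for x
    by (intro closed_Collect_le continuous_intros app.continuous_on)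
  ultimately show ?thesis by (auto intro!: closed_Int closed_INT)
qed

lemma tendsto_cop_le:
  fixes f g :: "nat \<Rightarrow> 'a::chilbert_space cop"
  assumes "f \<longlonglongrightarrow> a" "g \<longlonglongrightarrow> b" "\<And>n. f n \<le> g n"
  shows "a \<le> b"
proof -
  have "(\<lambda>n. g n - f n) \<longlonglongrightarrow> b - a" by (intro tendsto_intros assms)
  then have "b - a \<in> {a. 0 \<le> a}"
    by (rule closed_sequentially[OF closed_nonneg, rotated]) (use assms(3) in auto)
  then show ?thesis by simp
qed

section \<open>Invertible operators\<close>

definition unit :: "'h::chilbert_space cop \<Rightarrow> bool" where
  "unit a \<longleftrightarrow> (\<exists>b. a * b = 1 \<and> b * a = 1)"

definition cinv :: "'h::chilbert_space cop \<Rightarrow> 'h cop" where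
  "cinv a = (THE b. a * b = 1 \<and> b * a = 1)"

lemma left_right_inverse: "a * b = 1 \<Longrightarrow> c * a = 1 \<Longrightarrow> b = (c :: 'h::chilbert_space cop)"
  by (metis mult.assoc mult_1_left mult_1_right)

lemma cinv_eq: "a * b = 1 \<Longrightarrow> b * a = 1 \<Longrightarrow> cinv a = b"
  unfolding cinv_def by (rule the_equality) (auto intro: left_right_inverse)

lemma cinv_right: "unit a \<Longrightarrow> a * cinv a = 1"
  using cinv_eq[of a] by (auto simp: unit_def)

lemma cinv_left: "unit a \<Longrightarrow> cinv a * a = 1"
  using cinv_eq[of a] by (auto simp: unit_def)

lemma unit_mult: "unit a \<Longrightarrow> unit b \<Longrightarrow> unit (a * b)"
  unfolding unit_def by (metis mult.assoc mult_1_left)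

lemma cinv_mult: "unit a \<Longrightarrow> unit b \<Longrightarrow> cinv (a * b) = cinv b * cinv a"
proof (rule cinv_eq)
  assume "unit a" "unit b"
  note u = this
  have "a * b * (cinv b * cinv a) = a * (b * cinv b) * cinv a" by (simp only: mult.assoc)
  then show "a * b * (cinv b * cinv a) = 1" using u by (simp add: cinv_right)
  have "cinv b * cinv a * (a * b) = cinv b * (cinv a * a) * b" by (simp only: mult.assoc)
  then show "cinv b * cinv a * (a * b) = 1" using u by (simp add: cinv_left)
qed

lemma cinv_cinv: "unit a \<Longrightarrow> cinv (cinv a) = a"
  by (rule cinv_eq) (auto simp: cinv_left cinv_right)

text \<open>An inverse of the product gives \<open>a\<close> a right inverse and, after commuting
  the factors, a left inverse; the two coincide.\<close>

lemma unit_of_commuting_mult: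
  assumes "a * b = b * a" "unit (a * b)"
  shows "unit a"
proof -
  obtain z where z: "a * b * z = 1" "z * (a * b) = 1" using assms(2) unit_def by blast
  have "a * (b * z) = 1" using z(1) by (simp add: mult.assoc)
  moreover have "(z * b) * a = 1" using z(2) by (simp add: mult.assoc assms(1))
  ultimately show ?thesis using left_right_inverse unit_def by metis
qed

lemma unit_scaleR: "r \<noteq> 0 \<Longrightarrow> unit (r *\<^sub>R a) \<longleftrightarrow> unit a"
proof -
  have *: "unit (s *\<^sub>R b)" if "unit b" "s \<noteq> 0" for b :: "'a cop" and s
    unfolding unit_def using that by (intro exI[of _ "(1/s) *\<^sub>R cinv b"]) (simp add: cinv_left cinv_right)
  show "r \<noteq> 0 \<Longrightarrow> unit (r *\<^sub>R a) \<longleftrightarrow> unit a"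
    using *[of a r] *[of "r *\<^sub>R a" "1/r"] by auto
qed

lemma cinv_scaleR: "r \<noteq> 0 \<Longrightarrow> unit a \<Longrightarrow> cinv (r *\<^sub>R a) = (1/r) *\<^sub>R cinv a"
  by (rule cinv_eq) (auto simp: cinv_left cinv_right)

lemma cinv_one [simp]: "cinv 1 = 1"
  by (rule cinv_eq) auto

lemma adj_cinv: "unit a \<Longrightarrow> adj (cinv a) = cinv (adj a)"
  by (rule cinv_eq[symmetric]) (metis adj_simps(5,6) cinv_left cinv_right)+

lemma norm_power_le: "norm (x ^ n) \<le> norm (x :: 'h::chilbert_space cop) ^ n"
proof (induct n)
  case (Suc n)
  have "norm (x ^ Suc n) \<le> norm x * norm (x ^ n)" by (simp add: norm_mult_ineq)
  also have "\<dots> \<le> norm x * norm x ^ n" by (rule mult_left_mono[OF Suc]) simp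
  finally show ?case by simp
qed (simp add: norm_one_le)

text \<open>The partial sums are part of the conclusion because they exhibit the inverse as a norm
  limit of polynomials in \<open>x\<close>, which later places it in the given operator
  algebra.\<close>

lemma neumann_series:
  fixes x :: "'h::chilbert_space cop"
  assumes "norm x < 1"
  shows "\<exists>b. (\<lambda>n. \<Sum>i<n. x ^ i) \<longlonglongrightarrow> b \<and> (1 - x) * b = 1 \<and> b * (1 - x) = 1"
proof -
  have "summable (\<lambda>n. x ^ n)"
    by (rule summable_comparison_test[of _ "\<lambda>n. norm x ^ n"])
       (use assms norm_power_le in \<open>auto intro!: summable_geometric\<close>)
  then obtain b where b: "(\<lambda>n. \<Sum>i<n. x ^ i) \<longlonglongrightarrow> b" by (auto simp: summable_def sums_def)
  have z: "(\<lambda>n. x ^ n) \<longlonglongrightarrow> 0"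
    by (rule Lim_null_comparison[of _ "\<lambda>n. norm x ^ n"])
       (use assms in \<open>auto intro!: LIMSEQ_power_zero simp: norm_power_le\<close>)
  have l: "(1 - x) * (\<Sum>i<n. x ^ i) = 1 - x ^ n" for n
  proof (induct n)
    case (Suc n)
    have "(1 - x) * (\<Sum>i<Suc n. x ^ i) = (1 - x) * (\<Sum>i<n. x ^ i) + (1 - x) * x ^ n"
      by (simp add: distrib_left)
    then show ?case unfolding Suc by (simp add: left_diff_distrib)
  qed simp
  have r: "(\<Sum>i<n. x ^ i) * (1 - x) = 1 - x ^ n" for n
  proof (induct n)
    case (Suc n)
    have "(\<Sum>i<Suc n. x ^ i) * (1 - x) = (\<Sum>i<n. x ^ i) * (1 - x) + x ^ n * (1 - x)"
      by (simp add: distrib_right)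
    then show ?case unfolding Suc by (simp add: right_diff_distrib power_commutes)
  qed simp
  have lim1: "(\<lambda>n. 1 - x ^ n) \<longlonglongrightarrow> 1 - 0" by (intro tendsto_intros z)
  have "(\<lambda>n. (1 - x) * (\<Sum>i<n. x ^ i)) \<longlonglongrightarrow> (1 - x) * b" by (intro tendsto_intros b)
  then have "(1 - x) * b = 1" using lim1 l by (simp add: LIMSEQ_unique)
  moreover have "(\<lambda>n. (\<Sum>i<n. x ^ i) * (1 - x)) \<longlonglongrightarrow> b * (1 - x)" by (intro tendsto_intros b)
  then have "b * (1 - x) = 1" using lim1 r by (simp add: LIMSEQ_unique)
  ultimately show ?thesis using b by blast
qed

text \<open>The interval from \<alpha> to \<beta> contains the real spectrum
  (\<open>rspec_between\<close>). Functional calculus is used with such an interval as domain, so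
  continuity is checked there and the spectrum itself need not be known.\<close>

definition between :: "'h::chilbert_space cop \<Rightarrow> real \<Rightarrow> real \<Rightarrow> bool" where
  "between a \<alpha> \<beta> \<longleftrightarrow> \<alpha> *\<^sub>R 1 \<le> a \<and> a \<le> \<beta> *\<^sub>R 1"

lemma ge_scal_sa: "\<alpha> *\<^sub>R 1 \<le> a \<Longrightarrow> adj a = a"
  using nonneg_sa[of "a - \<alpha> *\<^sub>R 1"] by simp

lemma between_sa: "between a \<alpha> \<beta> \<Longrightarrow> adj a = a"
  unfolding between_def using ge_scal_sa by blast

lemma sa_between_norm: "adj a = a \<Longrightarrow> norm a \<le> c \<Longrightarrow> between a (- c) c"
  using sa_le_norm[of a c] sa_le_norm[of "- a" c] by (simp add: between_def minus_le_iff)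

text \<open>Division by a bound \<open>M\<close> squeezes \<open>a\<close> between
  \<open>c/M\<close> and 1, so \<open>1 - a/M\<close> has norm at most \<open>1 - c/M\<close> and
  the geometric series inverts \<open>a/M\<close>.\<close>

lemma neumann_positive:
  assumes "0 < c" "c *\<^sub>R 1 \<le> (a :: 'h::chilbert_space cop)"
  shows "\<exists>M>0. \<exists>b. (\<lambda>n. \<Sum>i<n. (1 - (1/M) *\<^sub>R a) ^ i) \<longlonglongrightarrow> b \<and> a * ((1/M) *\<^sub>R b) = 1 \<and> ((1/M) *\<^sub>R b) * a = 1"
proof -
  \<comment> \<open>The maximum with \<open>c\<close> keeps \<open>M\<close> positive and
    \<open>c/M \<le> 1\<close> even on the zero space, where \<open>norm a\<close> is 0.\<close>
  define M where "M = max (norm a) c"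
  have M: "M > 0" "norm a \<le> M" "c \<le> M" using assms by (auto simp: M_def)
  have sa: "adj a = a" using assms(2) by (rule ge_scal_sa)
  have aM: "a \<le> M *\<^sub>R 1" using sa_le_norm[OF sa M(2)] .
  define x where "x = 1 - (1/M) *\<^sub>R a"
  have "(1/M) *\<^sub>R a \<le> (1/M) *\<^sub>R M *\<^sub>R 1" using aM M(1) by (intro scaleR_left_mono) auto
  then have x0: "0 \<le> x" using M(1) by (simp add: x_def)
  have "(1/M) *\<^sub>R c *\<^sub>R 1 \<le> (1/M) *\<^sub>R a" using assms(2) M(1) by (intro scaleR_left_mono) auto
  then have x1: "x \<le> (1 - c/M) *\<^sub>R 1" by (simp add: x_def algebra_simps)
  have "(0::real) \<le> 1 - c/M" using M by simp
  then have "- ((1 - c/M) *\<^sub>R 1) \<le> (0 :: 'h cop)" using scal_mono[of 0 "1 - c/M"] by simp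
  then have "norm x \<le> \<bar>1 - c/M\<bar>" using x0 by (intro norm_le_of_le x1) (rule order_trans)
  also have "\<dots> < 1" using M assms(1) by simp
  finally obtain b where "(\<lambda>n. \<Sum>i<n. x ^ i) \<longlonglongrightarrow> b" "(1 - x) * b = 1" "b * (1 - x) = 1"
    using neumann_series by blast
  moreover have "1 - x = (1/M) *\<^sub>R a" by (simp add: x_def)
  ultimately show ?thesis using M(1) unfolding x_def by (intro exI[of _ M]) auto
qed

lemma unit_positive: "0 < c \<Longrightarrow> c *\<^sub>R 1 \<le> a \<Longrightarrow> unit a"
  using neumann_positive[of c a] unfolding unit_def by blast

section \<open>Spectrum and polynomials\<close>

definition rspec :: "'h::chilbert_space cop \<Rightarrow> real set" where
  "rspec a = {t. \<not> unit (a - t *\<^sub>R 1)}"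

lemma rspec_between: "between a \<alpha> \<beta> \<Longrightarrow> rspec a \<subseteq> {\<alpha>..\<beta>}"
proof (rule subsetI, rule ccontr)
  fix t assume b: "between a \<alpha> \<beta>" and t: "t \<in> rspec a" "t \<notin> {\<alpha>..\<beta>}"
  consider "t < \<alpha>" | "t > \<beta>" using t(2) by force
  then have "unit (a - t *\<^sub>R 1)"
  proof cases
    case 1
    have "(\<alpha> - t) *\<^sub>R 1 \<le> a - t *\<^sub>R 1" using b by (simp add: between_def scaleR_diff_left)
    then show ?thesis using 1 by (intro unit_positive[of "\<alpha> - t"]) auto
  next
    case 2
    have "(t - \<beta>) *\<^sub>R 1 \<le> - (a - t *\<^sub>R 1)" using b by (simp add: between_def scaleR_diff_left)
    then have "unit (- (a - t *\<^sub>R 1))" using 2 by (intro unit_positive[of "t - \<beta>"]) auto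
    then show ?thesis using unit_scaleR[of "-1" "a - t *\<^sub>R 1"] by simp
  qed
  then show False using t(1) by (simp add: rspec_def)
qed

text \<open>After shifting by the real part of \<open>r\<close>, the product of the two conjugate
  factors is \<open>v * v\<close> plus the square of \<open>Im r\<close>, which is bounded below; a
  factor of a commuting invertible product is invertible.\<close>

lemma unit_nonreal:
  assumes "adj a = a" "Im r \<noteq> 0"
  shows "unit (a - cscale r 1)"
proof -
  define v where "v = a - Re r *\<^sub>R 1"
  have v: "adj v = v" using assms(1) by (simp add: v_def)
  have r1: "cscale r 1 = Re r *\<^sub>R (1::'a cop) + cscale (\<i> * Im r) 1"
    using cscale_simps(2)[of "of_real (Re r)" "\<i> * Im r" "1::'a cop"]
    by (simp add: cscale_of_real flip: complex_eq)
  let ?w = "cscale (\<i> * Im r) (1::'a cop)"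
  have "\<i> * Im r * (\<i> * Im r) = of_real (- ((Im r)\<^sup>2))"
    by (simp add: complex_eq_iff power2_eq_square)
  moreover have "?w * ?w = cscale (\<i> * Im r * (\<i> * Im r)) 1"
    by (simp add: cscale_simps)
  ultimately have w: "?w * ?w = - ((Im r)\<^sup>2 *\<^sub>R 1)"
    by (simp only: cscale_of_real scaleR_minus_left)
  have wv: "?w * v = v * ?w" by (simp add: cscale_simps)
  have "(v - ?w) * (v + ?w) = v * v + (v * ?w - ?w * v) - ?w * ?w" by (simp add: algebra_simps)
  then have prod: "(v - ?w) * (v + ?w) = v * v + (Im r)\<^sup>2 *\<^sub>R 1" by (simp add: w wv)
  have "(v + ?w) * (v - ?w) = v * v - (v * ?w - ?w * v) - ?w * ?w" by (simp add: algebra_simps)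
  then have prod': "(v + ?w) * (v - ?w) = v * v + (Im r)\<^sup>2 *\<^sub>R 1" by (simp add: w wv)
  have "(Im r)\<^sup>2 *\<^sub>R 1 \<le> v * v + (Im r)\<^sup>2 *\<^sub>R 1" using adj_mult_nonneg[of v] v by simp
  then have "unit ((v - ?w) * (v + ?w))"
    unfolding prod by (rule unit_positive[rotated]) (use assms(2) in simp)
  moreover have "(v - ?w) * (v + ?w) = (v + ?w) * (v - ?w)" unfolding prod prod' ..
  ultimately have "unit (v - ?w)" by (rule unit_of_commuting_mult[rotated])
  moreover have "v - ?w = a - cscale r 1" unfolding v_def r1 by (rule diff_diff_eq)
  ultimately show ?thesis by simp
qed

section \<open>Polynomials of an operator, spectral mapping and the norm; complex coefficients serve
  the factorization\<close>

definition cpev :: "complex poly \<Rightarrow> 'h::chilbert_space cop \<Rightarrow> 'h cop" where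
  "cpev p a = fold_coeffs (\<lambda>c b. cscale c 1 + a * b) p 0"

lemma cscale_zero [simp]: "cscale 0 a = 0" "cscale c 0 = 0"
  by (rule app_ext, simp)+

lemma cpev_0 [simp]: "cpev 0 a = 0"
  by (simp add: cpev_def)

lemma cpev_pCons: "cpev (pCons c p) a = cscale c 1 + a * cpev p a"
proof (cases "p = 0 \<and> c = 0")
  case False
  then show ?thesis by (cases "c = 0") (auto simp: cpev_def)
qed auto

lemma cpev_add: "cpev (p + q) a = cpev p a + cpev q a"
proof (induct p arbitrary: q)
  case (pCons c p)
  then show ?case
    by (cases q) (simp add: cpev_pCons cscale_simps algebra_simps)
qed simp

lemma cpev_smult: "cpev (smult c p) a = cscale c (cpev p a)"
  by (induct p) (auto simp: cpev_pCons cscale_simps)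

lemma cpev_linear_mult: "cpev ([:- z, 1:] * s) a = (a - cscale z 1) * cpev s a"
proof -
  have "[:- z, 1:] * s = smult (- z) s + pCons 0 s" by simp
  then show ?thesis
    by (simp only: cpev_add cpev_smult cpev_pCons)
       (simp add: cscale_simps cscale_minus algebra_simps)
qed

text \<open>The fundamental theorem of algebra splits off one linear factor at a time, and each
  factor is invertible at \<open>a\<close> by assumption.\<close>

lemma unit_cpev:
  assumes "p \<noteq> 0" "\<And>z. poly p z = 0 \<Longrightarrow> unit (a - cscale z 1)"
  shows "unit (cpev p a)"
  using assms
proof (induct "degree p" arbitrary: p)
  case 0
  then obtain c where c: "p = [:c:]" "c \<noteq> 0" by (metis degree_eq_zeroE pCons_0_0)
  have "unit (cscale c (1::'a cop))"
    unfolding unit_def using c by (intro exI[of _ "cscale (1/c) 1"]) (simp add: cscale_simps cscale_one)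
  then show ?case by (simp add: c cpev_pCons)
next
  case (Suc n)
  then have "\<not> constant (poly p)" by (simp add: constant_degree)
  then obtain z where z: "poly p z = 0" using fundamental_theorem_of_algebra by blast
  then obtain s where s: "p = [:- z, 1:] * s" by (auto simp: poly_eq_0_iff_dvd elim: dvdE)
  have s0: "s \<noteq> 0" using Suc s by auto
  have "degree p = degree [:- z, 1:] + degree s"
    unfolding s by (rule degree_mult_eq) (use s0 in auto)
  then have "degree s = n" using Suc by simp
  then have "unit (cpev s a)" using Suc s s0 by auto
  moreover have "unit (a - cscale z 1)" using Suc z by simp
  ultimately show ?case unfolding s cpev_linear_mult by (rule unit_mult[rotated])
qed

definition rpev :: "real poly \<Rightarrow> 'h::chilbert_space cop \<Rightarrow> 'h cop" where
  "rpev p a = (\<Sum>i\<le>degree p. coeff p i *\<^sub>R a ^ i)"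

lemma rpev_0 [simp]: "rpev 0 a = 0"
  by (simp add: rpev_def)

lemma rpev_pCons: "rpev (pCons c p) a = c *\<^sub>R 1 + a * rpev p a"
proof (cases "p = 0")
  case False
  then show ?thesis
    by (simp add: rpev_def sum.atMost_Suc_shift sum_distrib_left del: sum.atMost_Suc)
qed (simp add: rpev_def)

lemma rpev_add: "rpev (p + q) a = rpev p a + rpev q a"
proof (induct p arbitrary: q)
  case (pCons c p)
  then show ?case
    by (cases q) (simp add: rpev_pCons algebra_simps)
qed simp

lemma rpev_smult: "rpev (smult c p) a = c *\<^sub>R rpev p a"
  by (induct p) (auto simp: rpev_pCons algebra_simps)

lemma rpev_diff: "rpev (p - q) a = rpev p a - rpev q a"
  using rpev_add[of p "smult (-1) q" a] rpev_smult[of "-1" q a] by simp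

lemma rpev_mult: "rpev (p * q) a = rpev p a * rpev q a"
  by (induct p) (auto simp: rpev_pCons rpev_add rpev_smult algebra_simps)

lemma rpev_commute: "a * b = b * a \<Longrightarrow> rpev p a * b = b * rpev p a"
proof (induct p)
  case (pCons c p)
  have "a * rpev p a * b = a * (b * rpev p a)" using pCons by (simp add: mult.assoc)
  also have "\<dots> = (a * b) * rpev p a" by (simp only: mult.assoc)
  also have "\<dots> = b * (a * rpev p a)" by (simp only: pCons.prems mult.assoc)
  finally show ?case by (simp add: rpev_pCons algebra_simps)
qed simp

lemma rpev_sa: "adj a = a \<Longrightarrow> adj (rpev p a) = rpev p a"
  by (simp add: rpev_def adj_sum adj_power)

lemma cpev_of_real: "cpev (map_poly of_real p) a = rpev p a"
  by (induct p) (auto simp: map_poly_pCons cpev_pCons rpev_pCons cscale_of_real)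

text \<open>If no complex root \<open>z\<close> of \<open>q\<close> made \<open>a - z\<close>
  singular, \<open>q(a)\<close> would be a product of units. Such a root is real because
  \<open>a\<close> is self-adjoint. With \<open>q\<close> replaced by \<open>q - l\<close> this is
  the inclusion of the spectrum of \<open>q(a)\<close> in the image of the spectrum of
  \<open>a\<close>.\<close>

lemma spectral_mapping:
  fixes a :: "'h::chilbert_space cop"
  assumes sa: "adj a = a" and nu: "\<not> unit (rpev q a)" and q0: "q \<noteq> 0"
  shows "\<exists>t\<in>rspec a. poly q t = 0"
proof -
  let ?p = "map_poly of_real q :: complex poly"
  have "?p \<noteq> 0" using q0 by (simp add: map_poly_eq_0_iff)
  then obtain z where z: "poly ?p z = 0" "\<not> unit (a - cscale z 1)"
    using unit_cpev[of ?p a] nu by (auto simp: cpev_of_real)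
  then have "Im z = 0" using unit_nonreal[OF sa] by blast
  then have zr: "z = of_real (Re z)" by (simp add: complex_eq_iff)
  have "poly ?p (of_real (Re z)) = of_real (poly q (Re z))"
    by (induct q) (auto simp: map_poly_pCons)
  then have "poly q (Re z) = 0" using z(1) zr by (metis of_real_eq_0_iff)
  moreover have "cscale z (1::'h cop) = Re z *\<^sub>R 1" using zr by (metis cscale_of_real)
  ultimately show ?thesis using z(2) by (intro bexI[of _ "Re z"]) (simp_all add: rspec_def)
qed

text \<open>If both \<open>n = norm b\<close> and \<open>-n\<close> missed the spectrum,
  \<open>D = b * b - n\<^sup>2\<close> would be invertible and so bounded below. Expanding the
  squared norm of \<open>D \<cdot> x\<close> turns this into a uniform bound of
  \<open>norm (b \<cdot> x)\<close> strictly below \<open>n * norm x\<close>. The assumption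
  \<open>1 \<noteq> 0\<close> excludes the zero space, whose operators have empty spectrum.\<close>

lemma norm_in_rspec:
  assumes sa: "adj b = b" and nt: "(1::'h::chilbert_space cop) \<noteq> 0"
  shows "norm (b::'h cop) \<in> rspec b \<or> - norm b \<in> rspec b"
proof (rule ccontr)
  assume neg: "\<not> (norm b \<in> rspec b \<or> - norm b \<in> rspec b)"
  define n where "n = norm b"
  have u: "unit (b - n *\<^sub>R 1)" "unit (b + n *\<^sub>R 1)"
    using neg unfolding rspec_def n_def by simp_all
  have "n \<noteq> 0"
  proof
    assume "n = 0"
    then have "b = 0" by (simp add: n_def)
    then show False using u(1) \<open>n = 0\<close> nt by (simp add: unit_def)
  qed
  then have n0: "n > 0" by (simp add: n_def)
  define D where "D = (b - n *\<^sub>R 1) * (b + n *\<^sub>R 1)"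
  have Deq: "D = b * b - n\<^sup>2 *\<^sub>R 1" by (simp add: D_def algebra_simps power2_eq_square)
  define w where "w = cinv D"
  have wD: "w * D = 1" unfolding w_def D_def by (intro cinv_left unit_mult u)
  define K where "K = (norm w)\<^sup>2"
  have "w \<noteq> 0" using wD nt by auto
  then have K0: "K > 0" by (simp add: K_def)
  have key: "(norm (b \<cdot> x))\<^sup>2 \<le> (n\<^sup>2 - 1 / (K * n\<^sup>2)) * (norm x)\<^sup>2" for x
  proof -
    have "(norm x)\<^sup>2 = (norm (w \<cdot> D \<cdot> x))\<^sup>2" by (metis app_simps(2,7) wD)
    also have "\<dots> \<le> (norm w * norm (D \<cdot> x))\<^sup>2" by (intro power_mono norm_app) auto
    also have "\<dots> = K * (norm (D \<cdot> x))\<^sup>2" by (simp add: K_def power_mult_distrib)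
    also have "(norm (D \<cdot> x))\<^sup>2 = (norm (b \<cdot> b \<cdot> x))\<^sup>2 - 2 * n\<^sup>2 * inner (b \<cdot> b \<cdot> x) x + n\<^sup>2 * n\<^sup>2 * (norm x)\<^sup>2"
      unfolding Deq power2_norm_eq_inner
      by (simp add: inner_diff_left inner_diff_right inner_commute algebra_simps)
    also have "inner (b \<cdot> b \<cdot> x) x = (norm (b \<cdot> x))\<^sup>2" using norm_app_sq[of b x] sa by simp
    also have "(norm (b \<cdot> b \<cdot> x))\<^sup>2 \<le> (n * norm (b \<cdot> x))\<^sup>2"
      unfolding n_def by (intro power_mono norm_app) auto
    finally have "(norm x)\<^sup>2 \<le> K * ((n * norm (b \<cdot> x))\<^sup>2 - 2 * n\<^sup>2 * (norm (b \<cdot> x))\<^sup>2 + n\<^sup>2 * n\<^sup>2 * (norm x)\<^sup>2)"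
      using K0 by (simp add: mult_left_mono)
    also have "\<dots> = K * n\<^sup>2 * (n\<^sup>2 * (norm x)\<^sup>2 - (norm (b \<cdot> x))\<^sup>2)"
      by (simp add: algebra_simps power2_eq_square)
    finally have "(norm x)\<^sup>2 / (K * n\<^sup>2) \<le> n\<^sup>2 * (norm x)\<^sup>2 - (norm (b \<cdot> x))\<^sup>2"
      using K0 n0 by (simp add: divide_le_eq mult.commute)
    then show ?thesis by (simp add: algebra_simps)
  qed
  \<comment> \<open>Truncated at 0 so that it has a square root; it is still smaller than the square
    of \<open>n\<close>.\<close>
  define m where "m = max 0 (n\<^sup>2 - 1 / (K * n\<^sup>2))"
  have "norm b \<le> sqrt m"
  proof (rule norm_cop_bound)
    fix x
    have "(norm (b \<cdot> x))\<^sup>2 \<le> m * (norm x)\<^sup>2"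
      using key[of x] by (rule order_trans) (auto simp: m_def intro!: mult_right_mono)
    also have "\<dots> = (sqrt m * norm x)\<^sup>2" by (simp add: power_mult_distrib m_def)
    finally show "norm (b \<cdot> x) \<le> sqrt m * norm x" by (rule power2_le_imp_le) (simp add: m_def)
  qed (simp add: m_def)
  then have "n\<^sup>2 \<le> m" unfolding n_def by (metis m_def max.cobounded1 norm_ge_zero power_mono real_sqrt_pow2)
  moreover have "m < n\<^sup>2" using n0 K0 by (simp add: m_def)
  ultimately show False by simp
qed

text \<open>Plus or minus the norm of the self-adjoint \<open>q(a)\<close> lies in its spectrum,
  hence is a value of \<open>q\<close> on the spectrum of \<open>a\<close>. This estimate is what
  makes the functional calculus converge.\<close>

lemma norm_rpev:
  assumes sa: "adj a = a" and c: "0 \<le> c" "\<And>t. t \<in> rspec a \<Longrightarrow> \<bar>poly q t\<bar> \<le> c"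
  shows "norm (rpev q (a::'h::chilbert_space cop)) \<le> c"
proof (cases "(1::'h cop) = 0")
  case True
  then have "rpev q a = 0" using mult_1_left[of "rpev q a"] by simp
  then show ?thesis using c(1) by simp
next
  case False
  have ne: "rspec a \<noteq> {}" using norm_in_rspec[OF sa False] by auto
  have "\<exists>t\<in>rspec a. poly q t = l" if l: "l \<in> rspec (rpev q a)" for l
  proof (cases "q = [:l:]")
    case True then show ?thesis using ne by auto
  next
    case nq: False
    have "rpev (q - [:l:]) a = rpev q a - l *\<^sub>R 1" by (simp add: rpev_diff rpev_pCons)
    then show ?thesis
      using spectral_mapping[OF sa, of "q - [:l:]"] l nq by (auto simp: rspec_def)
  qed
  then have bound: "\<bar>l\<bar> \<le> c" if "l \<in> rspec (rpev q a)" for l using that c(2) by blast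
  from norm_in_rspec[OF rpev_sa[OF sa] False, of q] show ?thesis
    using bound[of "norm (rpev q a)"] bound[of "- norm (rpev q a)"] by auto
qed

section \<open>Continuous functional calculus\<close>

text \<open>Copies the shape of \<open>fun_calc\<close>, limits along all approximating sequences
  included, so that the two can be identified without reworking the description.\<close>

definition fc :: "(real \<Rightarrow> real) \<Rightarrow> 'h::chilbert_space cop \<Rightarrow> 'h cop" where
  "fc f a = (THE b. \<forall>p :: nat \<Rightarrow> real poly.
     uniform_limit (rspec a) (\<lambda>n. poly (p n)) f sequentially \<longrightarrow> (\<lambda>n. rpev (p n) a) \<longlonglongrightarrow> b)"

text \<open>Two approximating sequences differ uniformly little on the spectrum, hence little in
  norm; this is why the limit in \<open>fc\<close> depends on \<open>f\<close> alone.\<close>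

lemma rpev_diff_tendsto_0:
  assumes sa: "adj a = a"
    and p: "uniform_limit (rspec a) (\<lambda>n. poly (p n)) f sequentially"
    and q: "uniform_limit (rspec a) (\<lambda>n. poly (q n)) f sequentially"
  shows "(\<lambda>n. rpev (p n) a - rpev (q n) a) \<longlonglongrightarrow> 0"
proof (rule tendstoI)
  fix e :: real assume e: "0 < e"
  have "\<forall>\<^sub>F n in sequentially. \<forall>x\<in>rspec a. dist (poly (p n) x) (f x) < e/4"
    "\<forall>\<^sub>F n in sequentially. \<forall>x\<in>rspec a. dist (poly (q n) x) (f x) < e/4"
    using uniform_limitD[OF p, of "e/4"] uniform_limitD[OF q, of "e/4"] e by simp_all
  then show "\<forall>\<^sub>F n in sequentially. dist (rpev (p n) a - rpev (q n) a) 0 < e"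
  proof eventually_elim
    case (elim n)
    have "norm (rpev (p n - q n) a) \<le> e/2"
    proof (rule norm_rpev[OF sa])
      fix t assume "t \<in> rspec a"
      then have "\<bar>poly (p n) t - f t\<bar> < e/4" "\<bar>poly (q n) t - f t\<bar> < e/4"
        using elim by (auto simp: dist_real_def)
      then show "\<bar>poly (p n - q n) t\<bar> \<le> e/2" by (simp add: abs_if split: if_splits)
    qed (use e in auto)
    then show ?case using e by (simp add: rpev_diff)
  qed
qed

lemma rpev_Cauchy:
  assumes sa: "adj a = a"
    and p: "uniform_limit (rspec a) (\<lambda>n. poly (p n)) f sequentially"
  shows "convergent (\<lambda>n. rpev (p n) a)"
proof -
  have "Cauchy (\<lambda>n. rpev (p n) a)"
  proof (rule metric_CauchyI)
    fix e :: real assume e: "0 < e"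
    then obtain N where N: "\<And>n x. n \<ge> N \<Longrightarrow> x \<in> rspec a \<Longrightarrow> \<bar>poly (p n) x - f x\<bar> < e/4"
      using p unfolding uniform_limit_sequentially_iff dist_real_def
      by (metis divide_pos_pos zero_less_numeral)
    have "dist (rpev (p m) a) (rpev (p n) a) < e" if "m \<ge> N" "n \<ge> N" for m n
    proof -
      have "norm (rpev (p m - p n) a) \<le> e/2"
      proof (rule norm_rpev[OF sa])
        fix t assume "t \<in> rspec a"
        then have "\<bar>poly (p m) t - f t\<bar> < e/4" "\<bar>poly (p n) t - f t\<bar> < e/4" using N that by auto
        then show "\<bar>poly (p m - p n) t\<bar> \<le> e/2" by (simp add: abs_if split: if_splits)
      qed (use e in auto)
      then show ?thesis using e by (simp add: rpev_diff dist_norm)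
    qed
    then show "\<exists>M. \<forall>m\<ge>M. \<forall>n\<ge>M. dist (rpev (p m) a) (rpev (p n) a) < e" by blast
  qed
  then show ?thesis by (rule Cauchy_convergent)
qed

lemma fc_tendsto:
  assumes sa: "adj a = a"
    and p: "uniform_limit (rspec a) (\<lambda>n. poly (p n)) f sequentially"
  shows "(\<lambda>n. rpev (p n) a) \<longlonglongrightarrow> fc f a"
proof -
  obtain b where b: "(\<lambda>n. rpev (p n) a) \<longlonglongrightarrow> b" using rpev_Cauchy[OF sa p] convergent_def by blast
  have "(\<lambda>n. rpev (q n) a) \<longlonglongrightarrow> b"
    if q: "uniform_limit (rspec a) (\<lambda>n. poly (q n)) f sequentially" for q
    using tendsto_add[OF rpev_diff_tendsto_0[OF sa q p] b] by simp
  then have "fc f a = b"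
    unfolding fc_def using p b by (intro the_equality) (auto intro: LIMSEQ_unique)
  then show ?thesis using b by simp
qed

lemma poly_approx:
  assumes "continuous_on {\<alpha>..\<beta>::real} f"
  shows "\<exists>p. uniform_limit {\<alpha>..\<beta>} (\<lambda>n. poly (p n)) f sequentially"
proof -
  have "\<exists>p. \<forall>x\<in>{\<alpha>..\<beta>}. \<bar>f x - poly p x\<bar> < e" if e: "0 < e" for e
  proof -
    obtain g where g: "real_polynomial_function g" "\<And>x. x \<in> {\<alpha>..\<beta>} \<Longrightarrow> \<bar>f x - g x\<bar> < e"
      using Stone_Weierstrass_real_polynomial_function[OF _ assms e] by auto
    obtain c n where "g = (\<lambda>x. \<Sum>i\<le>(n::nat). c i * x ^ i)"
      using g(1) real_polynomial_function_iff_sum by auto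
    then have "g x = poly (\<Sum>i\<le>n. monom (c i) i) x" for x by (simp add: poly_sum poly_monom)
    then show ?thesis using g(2) by (intro exI[of _ "\<Sum>i\<le>n. monom (c i) i"]) auto
  qed
  then have "\<exists>p. \<forall>x\<in>{\<alpha>..\<beta>}. \<bar>f x - poly p x\<bar> < 1 / real (Suc n)" for n by simp
  then obtain p where p: "\<And>n x. x \<in> {\<alpha>..\<beta>} \<Longrightarrow> \<bar>f x - poly (p n) x\<bar> < 1 / real (Suc n)" by metis
  have "uniform_limit {\<alpha>..\<beta>} (\<lambda>n. poly (p n)) f sequentially"
    unfolding uniform_limit_sequentially_iff
  proof (intro allI impI)
    fix e :: real assume "0 < e"
    then obtain N where N: "1 / real (Suc N) < e" using nat_approx_posE by blast
    have "dist (poly (p n) x) (f x) < e" if "n \<ge> N" "x \<in> {\<alpha>..\<beta>}" for n x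
    proof -
      have "dist (poly (p n) x) (f x) < 1 / real (Suc n)"
        using p[OF that(2), of n] by (simp add: dist_real_def abs_minus_commute)
      also have "\<dots> \<le> 1 / real (Suc N)" using that by (intro divide_left_mono) auto
      finally show ?thesis using N by simp
    qed
    then show "\<exists>N. \<forall>n\<ge>N. \<forall>x\<in>{\<alpha>..\<beta>}. dist (poly (p n) x) (f x) < e" by blast
  qed
  then show ?thesis by blast
qed

lemma fc_lim:
  assumes b: "between a \<alpha> \<beta>" and p: "uniform_limit {\<alpha>..\<beta>} (\<lambda>n. poly (p n)) f sequentially"
  shows "(\<lambda>n. rpev (p n) a) \<longlonglongrightarrow> fc f a"
  using fc_tendsto[OF between_sa[OF b] uniform_limit_on_subset[OF p rspec_between[OF b]]] .

lemma fc_poly: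
  assumes "adj a = a"
  shows "fc (poly q) a = rpev q a"
proof -
  have "uniform_limit (rspec a) (\<lambda>n. poly q) (poly q) sequentially"
    by (rule uniform_limitI) simp
  from fc_tendsto[OF assms this] show ?thesis by (simp add: LIMSEQ_const_iff)
qed

lemma fc_cong_rspec:
  assumes "\<And>x. x \<in> rspec a \<Longrightarrow> f x = g x"
  shows "fc f a = fc g a"
proof -
  have "uniform_limit (rspec a) h f sequentially \<longleftrightarrow> uniform_limit (rspec a) h g sequentially"
    for h :: "nat \<Rightarrow> real \<Rightarrow> real"
    by (rule uniform_limit_cong') (auto simp: assms)
  then show ?thesis unfolding fc_def by simp
qed

lemma fc_cong: "between a \<alpha> \<beta> \<Longrightarrow> (\<And>x. \<alpha> \<le> x \<Longrightarrow> x \<le> \<beta> \<Longrightarrow> f x = g x) \<Longrightarrow> fc f a = fc g a"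
  using rspec_between[of a \<alpha> \<beta>] by (intro fc_cong_rspec) auto

context
  fixes a :: "'h::chilbert_space cop" and \<alpha> \<beta> :: real
  assumes btw: "between a \<alpha> \<beta>"
begin

lemma fc_id: "fc (\<lambda>x. x) a = a"
proof -
  have "poly [:0, 1:] = (\<lambda>x::real. x)" by (rule ext) simp
  then show ?thesis
    using fc_poly[OF between_sa[OF btw], of "[:0, 1:]"] by (simp add: rpev_pCons)
qed

lemma fc_const: "fc (\<lambda>x. c) a = c *\<^sub>R 1"
proof -
  have "poly [:c:] = (\<lambda>x. c)" by (rule ext) simp
  then show ?thesis
    using fc_poly[OF between_sa[OF btw], of "[:c:]"] by (simp add: rpev_pCons)
qed

lemma fc_add:
  assumes "continuous_on {\<alpha>..\<beta>} f" "continuous_on {\<alpha>..\<beta>} g"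
  shows "fc (\<lambda>x. f x + g x) a = fc f a + fc g a"
proof -
  obtain p q where p: "uniform_limit {\<alpha>..\<beta>} (\<lambda>n. poly (p n)) f sequentially"
    and q: "uniform_limit {\<alpha>..\<beta>} (\<lambda>n. poly (q n)) g sequentially"
    using poly_approx assms by blast
  have "uniform_limit {\<alpha>..\<beta>} (\<lambda>n x. poly (p n + q n) x) (\<lambda>x. f x + g x) sequentially"
    using uniform_limit_add[OF p q] by (simp only: poly_add)
  from fc_lim[OF btw this] have "(\<lambda>n. rpev (p n + q n) a) \<longlonglongrightarrow> fc (\<lambda>x. f x + g x) a" .
  moreover have "(\<lambda>n. rpev (p n + q n) a) \<longlonglongrightarrow> fc f a + fc g a"
    unfolding rpev_add by (intro tendsto_intros fc_lim[OF btw] p q)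
  ultimately show ?thesis by (rule LIMSEQ_unique)
qed

lemma fc_mult:
  assumes "continuous_on {\<alpha>..\<beta>} f" "continuous_on {\<alpha>..\<beta>} g"
  shows "fc (\<lambda>x. f x * g x) a = fc f a * fc g a"
proof -
  obtain p q where p: "uniform_limit {\<alpha>..\<beta>} (\<lambda>n. poly (p n)) f sequentially"
    and q: "uniform_limit {\<alpha>..\<beta>} (\<lambda>n. poly (q n)) g sequentially"
    using poly_approx assms by blast
  have "uniform_limit {\<alpha>..\<beta>} (\<lambda>n x. poly (p n) x * poly (q n) x) (\<lambda>x. f x * g x) sequentially"
    using assms by (intro uniform_lim_mult p q compact_imp_bounded compact_continuous_image) auto
  then have "uniform_limit {\<alpha>..\<beta>} (\<lambda>n x. poly (p n * q n) x) (\<lambda>x. f x * g x) sequentially" by (simp only: poly_mult)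
  from fc_lim[OF btw this] have "(\<lambda>n. rpev (p n * q n) a) \<longlonglongrightarrow> fc (\<lambda>x. f x * g x) a" .
  moreover have "(\<lambda>n. rpev (p n * q n) a) \<longlonglongrightarrow> fc f a * fc g a"
    unfolding rpev_mult by (intro tendsto_intros fc_lim[OF btw] p q)
  ultimately show ?thesis by (rule LIMSEQ_unique)
qed

lemma fc_scaleR:
  assumes "continuous_on {\<alpha>..\<beta>} f"
  shows "fc (\<lambda>x. c * f x) a = c *\<^sub>R fc f a"
  using fc_mult[OF _ assms, of "\<lambda>x. c"] by (simp add: fc_const)

lemma fc_diff:
  assumes "continuous_on {\<alpha>..\<beta>} f" "continuous_on {\<alpha>..\<beta>} g"
  shows "fc (\<lambda>x. f x - g x) a = fc f a - fc g a"
  using fc_add[OF assms(1), of "\<lambda>x. -1 * g x"] fc_scaleR[OF assms(2), of "-1"] assms(2)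
  by (simp add: continuous_on_minus)

lemma fc_sa:
  assumes "continuous_on {\<alpha>..\<beta>} f"
  shows "adj (fc f a) = fc f a"
proof -
  obtain p where p: "uniform_limit {\<alpha>..\<beta>} (\<lambda>n. poly (p n)) f sequentially"
    using poly_approx assms by blast
  have "(\<lambda>n. adj (rpev (p n) a)) \<longlonglongrightarrow> adj (fc f a)" by (intro tendsto_intros fc_lim[OF btw] p)
  then show ?thesis using fc_lim[OF btw p] between_sa[OF btw] by (simp add: rpev_sa LIMSEQ_unique)
qed

lemma fc_commute:
  assumes "continuous_on {\<alpha>..\<beta>} f" "a * b = b * a"
  shows "fc f a * b = b * fc f a"
proof -
  obtain p where p: "uniform_limit {\<alpha>..\<beta>} (\<lambda>n. poly (p n)) f sequentially"
    using poly_approx assms by blast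
  have "(\<lambda>n. rpev (p n) a * b) \<longlonglongrightarrow> fc f a * b" "(\<lambda>n. b * rpev (p n) a) \<longlonglongrightarrow> b * fc f a"
    by (intro tendsto_intros fc_lim[OF btw] p)+
  then show ?thesis using assms(2) by (simp add: rpev_commute LIMSEQ_unique)
qed

text \<open>The function has a continuous square root, so its value at \<open>a\<close> has the form
  \<open>adj b * b\<close>.\<close>

lemma fc_nonneg:
  assumes "continuous_on {\<alpha>..\<beta>} f" "\<And>x. \<alpha> \<le> x \<Longrightarrow> x \<le> \<beta> \<Longrightarrow> 0 \<le> f x"
  shows "0 \<le> fc f a"
proof -
  let ?g = "\<lambda>x. sqrt (f x)"
  have g: "continuous_on {\<alpha>..\<beta>} ?g" using assms(1) by (intro continuous_intros)
  have "fc f a = fc (\<lambda>x. ?g x * ?g x) a" using assms(2) by (intro fc_cong[OF btw]) simp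
  also have "\<dots> = adj (fc ?g a) * fc ?g a" by (simp only: fc_mult[OF g g] fc_sa[OF g])
  finally show ?thesis by (simp add: adj_mult_nonneg)
qed

lemma fc_mono:
  assumes "continuous_on {\<alpha>..\<beta>} f" "continuous_on {\<alpha>..\<beta>} g"
    "\<And>x. \<alpha> \<le> x \<Longrightarrow> x \<le> \<beta> \<Longrightarrow> f x \<le> g x"
  shows "fc f a \<le> fc g a"
  using fc_nonneg[of "\<lambda>x. g x - f x"] assms fc_diff[OF assms(2,1)] by (simp add: continuous_on_diff)

lemma fc_between:
  assumes "continuous_on {\<alpha>..\<beta>} f" "\<And>x. \<alpha> \<le> x \<Longrightarrow> x \<le> \<beta> \<Longrightarrow> \<gamma> \<le> f x \<and> f x \<le> \<delta>"
  shows "between (fc f a) \<gamma> \<delta>"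
  unfolding between_def fc_const[symmetric] using assms by (intro conjI fc_mono) auto

lemma rpev_fc:
  assumes "continuous_on {\<alpha>..\<beta>} f"
  shows "rpev p (fc f a) = fc (\<lambda>x. poly p (f x)) a"
proof (induct p)
  case (pCons c p)
  have "continuous_on {\<alpha>..\<beta>} (\<lambda>x. poly p (f x))" using assms by (intro continuous_intros)
  then show ?case using pCons assms
    by (simp add: rpev_pCons fc_add fc_mult fc_const continuous_on_mult)
qed (simp add: fc_const)

lemma fc_norm_le:
  assumes "continuous_on {\<alpha>..\<beta>} f" "\<And>x. \<alpha> \<le> x \<Longrightarrow> x \<le> \<beta> \<Longrightarrow> \<bar>f x\<bar> \<le> c" "0 \<le> c"
  shows "norm (fc f a) \<le> c"
proof -
  have "between (fc f a) (- c) c" using assms(2) by (intro fc_between assms(1)) (simp add: abs_le_iff minus_le_iff)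
  then show ?thesis using norm_le_of_le[of c "fc f a"] assms(3) by (simp add: between_def)
qed

text \<open>Polynomials that approximate \<open>g\<close> remain uniform approximations after
  substituting \<open>f\<close>, and for polynomials the rule is algebra.\<close>

lemma fc_comp:
  assumes f: "continuous_on {\<alpha>..\<beta>} f" "\<And>x. \<alpha> \<le> x \<Longrightarrow> x \<le> \<beta> \<Longrightarrow> \<gamma> \<le> f x \<and> f x \<le> \<delta>"
    and g: "continuous_on {\<gamma>..\<delta>} g"
  shows "fc g (fc f a) = fc (\<lambda>x. g (f x)) a"
proof -
  have gf: "continuous_on {\<alpha>..\<beta>} (\<lambda>x. g (f x))"
    using f by (intro continuous_on_compose2[OF g]) auto
  obtain p where p: "uniform_limit {\<gamma>..\<delta>} (\<lambda>n. poly (p n)) g sequentially"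
    using poly_approx g by blast
  have 1: "(\<lambda>n. rpev (p n) (fc f a)) \<longlonglongrightarrow> fc g (fc f a)"
    by (rule fc_lim[OF fc_between[OF f] p])
  have "(\<lambda>n. rpev (p n) (fc f a)) \<longlonglongrightarrow> fc (\<lambda>x. g (f x)) a"
  proof (rule tendstoI)
    fix e :: real assume e: "0 < e"
    then have "\<forall>\<^sub>F n in sequentially. \<forall>x\<in>{\<gamma>..\<delta>}. dist (poly (p n) x) (g x) < e/2"
      using uniform_limitD[OF p, of "e/2"] by simp
    then show "\<forall>\<^sub>F n in sequentially. dist (rpev (p n) (fc f a)) (fc (\<lambda>x. g (f x)) a) < e"
    proof eventually_elim
      case (elim n)
      have c: "continuous_on {\<alpha>..\<beta>} (\<lambda>x. poly (p n) (f x))" using f(1) by (intro continuous_intros)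
      have "norm (fc (\<lambda>x. poly (p n) (f x) - g (f x)) a) \<le> e/2"
      proof (rule fc_norm_le[OF continuous_on_diff[OF c gf]])
        fix x assume "\<alpha> \<le> x" "x \<le> \<beta>"
        then have "dist (poly (p n) (f x)) (g (f x)) < e/2" using elim f(2) by auto
        then show "\<bar>poly (p n) (f x) - g (f x)\<bar> \<le> e/2" by (simp add: dist_real_def)
      qed (use e in simp)
      then show ?case using e by (simp add: fc_diff[OF c gf] rpev_fc[OF f(1)] dist_norm)
    qed
  qed
  with 1 show ?thesis by (rule LIMSEQ_unique)
qed

end

section \<open>Von Neumann algebras\<close>

lemma sa_of_inner:
  assumes "\<And>x y. inner (a \<cdot> x) y = inner x (a \<cdot> y)"
  shows "adj a = a"
proof (rule app_ext)
  fix y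
  have "inner x (adj a \<cdot> y) = inner x (a \<cdot> y)" for x using assms inner_adj[of a x y] by simp
  then have "inner (adj a \<cdot> y - a \<cdot> y) (adj a \<cdot> y - a \<cdot> y) = 0"
    by (simp add: inner_diff_right)
  then show "adj a \<cdot> y = a \<cdot> y" by simp
qed

text \<open>The nearest point is characterized by orthogonality of the remainder. Its uniqueness
  gives additivity, and the stability of \<open>M\<close> under complex scalars gives
  complex-linearity.\<close>

lemma orthogonal_projection_exists:
  fixes M :: "'h::chilbert_space set"
  assumes M: "subspace M" "closed M" and MC: "\<And>c x. x \<in> M \<Longrightarrow> c *\<^sub>C x \<in> M"
  obtains q where "adj q = q" "q * q = q" "\<And>x. q \<cdot> x \<in> M" "\<And>x. x \<in> M \<Longrightarrow> q \<cdot> x = x"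
proof -
  obtain P where P: "\<And>x. P x \<in> M" "\<And>x z. z \<in> M \<Longrightarrow> inner (x - P x) z = 0"
    using hilbert_projection[OF M] by metis
  have uniq: "P x = y" if y: "y \<in> M" and o: "\<And>z. z \<in> M \<Longrightarrow> inner (x - y) z = 0" for x y
  proof -
    have d: "P x - y \<in> M" using y P(1) M(1) by (simp add: subspace_diff)
    have "inner (P x - y) (P x - y) = inner (x - y) (P x - y) - inner (x - P x) (P x - y)"
      by (simp add: inner_diff_left)
    then show ?thesis using o[OF d] P(2)[OF d, of x] by simp
  qed
  have addP: "P (x + y) = P x + P y" for x y
  proof (rule uniq)
    show "P x + P y \<in> M" using P(1) M(1) by (simp add: subspace_add)
    show "inner (x + y - (P x + P y)) z = 0" if "z \<in> M" for z
      using P(2)[OF that, of x] P(2)[OF that, of y] by (simp add: inner_diff_left inner_add_left)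
  qed
  have cP: "P (c *\<^sub>C x) = c *\<^sub>C P x" for c x
  proof (rule uniq)
    show "c *\<^sub>C P x \<in> M" using P(1) MC by simp
    show "inner (c *\<^sub>C x - c *\<^sub>C P x) z = 0" if z: "z \<in> M" for z
    proof -
      have "c *\<^sub>C x - c *\<^sub>C P x = c *\<^sub>C (x - P x)"
        using scaleC_add_right[of c "x - P x" "P x"] by simp
      then have "inner (c *\<^sub>C x - c *\<^sub>C P x) z = inner (x - P x) (cnj c *\<^sub>C z)"
        by (simp add: inner_eq_Re_cinner cinner_scaleC_left cinner_scaleC_right)
      then show ?thesis using P(2) MC[OF z] by simp
    qed
  qed
  have bl: "bounded_linear P"
  proof (rule bounded_linear_intro[where K = 1])
    show "P (x + y) = P x + P y" for x y by (rule addP)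
    show "P (r *\<^sub>R x) = r *\<^sub>R P x" for r x using cP[of "of_real r" x] by (simp add: scaleC_of_real)
    show "norm (P x) \<le> norm x * 1" for x
    proof -
      have "(norm (P x))\<^sup>2 = inner x (P x)"
        using P(2)[OF P(1)[of x], of x] by (simp add: inner_diff_left power2_norm_eq_inner)
      also have "\<dots> \<le> norm x * norm (P x)" by (rule norm_cauchy_schwarz)
      finally show ?thesis by (cases "norm (P x) = 0") (simp_all add: power2_eq_square)
    qed
  qed
  define q where "q = Cop (Blinfun P)"
  have q: "q \<cdot> x = P x" for x
  proof -
    have "complex_linear_op (Blinfun P)"
      by (simp add: complex_linear_op_def bounded_linear_Blinfun_apply[OF bl] cP)
    then show ?thesis
      by (simp add: q_def app.rep_eq Cop_inverse bounded_linear_Blinfun_apply[OF bl])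
  qed
  have fixM: "P x = x" if "x \<in> M" for x using that by (intro uniq) auto
  show ?thesis
  proof
    show "adj q = q"
    proof (rule sa_of_inner)
      fix x y
      have "inner (P x) y - inner (P x) (P y) = inner (y - P y) (P x)"
        by (simp add: inner_diff_right inner_commute[of "y - P y" "P x"])
      then have "inner (q \<cdot> x) y = inner (P x) (P y)" using P(2)[OF P(1)[of x], of y] by (simp add: q)
      moreover have "inner x (q \<cdot> y) = inner (P x) (P y)"
        using P(2)[OF P(1)[of y], of x] by (simp add: q inner_diff_left)
      ultimately show "inner (q \<cdot> x) y = inner x (q \<cdot> y)" by simp
    qed
    show "q * q = q" by (rule app_ext) (simp add: q fixM P(1))
  qed (auto simp: q P(1) fixM)
qed

lemma projection_nonneg: "adj p = p \<Longrightarrow> p * p = p \<Longrightarrow> 0 \<le> p"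
  using adj_mult_nonneg[of p] by simp

lemma projection_le: "adj p = p \<Longrightarrow> p * p = p \<Longrightarrow> adj e = e \<Longrightarrow> e * e = e \<Longrightarrow> e * p = p \<Longrightarrow> p \<le> e"
proof -
  assume h: "adj p = p" "p * p = p" "adj e = e" "e * e = e" "e * p = p"
  have "p * e = p" using h adj_simps(6)[of e p] by simp
  then have "0 \<le> e - p" using h by (intro projection_nonneg) (simp_all add: algebra_simps)
  then show "p \<le> e" by simp
qed

text \<open>Strong closure is phrased through basic neighbourhoods, finitely many vectors and one
  tolerance. Operators known only as strong limits are shown to lie in \<open>R\<close> by producing
  approximants for each such neighbourhood.\<close>

locale vn_alg =
  fixes R :: "'h::chilbert_space cop set"
  assumes one_in: "1 \<in> R"
    and add_in: "a \<in> R \<Longrightarrow> b \<in> R \<Longrightarrow> a + b \<in> R"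
    and cscale_in: "a \<in> R \<Longrightarrow> cscale c a \<in> R"
    and mult_in: "a \<in> R \<Longrightarrow> b \<in> R \<Longrightarrow> a * b \<in> R"
    and adj_in: "a \<in> R \<Longrightarrow> adj a \<in> R"
    and sot_closed: "(\<And>F e. finite F \<Longrightarrow> 0 < e \<Longrightarrow> \<exists>b\<in>R. \<forall>x\<in>F. norm (b \<cdot> x - a \<cdot> x) < e) \<Longrightarrow> a \<in> R"
begin

lemma scaleR_in: "a \<in> R \<Longrightarrow> r *\<^sub>R a \<in> R"
  using cscale_in[of a "of_real r"] by (simp add: cscale_of_real)

lemma zero_in: "0 \<in> R"
  using scaleR_in[OF one_in, of 0] by simp

lemma uminus_in: "a \<in> R \<Longrightarrow> - a \<in> R"
  using scaleR_in[of a "-1"] by simp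

lemma diff_in: "a \<in> R \<Longrightarrow> b \<in> R \<Longrightarrow> a - b \<in> R"
  using add_in[of a "- b"] uminus_in[of b] by simp

lemma power_in: "a \<in> R \<Longrightarrow> a ^ n \<in> R"
  by (induct n) (simp_all add: one_in mult_in)

lemma sum_in: "(\<And>i. i \<in> I \<Longrightarrow> f i \<in> R) \<Longrightarrow> sum f I \<in> R"
  by (induct I rule: infinite_finite_induct) (simp_all add: zero_in add_in)

lemmas alg_in = one_in add_in cscale_in mult_in adj_in scaleR_in zero_in uminus_in diff_in power_in

lemma lim_in:
  assumes "\<And>n. f n \<in> R" "f \<longlonglongrightarrow> a"
  shows "a \<in> R"
proof (rule sot_closed)
  fix F :: "'h set" and e :: real assume F: "finite F" and e: "0 < e"
  have "\<forall>\<^sub>F n in sequentially. norm (f n \<cdot> x - a \<cdot> x) < e" for x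
  proof -
    have "(\<lambda>n. f n \<cdot> x) \<longlonglongrightarrow> a \<cdot> x" by (intro app.tendsto assms(2) tendsto_const)
    from tendstoD[OF this e] show ?thesis by (simp add: dist_norm)
  qed
  then have "\<forall>\<^sub>F n in sequentially. \<forall>x\<in>F. norm (f n \<cdot> x - a \<cdot> x) < e"
    using F by (intro eventually_ball_finite) auto
  then obtain n where "\<forall>x\<in>F. norm (f n \<cdot> x - a \<cdot> x) < e"
    using eventually_happens'[OF sequentially_bot] by blast
  then show "\<exists>b\<in>R. \<forall>x\<in>F. norm (b \<cdot> x - a \<cdot> x) < e" using assms(1) by blast
qed

lemma rpev_in: "a \<in> R \<Longrightarrow> rpev p a \<in> R"
  unfolding rpev_def by (intro sum_in scaleR_in power_in)

lemma fc_in: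
  assumes "a \<in> R" "between a \<alpha> \<beta>" "continuous_on {\<alpha>..\<beta>} f"
  shows "fc f a \<in> R"
proof -
  obtain p where "uniform_limit {\<alpha>..\<beta>} (\<lambda>n. poly (p n)) f sequentially"
    using poly_approx[OF assms(3)] by blast
  from fc_lim[OF assms(2) this] show ?thesis by (rule lim_in[rotated]) (rule rpev_in[OF assms(1)])
qed

lemma cinv_in:
  assumes "a \<in> R" "0 < c" "c *\<^sub>R 1 \<le> a"
  shows "cinv a \<in> R"
proof -
  obtain M b where b: "(\<lambda>n. \<Sum>i<n. (1 - (1/M) *\<^sub>R a) ^ i) \<longlonglongrightarrow> b"
    "a * ((1/M) *\<^sub>R b) = 1" "((1/M) *\<^sub>R b) * a = 1"
    using neumann_positive[OF assms(2,3)] by blast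
  have "b \<in> R" using b(1)
    by (rule lim_in[rotated]) (intro sum_in power_in diff_in one_in scaleR_in assms(1))
  then show ?thesis using cinv_eq[OF b(2,3)] by (simp add: scaleR_in)
qed

end

subsection \<open>Kernel projections\<close>

lemma norm_app_ge_one:
  assumes "1 \<le> y"
  shows "norm u \<le> norm (y \<cdot> u)"
proof -
  have "(norm u)\<^sup>2 \<le> inner (y \<cdot> u) u"
    using assms ge_scal_sa[of 1 y] by (simp add: le_iff power2_norm_eq_inner)
  also have "\<dots> \<le> norm (y \<cdot> u) * norm u" by (rule norm_cauchy_schwarz)
  finally show ?thesis by (cases "norm u = 0") (simp_all add: power2_eq_square)
qed

text \<open>\<open>resol T n\<close> tends strongly to the projection onto the common kernel of \<open>T\<close>
  as \<open>T\<close> exhausts \<open>S\<close> and \<open>n\<close> tends to infinity.\<close>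

definition resol :: "'h::chilbert_space cop set \<Rightarrow> nat \<Rightarrow> 'h cop" where
  "resol T n = cinv (1 + real n *\<^sub>R (\<Sum>s\<in>T. adj s * s))"

lemma gram_nonneg: "0 \<le> (\<Sum>s\<in>T. adj s * s)"
  by (intro sum_nonneg adj_mult_nonneg)

lemma resol_base: "1 \<le> 1 + real n *\<^sub>R (\<Sum>s\<in>T. adj s * s)"
  using scaleR_nonneg_nonneg[OF _ gram_nonneg[of T], of "real n"] by simp

lemma unit_resol_base: "unit (1 + real n *\<^sub>R (\<Sum>s\<in>T. adj s * s))"
  by (rule unit_positive[of 1]) (use resol_base in simp_all)

lemma app_cinv_right: "unit a \<Longrightarrow> a \<cdot> cinv a \<cdot> x = x"
  using app_simps(7)[of a "cinv a" x] by (simp add: cinv_right del: app_simps(7))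

lemma app_cinv_left: "unit a \<Longrightarrow> cinv a \<cdot> a \<cdot> x = x"
  using app_simps(7)[of "cinv a" a x] by (simp add: cinv_left del: app_simps(7))

lemma resol_app: "(1 + real n *\<^sub>R (\<Sum>s\<in>T. adj s * s)) \<cdot> resol T n \<cdot> x = x"
  unfolding resol_def by (rule app_cinv_right[OF unit_resol_base])

lemma norm_resol: "norm (resol T n \<cdot> x) \<le> norm x"
  using norm_app_ge_one[OF resol_base[of n T], of "resol T n \<cdot> x"] unfolding resol_app .

lemma adj_resol: "adj (resol T n) = resol T n"
  unfolding resol_def using adj_cinv[OF unit_resol_base[of n T]]
  by (simp add: adj_sum)

lemma app_sum: "(sum f T) \<cdot> x = (\<Sum>s\<in>T. f s \<cdot> x)"
  by (rule app.sum_left)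

lemma resol_fix:
  assumes "\<And>s. s \<in> T \<Longrightarrow> s \<cdot> x = 0"
  shows "resol T n \<cdot> x = x"
proof -
  have h: "(1 + real n *\<^sub>R (\<Sum>s\<in>T. adj s * s)) \<cdot> x = x"
    using assms by (simp add: app_sum app_right_simps)
  show ?thesis
    using app_cinv_left[OF unit_resol_base[of n T], of x] unfolding resol_def h .
qed

text \<open>Pairing the resolvent equation of \<open>u\<close> with \<open>u\<close> bounds the sum
  of the squared norm of \<open>u\<close> and \<open>n\<close> times that of
  \<open>s \<cdot> u\<close> by \<open>norm y * norm (s \<cdot> u)\<close>. The arithmetic-geometric
  mean inequality absorbs the term in \<open>s \<cdot> u\<close>. So the resolvents tend to 0 on the
  range of \<open>adj s\<close>.\<close>

lemma resol_adj:
  assumes T: "finite T" "s \<in> T" and n: "0 < n"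
  shows "(norm (resol T n \<cdot> adj s \<cdot> y))\<^sup>2 \<le> (norm y)\<^sup>2 / real n"
proof -
  define u where "u = resol T n \<cdot> adj s \<cdot> y"
  have "inner ((1 + real n *\<^sub>R (\<Sum>s\<in>T. adj s * s)) \<cdot> u) u = (norm u)\<^sup>2 + real n * (\<Sum>s\<in>T. (norm (s \<cdot> u))\<^sup>2)"
    by (simp add: app_sum inner_add_left inner_sum_left power2_norm_eq_inner[of u] norm_app_sq)
  also have "(1 + real n *\<^sub>R (\<Sum>s\<in>T. adj s * s)) \<cdot> u = adj s \<cdot> y"
    unfolding u_def by (rule resol_app)
  finally have eq: "(norm u)\<^sup>2 + real n * (\<Sum>s\<in>T. (norm (s \<cdot> u))\<^sup>2) = inner y (s \<cdot> u)"
    using inner_adj[of "adj s" y u] by simp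
  have "(norm (s \<cdot> u))\<^sup>2 \<le> (\<Sum>s\<in>T. (norm (s \<cdot> u))\<^sup>2)"
    by (rule member_le_sum[OF T(2) _ T(1)]) simp
  then have "real n * (norm (s \<cdot> u))\<^sup>2 \<le> real n * (\<Sum>s\<in>T. (norm (s \<cdot> u))\<^sup>2)"
    by (intro mult_left_mono) auto
  then have "(norm u)\<^sup>2 + real n * (norm (s \<cdot> u))\<^sup>2 \<le> norm y * norm (s \<cdot> u)"
    using eq norm_cauchy_schwarz[of y "s \<cdot> u"] by linarith
  also have "\<dots> \<le> (norm y)\<^sup>2 / real n + real n * (norm (s \<cdot> u))\<^sup>2"
  proof -
    have "0 \<le> (norm y / sqrt (real n) - sqrt (real n) * norm (s \<cdot> u))\<^sup>2" by simp
    also have "\<dots> = (norm y)\<^sup>2 / real n - 2 * (norm y * norm (s \<cdot> u)) + real n * (norm (s \<cdot> u))\<^sup>2"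
      using n by (simp add: power2_diff power_divide power_mult_distrib)
    finally have "2 * (norm y * norm (s \<cdot> u)) \<le> (norm y)\<^sup>2 / real n + real n * (norm (s \<cdot> u))\<^sup>2" by simp
    moreover have "0 \<le> norm y * norm (s \<cdot> u)" by simp
    ultimately show ?thesis by linarith
  qed
  finally show ?thesis by (simp add: u_def)
qed

context vn_alg
begin

lemma resol_in: "T \<subseteq> R \<Longrightarrow> resol T n \<in> R"
  unfolding resol_def
  by (rule cinv_in[of _ 1]) (use resol_base in \<open>auto intro!: add_in one_in scaleR_in sum_in mult_in adj_in\<close>)

text \<open>Resolvents fix the common kernel \<open>M\<close> and tend to 0 on the set
  \<open>C\<close>, which is closed since they are contractions and contains the ranges of all
  \<open>adj s\<close>. The orthogonal complement of \<open>M\<close> lies in \<open>C\<close>, so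
  the resolvents converge strongly to the projection onto \<open>M\<close>.\<close>

lemma kernel_projection:
  assumes SR: "S \<subseteq> R"
  obtains q where "q \<in> R" "adj q = q" "q * q = q" "\<And>s. s \<in> S \<Longrightarrow> s * q = 0"
    "\<And>x. (\<And>s. s \<in> S \<Longrightarrow> s \<cdot> x = 0) \<Longrightarrow> q \<cdot> x = x"
proof -
  define M where "M = {x. \<forall>s\<in>S. s \<cdot> x = 0}"
  have Meq: "M = (\<Inter>s\<in>S. {x. s \<cdot> x = 0})" by (auto simp: M_def)
  have "closed {x. s \<cdot> x = 0}" for s :: "'h cop"
    by (intro closed_Collect_eq continuous_on_const app.continuous_on continuous_on_id)
  then have M: "closed M" unfolding Meq by (intro closed_INT ballI)
  have Ms: "subspace M" by (auto simp: subspace_def M_def app_right_simps)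
  have MC: "c *\<^sub>C x \<in> M" if "x \<in> M" for c x using that by (simp add: M_def app_right_simps)
  obtain q where q: "adj q = q" "q * q = q" "\<And>x. q \<cdot> x \<in> M" "\<And>x. x \<in> M \<Longrightarrow> q \<cdot> x = x"
    using orthogonal_projection_exists[OF Ms M MC] by blast
  \<comment> \<open>The finite subset of \<open>S\<close> and the parameter \<open>n\<close> grow
    together; the product filter treats them as a single limit, with no countability of
    \<open>S\<close> involved.\<close>
  define \<F> where "\<F> = finite_subsets_at_top S \<times>\<^sub>F sequentially"
  define r where "r = (\<lambda>p. resol (fst p) (snd p) :: 'h cop)"
  have nb: "\<F> \<noteq> bot" by (simp add: \<F>_def prod_filter_eq_bot)
  have evS: "\<forall>\<^sub>F p in \<F>. (finite (fst p) \<and> fst p \<subseteq> S \<and> T \<subseteq> fst p) \<and> n0 \<le> snd p"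
    if "finite T" "T \<subseteq> S" for T n0
    unfolding \<F>_def
    by (rule eventually_prodI)
       (use that in \<open>auto simp: eventually_finite_subsets_at_top eventually_ge_at_top\<close>)
  have nr: "norm (r p \<cdot> x) \<le> norm x" for p x by (simp add: r_def norm_resol)
  define C where "C = {z. ((\<lambda>p. r p \<cdot> z) \<longlongrightarrow> 0) \<F>}"
  have Csub: "subspace C"
    unfolding subspace_def C_def
  proof (intro conjI ballI allI CollectI)
    show "((\<lambda>p. r p \<cdot> 0) \<longlongrightarrow> 0) \<F>" by (simp add: app_right_simps)
    show "((\<lambda>p. r p \<cdot> (x + y)) \<longlongrightarrow> 0) \<F>"
      if "x \<in> {z. ((\<lambda>p. r p \<cdot> z) \<longlongrightarrow> 0) \<F>}" "y \<in> {z. ((\<lambda>p. r p \<cdot> z) \<longlongrightarrow> 0) \<F>}" for x y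
      using that tendsto_add[of "\<lambda>p. r p \<cdot> x" 0 \<F> "\<lambda>p. r p \<cdot> y" 0] by (simp add: app_right_simps)
    show "((\<lambda>p. r p \<cdot> (c *\<^sub>R x)) \<longlongrightarrow> 0) \<F>"
      if "x \<in> {z. ((\<lambda>p. r p \<cdot> z) \<longlongrightarrow> 0) \<F>}" for c x
      using that tendsto_scaleR[OF tendsto_const, of "\<lambda>p. r p \<cdot> x" 0 \<F> c] by (simp add: app_right_simps)
  qed
  have "closure C \<subseteq> C"
  proof
    fix x assume x: "x \<in> closure C"
    have "((\<lambda>p. r p \<cdot> x) \<longlongrightarrow> 0) \<F>"
    proof (rule tendstoI)
      fix e :: real assume e: "0 < e"
      then obtain y where y: "y \<in> C" "dist y x < e/2"
        using x unfolding closure_approachable by (meson half_gt_zero)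
      then have "\<forall>\<^sub>F p in \<F>. dist (r p \<cdot> y) 0 < e/2" using tendstoD[of "\<lambda>p. r p \<cdot> y" 0 \<F> "e/2"] e by (simp add: C_def)
      then show "\<forall>\<^sub>F p in \<F>. dist (r p \<cdot> x) 0 < e"
      proof (rule eventually_mono)
        fix p assume p: "dist (r p \<cdot> y) 0 < e/2"
        have "r p \<cdot> x = r p \<cdot> y - r p \<cdot> (y - x)" by (simp add: app_right_simps)
        then have "norm (r p \<cdot> x) \<le> norm (r p \<cdot> y) + norm (r p \<cdot> (y - x))" by (simp only: norm_triangle_ineq4)
        also have "\<dots> < e/2 + e/2" using p y(2) nr[of p "y - x"] by (simp add: dist_norm)
        finally show "dist (r p \<cdot> x) 0 < e" by simp
      qed
    qed
    then show "x \<in> C" by (simp add: C_def)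
  qed
  then have Cclosed: "closed C" by (rule closure_subset_eq[THEN iffD1])
  have adjC: "adj s \<cdot> y \<in> C" if s: "s \<in> S" for s y
  proof -
    have "((\<lambda>p. r p \<cdot> adj s \<cdot> y) \<longlongrightarrow> 0) \<F>"
    proof (rule tendstoI)
      fix e :: real assume e: "0 < e"
      obtain n0 :: nat where n0: "(norm y)\<^sup>2 / e\<^sup>2 < real n0" using reals_Archimedean2 by blast
      have "\<forall>\<^sub>F p in \<F>. (finite (fst p) \<and> fst p \<subseteq> S \<and> {s} \<subseteq> fst p) \<and> n0 \<le> snd p"
        using s by (intro evS) auto
      then show "\<forall>\<^sub>F p in \<F>. dist (r p \<cdot> adj s \<cdot> y) 0 < e"
      proof (rule eventually_mono)
        fix p assume p: "(finite (fst p) \<and> fst p \<subseteq> S \<and> {s} \<subseteq> fst p) \<and> n0 \<le> snd p"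
        have n1: "(norm y)\<^sup>2 / e\<^sup>2 < real (snd p)" using n0 p by linarith
        have "0 \<le> (norm y)\<^sup>2 / e\<^sup>2" by simp
        then have np: "0 < real (snd p)" using n1 by linarith
        have "(norm (r p \<cdot> adj s \<cdot> y))\<^sup>2 \<le> (norm y)\<^sup>2 / real (snd p)"
          unfolding r_def using p np by (intro resol_adj) auto
        also have "\<dots> < e\<^sup>2" using n1 np e by (simp add: divide_less_eq mult.commute)
        finally show "dist (r p \<cdot> adj s \<cdot> y) 0 < e" using e by (simp add: power_less_imp_less_base)
      qed
    qed
    then show ?thesis by (simp add: C_def)
  qed
  have perpC: "x - q \<cdot> x \<in> C" for x
  proof -
    define z where "z = x - q \<cdot> x"
    have zM: "inner z m = 0" if m: "m \<in> M" for m
    proof -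
      have "inner (q \<cdot> x) m = inner x (q \<cdot> m)" using inner_adj[of q x m] q(1) by simp
      then show ?thesis using q(4)[OF m] by (simp add: z_def inner_diff_left)
    qed
    obtain w where w: "w \<in> C" "\<And>c. c \<in> C \<Longrightarrow> inner (z - w) c = 0"
      using hilbert_projection[OF Csub Cclosed] by blast
    define v where "v = z - w"
    \<comment> \<open>\<open>v\<close> is orthogonal to \<open>C\<close>, in particular to
      \<open>adj s \<cdot> s \<cdot> v\<close>, and that inner product is the squared norm of
      \<open>s \<cdot> v\<close>.\<close>
    have vM: "v \<in> M"
      unfolding M_def
    proof (intro CollectI ballI)
      fix s assume s: "s \<in> S"
      have "inner (s \<cdot> v) (s \<cdot> v) = inner v (adj s \<cdot> s \<cdot> v)" by (rule inner_adj)
      also have "\<dots> = 0" using w(2)[OF adjC[OF s]] by (simp add: v_def)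
      finally show "s \<cdot> v = 0" by simp
    qed
    \<comment> \<open>Resolvents are self-adjoint and fix \<open>m\<close>, so pairing
      \<open>w\<close> with \<open>m\<close> is the same as pairing its resolvent images with
      \<open>m\<close>, and these tend to 0.\<close>
    have wM: "inner w m = 0" if m: "m \<in> M" for m
    proof -
      have "((\<lambda>p. inner (r p \<cdot> w) m) \<longlongrightarrow> inner 0 m) \<F>"
        using w(1) by (intro tendsto_inner tendsto_const) (simp add: C_def)
      moreover have "\<forall>\<^sub>F p in \<F>. inner (r p \<cdot> w) m = inner w m"
        using evS[of "{}" 0, simplified]
      proof (rule eventually_mono)
        fix p :: "'h cop set \<times> nat"
        assume "finite (fst p) \<and> fst p \<subseteq> S"
        then have "r p \<cdot> m = m" using m unfolding r_def by (intro resol_fix) (auto simp: M_def)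
        then show "inner (r p \<cdot> w) m = inner w m"
          using inner_adj[of "r p" w m] by (simp add: r_def adj_resol)
      qed
      ultimately have "((\<lambda>p. inner w m) \<longlongrightarrow> 0) \<F>" by (simp add: tendsto_cong)
      then show ?thesis using nb by (simp add: tendsto_const_iff)
    qed
    have "inner v v = inner z v - inner w v" by (simp add: v_def inner_diff_left)
    then have "v = 0" using zM[OF vM] wM[OF vM] by simp
    then have "z = w" by (simp add: v_def)
    then show ?thesis using w(1) by (simp add: z_def)
  qed
  have qR: "q \<in> R"
  proof (rule sot_closed)
    fix F :: "'h set" and e :: real assume F: "finite F" and e: "0 < e"
    have "\<forall>\<^sub>F p in \<F>. norm (r p \<cdot> (x - q \<cdot> x)) < e" for x
      using tendstoD[OF _ e, of "\<lambda>p. r p \<cdot> (x - q \<cdot> x)" 0 \<F>] perpC[of x] by (simp add: C_def)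
    then have "\<forall>\<^sub>F p in \<F>. \<forall>x\<in>F. norm (r p \<cdot> (x - q \<cdot> x)) < e"
      using F by (intro eventually_ball_finite) auto
    with evS[of "{}" 0, simplified]
    have "\<forall>\<^sub>F p in \<F>. (finite (fst p) \<and> fst p \<subseteq> S) \<and> (\<forall>x\<in>F. norm (r p \<cdot> (x - q \<cdot> x)) < e)"
      by (rule eventually_conj)
    from eventually_happens'[OF nb this]
    obtain T n where T: "finite T" "T \<subseteq> S" "\<forall>x\<in>F. norm (resol T n \<cdot> (x - q \<cdot> x)) < e"
      by (auto simp: r_def)
    have "resol T n \<cdot> (x - q \<cdot> x) = resol T n \<cdot> x - q \<cdot> x" for x
    proof -
      have "resol T n \<cdot> q \<cdot> x = q \<cdot> x"
        using q(3)[of x] T(2) by (intro resol_fix) (auto simp: M_def)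
      then show ?thesis by (simp add: app_right_simps)
    qed
    then show "\<exists>b\<in>R. \<forall>x\<in>F. norm (b \<cdot> x - q \<cdot> x) < e"
      using T SR by (intro bexI[of _ "resol T n"] resol_in) auto
  qed
  have sq: "s * q = 0" if "s \<in> S" for s
    by (rule app_ext) (use q(3) that in \<open>simp add: M_def\<close>)
  have qx: "q \<cdot> x = x" if "\<And>s. s \<in> S \<Longrightarrow> s \<cdot> x = 0" for x
    using q(4) that by (simp add: M_def)
  show ?thesis by (rule that[OF qR q(1,2) sq qx])
qed

end

section \<open>Factors are prime\<close>

locale factor_alg = vn_alg +
  assumes center: "z \<in> R \<Longrightarrow> (\<And>b. b \<in> R \<Longrightarrow> z * b = b * z) \<Longrightarrow> \<exists>c. z = cscale c 1"
begin

text \<open>The common kernel of the right ideal generated by \<open>u\<close> is invariant under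
  \<open>R\<close>, so its projection \<open>q\<close> is central and therefore a scalar. A nonzero
  scalar forces \<open>u = 0\<close>; if the scalar is 0, then \<open>v\<close>, whose range lies in
  that kernel, vanishes.\<close>

lemma prime:
  assumes u: "u \<in> R" and uv: "\<And>r. r \<in> R \<Longrightarrow> u * r * v = 0"
  shows "u = 0 \<or> v = 0"
proof -
  define S where "S = (\<lambda>r. u * r) ` R"
  have "S \<subseteq> R" using u by (auto simp: S_def mult_in)
  then obtain q where q: "q \<in> R" "adj q = q" "q * q = q" "\<And>s. s \<in> S \<Longrightarrow> s * q = 0"
    "\<And>x. (\<And>s. s \<in> S \<Longrightarrow> s \<cdot> x = 0) \<Longrightarrow> q \<cdot> x = x"
    using kernel_projection by blast
  \<comment> \<open>Invariance of the kernel: multiplying an element \<open>u * r\<close> of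
    \<open>S\<close> by \<open>b\<close> on the right stays in \<open>S\<close>. Taking adjoints
    below upgrades this to commutation with \<open>q\<close>.\<close>
  have qbq: "q * (b * q) = b * q" if b: "b \<in> R" for b
  proof (rule app_ext)
    fix x
    have "s \<cdot> b \<cdot> q \<cdot> x = 0" if s: "s \<in> S" for s
    proof -
      obtain r where r: "r \<in> R" "s = u * r" using s by (auto simp: S_def)
      have "u * (r * b) \<in> S" using r b by (auto simp: S_def mult_in)
      then have "u * (r * b) * q = 0" by (rule q(4))
      then have "(u * (r * b) * q) \<cdot> x = 0" by simp
      then show ?thesis by (simp add: r(2))
    qed
    then show "(q * (b * q)) \<cdot> x = (b * q) \<cdot> x" using q(5)[of "b \<cdot> q \<cdot> x"] by simp
  qed
  have "q * b = b * q" if b: "b \<in> R" for b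
  proof -
    have "adj (q * (adj b * q)) = adj (adj b * q)" using qbq[OF adj_in[OF b]] by simp
    then have "q * b * q = q * b" by (simp add: q(2))
    then show ?thesis using qbq[OF b] by (simp add: mult.assoc)
  qed
  then obtain c where c: "q = cscale c 1" using center[OF q(1)] by blast
  show ?thesis
  proof (cases "c = 0")
    case True
    have "v \<cdot> x = 0" for x
    proof -
      have "s \<cdot> v \<cdot> x = 0" if s: "s \<in> S" for s
      proof -
        obtain r where r: "r \<in> R" "s = u * r" using s by (auto simp: S_def)
        have "(u * r * v) \<cdot> x = 0" using uv[OF r(1)] by simp
        then show ?thesis by (simp add: r(2))
      qed
      then have "q \<cdot> v \<cdot> x = v \<cdot> x" by (intro q(5)) auto
      then show ?thesis by (simp add: c True)
    qed
    then have "v = 0" by (intro app_ext) simp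
    then show ?thesis by simp
  next
    case False
    have "u * 1 \<in> S" unfolding S_def using one_in by (rule imageI)
    then have "u * 1 * q = 0" by (rule q(4))
    then have "cscale c u = 0" by (simp add: c cscale_simps)
    then have "cscale (1/c) (cscale c u) = 0" by simp
    then show ?thesis using False by (simp add: cscale_simps cscale_one)
  qed
qed

end

section \<open>Comparison of projections\<close>

text \<open>By Pythagoras the squared norm of a finite partial sum is the sum of squared norms.
  These sums are bounded, so a finite set close to their supremum leaves only small tails, and the
  partial sums form a Cauchy filter.\<close>

lemma orthogonal_summable:
  fixes f :: "'i \<Rightarrow> 'a::{real_inner,banach}"
  assumes orth: "\<And>i j. i \<in> A \<Longrightarrow> j \<in> A \<Longrightarrow> i \<noteq> j \<Longrightarrow> inner (f i) (f j) = 0"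
    and bd: "\<And>F. finite F \<Longrightarrow> F \<subseteq> A \<Longrightarrow> (\<Sum>i\<in>F. (norm (f i))\<^sup>2) \<le> B"
  shows "f summable_on A"
proof -
  have pyth: "(norm (\<Sum>i\<in>F. f i))\<^sup>2 = (\<Sum>i\<in>F. (norm (f i))\<^sup>2)" if "finite F" "F \<subseteq> A" for F
    using that
  proof (induct F rule: finite_induct)
    case (insert x F)
    have "inner (f x) (\<Sum>i\<in>F. f i) = (\<Sum>i\<in>F. inner (f x) (f i))" by (rule inner_sum_right)
    also have "\<dots> = 0" using insert by (intro sum.neutral ballI orth) auto
    finally have "(norm (f x + (\<Sum>i\<in>F. f i)))\<^sup>2 = (norm (f x))\<^sup>2 + (norm (\<Sum>i\<in>F. f i))\<^sup>2"
      unfolding power2_norm_eq_inner by (simp add: inner_add inner_commute)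
    then show ?case using insert by simp
  qed simp
  define Q where "Q = (\<lambda>F. \<Sum>i\<in>F. (norm (f i))\<^sup>2) ` {F. finite F \<and> F \<subseteq> A}"
  have Qne: "Q \<noteq> {}" by (auto simp: Q_def)
  have Qb: "bdd_above Q" unfolding Q_def using bd by (intro bdd_aboveI2[where M = B]) auto
  have "\<exists>P. eventually P (finite_subsets_at_top A) \<and> (\<forall>F F'. P F \<and> P F' \<longrightarrow> dist (sum f F) (sum f F') < e)"
    if e: "0 < e" for e
  proof -
    have "Sup Q - (e/3)\<^sup>2 < Sup Q" using e by simp
    then obtain G where G: "finite G" "G \<subseteq> A" "Sup Q - (e/3)\<^sup>2 < (\<Sum>i\<in>G. (norm (f i))\<^sup>2)"
      using less_cSupE[OF _ Qne] unfolding Q_def by (smt (verit) imageE mem_Collect_eq)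
    define P where "P F \<longleftrightarrow> finite F \<and> G \<subseteq> F \<and> F \<subseteq> A" for F
    have "eventually P (finite_subsets_at_top A)"
      unfolding eventually_finite_subsets_at_top P_def using G by blast
    moreover have close: "norm (sum f F - sum f G) \<le> e/3" if P: "P F" for F
    proof -
      have F: "finite F" "G \<subseteq> F" "F \<subseteq> A" using P by (auto simp: P_def)
      have "(norm (sum f F - sum f G))\<^sup>2 = (\<Sum>i\<in>F - G. (norm (f i))\<^sup>2)"
        using F by (subst sum_diff[symmetric]) (auto intro!: pyth)
      also have "\<dots> = (\<Sum>i\<in>F. (norm (f i))\<^sup>2) - (\<Sum>i\<in>G. (norm (f i))\<^sup>2)"
        using F by (intro sum_diff)
      also have "\<dots> \<le> Sup Q - (\<Sum>i\<in>G. (norm (f i))\<^sup>2)"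
        using F by (intro diff_right_mono cSup_upper Qb) (auto simp: Q_def)
      also have "\<dots> \<le> (e/3)\<^sup>2" using G(3) by linarith
      finally show ?thesis by (rule power2_le_imp_le) (use e in simp)
    qed
    moreover have "dist (sum f F) (sum f F') < e" if PP: "P F \<and> P F'" for F F'
    proof -
      have "sum f F - sum f F' = (sum f F - sum f G) - (sum f F' - sum f G)" by simp
      then have "norm (sum f F - sum f F') \<le> norm (sum f F - sum f G) + norm (sum f F' - sum f G)"
        by (simp only: norm_triangle_ineq4)
      also have "\<dots> < e" using close[of F] close[of F'] PP e by linarith
      finally show ?thesis by (simp add: dist_norm)
    qed
    ultimately show ?thesis by blast
  qed
  then have c: "cauchy_filter (filtermap (sum f) (finite_subsets_at_top A))"
    by (simp add: cauchy_filter_metric_filtermap)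
  have "complete (UNIV::'a set)"
    by (rule completeI) (use Cauchy_convergent convergent_def in auto)
  then obtain L where "filtermap (sum f) (finite_subsets_at_top A) \<le> nhds L"
    using complete_uniform[where S="UNIV::'a set"] c by (force simp: filtermap_bot_iff)
  then have "(f has_sum L) A" by (simp add: has_sum_def filterlim_def)
  then show ?thesis by (rule has_sum_imp_summable)
qed

lemma partial_isometry_adj:
  assumes "v * adj v * v = (v :: 'h::chilbert_space cop)"
  shows "adj v * v * adj v = adj v"
proof -
  have "adj (v * adj v * v) = adj v" by (simp only: assms)
  then show ?thesis by (simp add: mult.assoc)
qed

text \<open>For projections \<open>e\<close> and \<open>f\<close>: partial isometries with initial
  spaces inside \<open>e\<close> and final spaces inside \<open>f\<close>.
  \<open>v * adj w = 0\<close> makes initial spaces orthogonal, \<open>adj v * w = 0\<close> final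
  spaces. Zero is excluded so that a new member enlarges the family properly.\<close>

definition partial_isometries ::
    "'h::chilbert_space cop set \<Rightarrow> 'h cop \<Rightarrow> 'h cop \<Rightarrow> 'h cop set \<Rightarrow> bool" where
  "partial_isometries R e f V \<longleftrightarrow>
     (\<forall>v\<in>V. v \<in> R \<and> v \<noteq> 0 \<and> v * adj v * v = v \<and> v * e = v \<and> f * v = v) \<and>
     (\<forall>v\<in>V. \<forall>w\<in>V. v \<noteq> w \<longrightarrow> adj v * w = 0 \<and> v * adj w = 0)"

context vn_alg
begin

text \<open>At each vector the images under the members are orthogonal, and Bessel's inequality for
  the initial projections makes them summable. The two identities for members say that the sum
  extends each of them.\<close>

lemma sum_partial_isometries:
  assumes V: "partial_isometries R e f V"
  obtains u where "u \<in> R" "\<And>v. v \<in> V \<Longrightarrow> u * adj v = v * adj v" "\<And>v. v \<in> V \<Longrightarrow> adj u * v = adj v * v"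
    "u * adj u * u = u" "u * e = u" "f * u = u"
proof -
  have v: "\<And>v. v \<in> V \<Longrightarrow> v \<in> R" "\<And>v. v \<in> V \<Longrightarrow> v * (adj v * v) = v"
      "\<And>v. v \<in> V \<Longrightarrow> v * e = v" "\<And>v. v \<in> V \<Longrightarrow> f * v = v"
    and o: "\<And>v w. v \<in> V \<Longrightarrow> w \<in> V \<Longrightarrow> v \<noteq> w \<Longrightarrow> adj v * w = 0"
      "\<And>v w. v \<in> V \<Longrightarrow> w \<in> V \<Longrightarrow> v \<noteq> w \<Longrightarrow> v * adj w = 0"
    using V by (auto simp: partial_isometries_def mult.assoc)
  have bessel: "(\<Sum>w\<in>F. (norm (w \<cdot> x))\<^sup>2) \<le> (norm x)\<^sup>2" if F: "finite F" "F \<subseteq> V" for F x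
  proof -
    \<comment> \<open>A finite sum of pairwise orthogonal initial projections, hence itself a
      projection; its quadratic form is the left side of Bessel's inequality.\<close>
    define p where "p = (\<Sum>w\<in>F. adj w * w)"
    have psa: "adj p = p" by (simp add: p_def adj_sum)
    have pv: "p * adj w = adj w" if w: "w \<in> F" for w
    proof -
      have "p * adj w = (\<Sum>w'\<in>F. adj w' * (w' * adj w))" by (simp add: p_def sum_distrib_right mult.assoc)
      also have "\<dots> = (\<Sum>w'\<in>F. if w' = w then adj w * w * adj w else 0)"
        using o(2) F w by (intro sum.cong refl) (auto simp: mult.assoc subset_iff)
      also have "\<dots> = adj w * w * adj w" using F w by simp
      also have "\<dots> = adj w" using w F v(2)[of w] by (intro partial_isometry_adj) (auto simp: mult.assoc)
      finally show ?thesis .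
    qed
    have "p * p = p * (\<Sum>w\<in>F. adj w * w)" by (simp add: p_def)
    also have "\<dots> = (\<Sum>w\<in>F. p * adj w * w)" by (simp only: sum_distrib_left mult.assoc)
    also have "\<dots> = (\<Sum>w\<in>F. adj w * w)" by (intro sum.cong refl) (simp only: pv)
    also have "\<dots> = p" by (simp only: p_def)
    finally have "p \<le> 1" using psa by (intro projection_le) auto
    then have "inner (p \<cdot> x) x \<le> (norm x)\<^sup>2" using psa by (simp add: le_iff power2_norm_eq_inner)
    also have "inner (p \<cdot> x) x = (\<Sum>w\<in>F. (norm (w \<cdot> x))\<^sup>2)"
      by (simp add: p_def app_sum inner_sum_left norm_app_sq)
    finally show ?thesis .
  qed
  have orth: "inner (w \<cdot> x) (w' \<cdot> y) = 0" if "w \<in> V" "w' \<in> V" "w \<noteq> w'" for w w' x y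
  proof -
    have "inner (w \<cdot> x) (w' \<cdot> y) = inner x ((adj w * w') \<cdot> y)" by (simp add: inner_adj)
    then show ?thesis using o(1)[OF that] by simp
  qed
  have sm: "(\<lambda>w. w \<cdot> x) summable_on V" for x
    by (rule orthogonal_summable[where B = "(norm x)\<^sup>2"]) (use orth bessel in auto)
  define U where "U x = infsum (\<lambda>w. w \<cdot> x) V" for x
  have hs: "((\<lambda>w. w \<cdot> x) has_sum U x) V" for x
    unfolding U_def using sm by (rule has_sum_infsum)
  have Uadd: "U (x + y) = U x + U y" for x y
    using has_sum_add[OF hs[of x] hs[of y]] hs[of "x + y"] by (simp add: app_right_simps has_sum_unique)
  have UC: "U (c *\<^sub>C x) = c *\<^sub>C U x" for c x
    using has_sum_bounded_linear[OF bounded_linear_scaleC hs[of x], of c] hs[of "c *\<^sub>C x"]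
    by (simp add: app_right_simps has_sum_unique)
  have Unorm: "norm (U x) \<le> norm x" for x
  proof (rule tendsto_upperbound)
    show "((\<lambda>F. norm (sum (\<lambda>w. w \<cdot> x) F)) \<longlongrightarrow> norm (U x)) (finite_subsets_at_top V)"
      using hs[of x] unfolding has_sum_def by (rule tendsto_norm)
    show "\<forall>\<^sub>F F in finite_subsets_at_top V. norm (sum (\<lambda>w. w \<cdot> x) F) \<le> norm x"
    proof (rule eventually_finite_subsets_at_top_weakI)
      fix F assume F: "finite F" "F \<subseteq> V"
      have "(norm (\<Sum>w\<in>F. w \<cdot> x))\<^sup>2 = (\<Sum>w\<in>F. (norm (w \<cdot> x))\<^sup>2)"
        using F
      proof (induct F rule: finite_induct)
        case (insert w F)
        have "inner (w \<cdot> x) (\<Sum>w\<in>F. w \<cdot> x) = (\<Sum>w'\<in>F. inner (w \<cdot> x) (w' \<cdot> x))" by (rule inner_sum_right)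
        also have "\<dots> = 0" using insert by (intro sum.neutral ballI orth) auto
        finally have "(norm (w \<cdot> x + (\<Sum>w\<in>F. w \<cdot> x)))\<^sup>2 = (norm (w \<cdot> x))\<^sup>2 + (norm (\<Sum>w\<in>F. w \<cdot> x))\<^sup>2"
          unfolding power2_norm_eq_inner by (simp add: inner_add inner_commute)
        then show ?case using insert by simp
      qed simp
      also have "\<dots> \<le> (norm x)\<^sup>2" by (rule bessel[OF F])
      finally show "norm (\<Sum>w\<in>F. w \<cdot> x) \<le> norm x" by (rule power2_le_imp_le) simp
    qed
  qed simp
  have bl: "bounded_linear U"
  proof (rule bounded_linear_intro[where K = 1])
    show "U (x + y) = U x + U y" for x y by (rule Uadd)
    show "U (r *\<^sub>R x) = r *\<^sub>R U x" for r x using UC[of "of_real r" x] by (simp add: scaleC_of_real)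
    show "norm (U x) \<le> norm x * 1" for x using Unorm by simp
  qed
  define u where "u = Cop (Blinfun U)"
  have u: "u \<cdot> x = U x" for x
  proof -
    have "complex_linear_op (Blinfun U)"
      by (simp add: complex_linear_op_def bounded_linear_Blinfun_apply[OF bl] UC)
    then show ?thesis
      by (simp add: u_def app.rep_eq Cop_inverse bounded_linear_Blinfun_apply[OF bl])
  qed
  have uR: "u \<in> R"
  proof (rule sot_closed)
    fix F :: "'h set" and d :: real assume F: "finite F" and d: "0 < d"
    have "\<forall>\<^sub>F T in finite_subsets_at_top V. norm (sum (\<lambda>w. w) T \<cdot> x - u \<cdot> x) < d" for x
      using tendstoD[OF hs[of x, unfolded has_sum_def] d] by (simp add: dist_norm u app_sum)
    then have "\<forall>\<^sub>F T in finite_subsets_at_top V. \<forall>x\<in>F. norm (sum (\<lambda>w. w) T \<cdot> x - u \<cdot> x) < d"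
      using F by (intro eventually_ball_finite) auto
    moreover have "\<forall>\<^sub>F T in finite_subsets_at_top V. sum (\<lambda>w. w) T \<in> R"
      by (rule eventually_finite_subsets_at_top_weakI) (rule sum_in, use v(1) in auto)
    ultimately have "\<forall>\<^sub>F T in finite_subsets_at_top V. (\<forall>x\<in>F. norm (sum (\<lambda>w. w) T \<cdot> x - u \<cdot> x) < d) \<and> sum (\<lambda>w. w) T \<in> R"
      by (rule eventually_conj)
    from eventually_happens'[OF finite_subsets_at_top_neq_bot this]
    show "\<exists>b\<in>R. \<forall>x\<in>F. norm (b \<cdot> x - u \<cdot> x) < d" by blast
  qed
  have u1: "u * adj w = w * adj w" if w: "w \<in> V" for w
  proof (rule app_ext)
    fix y
    have "((\<lambda>w'. w' \<cdot> adj w \<cdot> y) has_sum (w \<cdot> adj w \<cdot> y)) V"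
    proof (rule has_sum_finite_neutralI[of "{w}"])
      fix w' assume "w' \<in> V - {w}"
      then have "w' * adj w = 0" using o(2)[of w' w] w by auto
      then have "(w' * adj w) \<cdot> y = 0" by simp
      then show "w' \<cdot> adj w \<cdot> y = 0" by simp
    qed (use w in auto)
    then show "(u * adj w) \<cdot> y = (w * adj w) \<cdot> y"
      using hs[of "adj w \<cdot> y"] by (simp add: u has_sum_unique)
  qed
  have u2: "adj u * w = adj w * w" if w: "w \<in> V" for w
  proof -
    have "adj w * u = adj w * w"
    proof (rule app_ext)
      fix x
      have "((\<lambda>w'. adj w \<cdot> w' \<cdot> x) has_sum (adj w \<cdot> w \<cdot> x)) V"
      proof (rule has_sum_finite_neutralI[of "{w}"])
        fix w' assume "w' \<in> V - {w}"
        then have "adj w * w' = 0" using o(1)[of w w'] w by auto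
        then have "(adj w * w') \<cdot> x = 0" by simp
        then show "adj w \<cdot> w' \<cdot> x = 0" by simp
      qed (use w in auto)
      moreover have "((\<lambda>w'. adj w \<cdot> w' \<cdot> x) has_sum (adj w \<cdot> U x)) V"
        by (rule has_sum_bounded_linear[OF app.bounded_linear_right hs])
      ultimately show "(adj w * u) \<cdot> x = (adj w * w) \<cdot> x" by (simp add: u has_sum_unique)
    qed
    then have "adj (adj w * u) = adj (adj w * w)" by simp
    then show ?thesis by simp
  qed
  have uw: "u * adj u * w = w" if w: "w \<in> V" for w
  proof -
    have "u * adj u * w = (u * adj w) * w" by (simp add: u2[OF w] mult.assoc)
    also have "\<dots> = w" by (simp add: u1[OF w] mult.assoc v(2)[OF w])
    finally show ?thesis .
  qed
  have u3: "u * adj u * u = u"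
  proof (rule app_ext)
    fix x
    have "((\<lambda>w. (u * adj u) \<cdot> w \<cdot> x) has_sum ((u * adj u) \<cdot> U x)) V"
      by (rule has_sum_bounded_linear[OF app.bounded_linear_right hs])
    moreover have "(u * adj u) \<cdot> w \<cdot> x = w \<cdot> x" if "w \<in> V" for w
      using uw[OF that] app_simps(7)[of "u * adj u" w x] by (simp del: app_simps(7))
    ultimately have "((\<lambda>w. w \<cdot> x) has_sum ((u * adj u) \<cdot> U x)) V"
      by (subst has_sum_cong[where g = "\<lambda>w. (u * adj u) \<cdot> w \<cdot> x"]) auto
    then have "(u * adj u) \<cdot> U x = U x" using hs has_sum_unique by blast
    then show "(u * adj u * u) \<cdot> x = u \<cdot> x" by (simp add: u)
  qed
  have u4: "u * e = u"
  proof (rule app_ext)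
    fix x
    have "w \<cdot> e \<cdot> x = w \<cdot> x" if "w \<in> V" for w
      using v(3)[OF that] app_simps(7)[of w e x] by (simp del: app_simps(7))
    then have "((\<lambda>w. w \<cdot> x) has_sum U (e \<cdot> x)) V"
      using hs[of "e \<cdot> x"] by (subst has_sum_cong[where g = "\<lambda>w. w \<cdot> e \<cdot> x"]) auto
    then have "U (e \<cdot> x) = U x" using hs has_sum_unique by blast
    then show "(u * e) \<cdot> x = u \<cdot> x" by (simp add: u)
  qed
  have u5: "f * u = u"
  proof (rule app_ext)
    fix x
    have "((\<lambda>w. f \<cdot> w \<cdot> x) has_sum (f \<cdot> U x)) V"
      by (rule has_sum_bounded_linear[OF app.bounded_linear_right hs])
    moreover have "f \<cdot> w \<cdot> x = w \<cdot> x" if "w \<in> V" for w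
      using v(4)[OF that] app_simps(7)[of f w x] by (simp del: app_simps(7))
    ultimately have "((\<lambda>w. w \<cdot> x) has_sum (f \<cdot> U x)) V"
      by (subst has_sum_cong[where g = "\<lambda>w. f \<cdot> w \<cdot> x"]) auto
    then have "f \<cdot> U x = U x" using hs has_sum_unique by blast
    then show "(f * u) \<cdot> x = u \<cdot> x" by (simp add: u)
  qed
  show ?thesis by (rule that[OF uR u1 u2 u3 u4 u5])
qed

text \<open>The projection \<open>p\<close> cuts \<open>a\<close> down to where \<open>adj a * a\<close> is bounded below, so that the polar part
  is a norm-limit of polynomials and no strong limit is needed.\<close>

lemma exists_partial_isometry:
  assumes aR: "a \<in> R" and a0: "a \<noteq> 0"
  obtains v where "v \<in> R" "v \<noteq> 0" "v * adj v * v = v"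
    "\<And>e. a * e = 0 \<Longrightarrow> v * e = 0" "\<And>f. f * a = 0 \<Longrightarrow> f * v = 0"
proof -
  define X where "X = adj a * a"
  define N where "N = norm X"
  \<comment> \<open>Any cut strictly between 0 and \<open>N\<close> would do: positive, so that the
    inverse square root stays continuous, and below the norm, so that something survives the
    cut.\<close>
  define c where "c = N / 2"
  have N: "N > 0" using a0 adj_mult_eq_0[of a] by (auto simp: N_def X_def)
  have c: "0 < c" "c < N" using N by (auto simp: c_def)
  have XR: "X \<in> R" using aR by (simp add: X_def mult_in adj_in)
  have Xsa: "adj X = X" by (simp add: X_def)
  have btw: "between X 0 N"
    unfolding between_def using adj_mult_nonneg[of a] sa_le_norm[OF Xsa, of N] by (simp add: X_def N_def)
  \<comment> \<open>\<open>h\<close> vanishes up to \<open>c\<close>, \<open>g\<close> is the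
    inverse square root beyond \<open>c\<close>, and the factorization of \<open>h\<close> as
    \<open>k\<close> times the identity function shows that \<open>h(X)\<close> annihilates whatever
    \<open>X\<close> annihilates.\<close>
  define h where "h = (\<lambda>t::real. max (t - c) 0)"
  define k where "k = (\<lambda>t::real. max (t - c) 0 / max t c)"
  define g where "g = (\<lambda>t::real. 1 / sqrt (max t c))"
  have m0: "max t c \<noteq> 0" "max t c > 0" "sqrt (max t c) \<noteq> 0" for t using c by (auto simp: max_def)
  have ch: "continuous_on S h" for S unfolding h_def by (intro continuous_intros)
  have ck: "continuous_on S k" for S unfolding k_def by (intro continuous_intros ballI m0)
  have cg: "continuous_on S g" for S unfolding g_def by (intro continuous_intros ballI m0)
  have ci: "continuous_on S (\<lambda>t::real. t)" for S by (rule continuous_on_id)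
  define Z where "Z = fc h X"
  define Y where "Y = fc g X"
  have ZR: "Z \<in> R" and YR: "Y \<in> R" unfolding Z_def Y_def by (intro fc_in[OF XR btw] ch cg)+
  have Zsa: "adj Z = Z" and Ysa: "adj Y = Y" unfolding Z_def Y_def by (intro fc_sa[OF btw] ch cg)+
  have Zk: "Z = fc k X * X"
  proof -
    have "Z = fc (\<lambda>t. k t * t) X"
      unfolding Z_def
    proof (rule fc_cong[OF btw])
      fix t show "h t = k t * t" using c by (cases "t \<le> c") (auto simp: h_def k_def max_def)
    qed
    also have "\<dots> = fc k X * fc (\<lambda>t. t) X" by (rule fc_mult[OF btw ck ci])
    finally show ?thesis by (simp add: fc_id[OF btw])
  qed
  define D where "D = Y * X * Y - 1"
  \<comment> \<open>Wherever \<open>h\<close> is nonzero, \<open>g t * t * g t = 1\<close>. So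
    \<open>D\<close>, the failure of \<open>Y * X * Y\<close> to be the identity, maps into the
    kernel of \<open>Z\<close>.\<close>
  have ZD: "Z * D = 0"
  proof -
    have cgt: "continuous_on S (\<lambda>t. g t * t)" "continuous_on S (\<lambda>t. g t * t * g t)" for S
      by (intro continuous_on_mult cg ci)+
    have "D = fc (\<lambda>t. g t * t * g t - 1) X"
      by (simp add: D_def Y_def fc_diff[OF btw cgt(2) continuous_on_const] fc_mult[OF btw cgt(1) cg]
          fc_mult[OF btw cg ci] fc_id[OF btw] fc_const[OF btw])
    then have "Z * D = fc (\<lambda>t. h t * (g t * t * g t - 1)) X"
      unfolding Z_def by (simp add: fc_mult[OF btw ch continuous_on_diff[OF cgt(2) continuous_on_const]])
    also have "\<dots> = fc (\<lambda>t. 0) X"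
    proof (rule fc_cong[OF btw])
      fix t
      show "h t * (g t * t * g t - 1) = 0"
      proof (cases "t \<le> c")
        case False
        then have "g t * t * g t = 1" using c by (simp add: g_def)
        then show ?thesis by simp
      qed (simp add: h_def)
    qed
    finally show ?thesis by (simp add: fc_const[OF btw])
  qed
  obtain q where q: "q \<in> R" "adj q = q" "q * q = q" "Z * q = 0"
    "\<And>x. Z \<cdot> x = 0 \<Longrightarrow> q \<cdot> x = x"
    using kernel_projection[of "{Z}"] ZR by auto
  have qz: "q * b = b" if "Z * b = 0" for b
  proof (rule app_ext)
    fix x
    have "(Z * b) \<cdot> x = 0" using that by simp
    then show "(q * b) \<cdot> x = b \<cdot> x" using q(5)[of "b \<cdot> x"] by simp
  qed
  define p where "p = 1 - q"
  have pR: "p \<in> R" using q(1) by (simp add: p_def diff_in one_in)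
  have psa: "adj p = p" using q(2) by (simp add: p_def)
  have pp: "p * p = p" using q(3) by (simp add: p_def algebra_simps)
  have pz: "p * b = 0" if "Z * b = 0" for b using qz[OF that] by (simp add: p_def left_diff_distrib)
  define v where "v = a * Y * p"
  have vR: "v \<in> R" using aR YR pR by (simp add: v_def mult_in)
  \<comment> \<open>\<open>p\<close> annihilates \<open>D\<close>, so the factor \<open>Y\<close>
    normalizes \<open>a\<close> on the range of \<open>p\<close> exactly.\<close>
  have vv: "adj v * v = p"
  proof -
    have "adj v * v = p * (Y * X * Y) * p" by (simp add: v_def X_def psa Ysa mult.assoc)
    also have "\<dots> = p * (1 + D) * p" by (simp add: D_def)
    also have "\<dots> = p * p + (p * D) * p" by (simp add: distrib_left distrib_right)
    also have "\<dots> = p" using pz[OF ZD] pp by simp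
    finally show ?thesis .
  qed
  have vp: "v * p = v" by (simp add: v_def mult.assoc pp)
  \<comment> \<open>If \<open>h(X)\<close> vanished, \<open>X\<close> would be bounded by
    \<open>c\<close>, which is smaller than its norm.\<close>
  have "p \<noteq> 0"
  proof
    assume "p = 0"
    then have "q = 1" by (simp add: p_def)
    then have Z0: "fc h X = 0" using q(4) by (simp add: Z_def)
    have "fc (\<lambda>t. t) X \<le> fc (\<lambda>t. c + h t) X"
      by (intro fc_mono[OF btw] continuous_on_add continuous_on_const ch ci) (simp add: h_def)
    then have "X \<le> c *\<^sub>R 1"
      using Z0 by (simp add: fc_id[OF btw] fc_add[OF btw continuous_on_const ch] fc_const[OF btw])
    moreover have "- (c *\<^sub>R 1) \<le> X"
    proof -
      have "- (c *\<^sub>R 1) \<le> (0 :: 'h cop)" using scal_mono[of 0 c] c by simp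
      also have "0 \<le> X" by (simp add: X_def adj_mult_nonneg)
      finally show ?thesis .
    qed
    ultimately have "norm X \<le> \<bar>c\<bar>" by (rule norm_le_of_le[rotated])
    then show False using c by (simp add: N_def)
  qed
  then have v0: "v \<noteq> 0" using vv by auto
  have vvv: "v * adj v * v = v" using vv vp by (simp add: mult.assoc)
  have ve: "v * e = 0" if "a * e = 0" for e
  proof -
    have "X * e = 0" using that by (simp add: X_def mult.assoc)
    then have "Z * e = 0" by (simp add: Zk mult.assoc)
    then have "p * e = 0" by (rule pz)
    then show ?thesis by (simp add: v_def mult.assoc)
  qed
  have fv: "f * v = 0" if "f * a = 0" for f
  proof -
    have "f * v = (f * a) * Y * p" by (simp add: v_def mult.assoc)
    then show ?thesis using that by simp
  qed
  show ?thesis by (rule that[OF vR v0 vvv ve fv])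
qed

end

context factor_alg
begin

text \<open>Zorn's lemma gives a maximal family of orthogonal partial isometries from
  \<open>e\<close> to \<open>f\<close>. A nonzero element \<open>f0 * r * e0\<close> between the
  leftovers would yield another member, so all of them vanish, and primeness makes one leftover
  0.\<close>

lemma comparison:
  assumes e: "e \<in> R" "adj e = e" "e * e = e" and f: "f \<in> R" "adj f = f" "f * f = f"
  obtains u where "u \<in> R" "adj u * u = e" "f * (u * adj u) = u * adj u" "u * adj u * u = u"
  | u where "u \<in> R" "u * adj u = f" "e * (adj u * u) = adj u * u" "u * adj u * u = u"
proof -
  let ?A = "{V. partial_isometries R e f V}"
  have "\<exists>M\<in>?A. \<forall>V\<in>?A. M \<subseteq> V \<longrightarrow> V = M"
  proof (rule subset_Zorn)
    fix C assume C: "subset.chain ?A C"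
    then have sub: "\<And>V. V \<in> C \<Longrightarrow> partial_isometries R e f V"
      and ch: "\<And>V W. V \<in> C \<Longrightarrow> W \<in> C \<Longrightarrow> V \<subseteq> W \<or> W \<subseteq> V"
      by (auto simp: subset_chain_def)
    have "partial_isometries R e f (\<Union>C)"
      unfolding partial_isometries_def
    proof (intro conjI ballI impI)
      fix v assume "v \<in> \<Union>C"
      then obtain V where V: "V \<in> C" "v \<in> V" by blast
      note h = sub[OF V(1), unfolded partial_isometries_def, THEN conjunct1, rule_format, OF V(2)]
      show "v \<in> R" "v \<noteq> 0" "v * adj v * v = v" "v * e = v" "f * v = v" using h by simp_all
      fix w assume "w \<in> \<Union>C" and ne: "v \<noteq> w"
      then obtain W where W: "W \<in> C" "w \<in> W" by blast
      obtain U where U: "U \<in> C" "v \<in> U" "w \<in> U" using ch[OF V(1) W(1)] V W by blast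
      note k = sub[OF U(1), unfolded partial_isometries_def, THEN conjunct2, rule_format, OF U(2,3) ne]
      show "adj v * w = 0" "v * adj w = 0" using k by simp_all
    qed
    then show "\<exists>U\<in>?A. \<forall>X\<in>C. X \<subseteq> U" by (intro bexI[of _ "\<Union>C"]) auto
  qed
  then obtain V where V: "partial_isometries R e f V"
    and maxV: "\<And>W. partial_isometries R e f W \<Longrightarrow> V \<subseteq> W \<Longrightarrow> W = V" by blast
  obtain u where u: "u \<in> R" "\<And>v. v \<in> V \<Longrightarrow> u * adj v = v * adj v"
    "\<And>v. v \<in> V \<Longrightarrow> adj u * v = adj v * v" "u * adj u * u = u" "u * e = u" "f * u = u"
    using sum_partial_isometries[OF V] by blast
  define e0 where "e0 = e - adj u * u"
  define f0 where "f0 = f - u * adj u"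
  have e0R: "e0 \<in> R" "f0 \<in> R" using e(1) f(1) u(1) by (simp_all add: e0_def f0_def alg_in)
  have eu: "e * adj u = adj u" using arg_cong[OF u(5), of adj] e(2) by simp
  have uf: "adj u * f = adj u" using arg_cong[OF u(6), of adj] f(2) by simp
  have uuu: "adj u * (u * adj u) = adj u" using partial_isometry_adj[OF u(4)] by (simp add: mult.assoc)
  have e0e: "e0 * e = e0"
    using e(3) u(5) by (simp add: e0_def left_diff_distrib mult.assoc)
  have e0e0: "e0 * e0 = e0"
  proof -
    have "e0 * (adj u * u) = 0"
      using eu uuu by (simp add: e0_def left_diff_distrib flip: mult.assoc)
    then show ?thesis using e0e by (simp add: e0_def right_diff_distrib)
  qed
  have ff0: "f * f0 = f0" using f(3) u(6) by (simp add: f0_def right_diff_distrib flip: mult.assoc)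
  have f0f0: "f0 * f0 = f0"
  proof -
    have "u * adj u * f0 = 0"
      using uf uuu by (simp add: f0_def right_diff_distrib mult.assoc)
    then show ?thesis using ff0 by (simp add: f0_def left_diff_distrib)
  qed
  have "f0 * r * e0 = 0" if r: "r \<in> R" for r
  proof (rule ccontr)
    assume "f0 * r * e0 \<noteq> 0"
    moreover have "f0 * r * e0 \<in> R" using e0R r by (simp add: mult_in)
    ultimately obtain v where v: "v \<in> R" "v \<noteq> 0" "v * adj v * v = v"
      "\<And>c. f0 * r * e0 * c = 0 \<Longrightarrow> v * c = 0" "\<And>c. c * (f0 * r * e0) = 0 \<Longrightarrow> c * v = 0"
      using exists_partial_isometry by blast
    have "f0 * r * e0 * (1 - e0) = 0" by (simp add: right_diff_distrib mult.assoc e0e0)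
    then have ve0: "v * e0 = v" using v(4)[of "1 - e0"] by (simp add: right_diff_distrib)
    have "(1 - f0) * (f0 * r * e0) = 0" by (simp add: left_diff_distrib f0f0 flip: mult.assoc)
    then have f0v: "f0 * v = v" using v(5)[of "1 - f0"] by (simp add: left_diff_distrib)
    have 1: "v * adj w = 0" if w: "w \<in> V" for w
    proof -
      have W: "w * adj w * w = w" "w * e = w"
        using V w by (auto simp: partial_isometries_def)
      have "e * adj w = adj w" using arg_cong[OF W(2), of adj] e(2) by simp
      moreover have "adj u * (u * adj w) = adj w"
        using u(2,3)[OF w] partial_isometry_adj[OF W(1)] by (simp flip: mult.assoc)
      ultimately have "e0 * adj w = 0" by (simp add: e0_def left_diff_distrib mult.assoc)
      then have "v * e0 * adj w = 0" by (simp add: mult.assoc)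
      then show ?thesis by (simp add: ve0)
    qed
    have 2: "adj w * v = 0" if w: "w \<in> V" for w
    proof -
      have W: "w * adj w * w = w" "f * w = w"
        using V w by (auto simp: partial_isometries_def)
      have "u * (adj u * w) = w"
        using u(2,3)[OF w] W(1) by (simp flip: mult.assoc)
      then have "f0 * w = 0" using W(2) by (simp add: f0_def left_diff_distrib mult.assoc)
      then have "adj (f0 * w) = 0" by simp
      then have "adj w * f0 = 0" using f(2) by (simp add: f0_def)
      then have "adj w * f0 * v = 0" by simp
      then show ?thesis by (simp add: mult.assoc f0v)
    qed
    have "v \<notin> V"
    proof
      assume "v \<in> V"
      then have "v * adj v = 0" by (rule 1)
      then show False using v(2,3) by simp
    qed
    have "v * e0 * e = v * e0" by (simp only: mult.assoc e0e)
    then have vew: "v * e = v" by (simp only: ve0)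
    have "f * (f0 * v) = f0 * v" by (simp only: ff0 flip: mult.assoc)
    then have fvw: "f * v = v" by (simp only: f0v)
    have 3: "adj v * w = 0 \<and> w * adj v = 0" if "w \<in> V" for w
      using arg_cong[OF 1[OF that], of adj] arg_cong[OF 2[OF that], of adj] by simp
    have "partial_isometries R e f (insert v V)"
      using V v(1,2,3) vew fvw 1 2 3 unfolding partial_isometries_def by simp
    then have "insert v V = V" by (rule maxV) auto
    then show False using \<open>v \<notin> V\<close> by blast
  qed
  then have "f0 = 0 \<or> e0 = 0" using prime[OF e0R(2)] by blast
  then show ?thesis
  proof
    assume "e0 = 0"
    then show ?thesis using u by (intro that(1)[of u]) (simp_all add: e0_def flip: mult.assoc)
  next
    assume "f0 = 0"
    then show ?thesis using u eu by (intro that(2)[of u]) (simp_all add: f0_def flip: mult.assoc)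
  qed
qed

end

section \<open>Uniqueness of the trace\<close>

context vn_alg
begin

text \<open>Real-valued and only real-linear: the intended instances are the real part of \<tau> and
  its composition with a map of \<open>R\<close>.\<close>

definition tracial :: "('h cop \<Rightarrow> real) \<Rightarrow> bool" where
  "tracial t \<longleftrightarrow> (\<forall>a\<in>R. \<forall>b\<in>R. t (a + b) = t a + t b) \<and> (\<forall>r. \<forall>a\<in>R. t (r *\<^sub>R a) = r * t a) \<and>
     (\<forall>a\<in>R. \<forall>b\<in>R. t (a * b) = t (b * a)) \<and> (\<forall>a\<in>R. 0 \<le> a \<longrightarrow> 0 \<le> t a) \<and> t 1 = 1"

lemma
  assumes "tracial t"
  shows t_add: "a \<in> R \<Longrightarrow> b \<in> R \<Longrightarrow> t (a + b) = t a + t b"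
    and t_scaleR: "a \<in> R \<Longrightarrow> t (r *\<^sub>R a) = r * t a"
    and t_commute: "a \<in> R \<Longrightarrow> b \<in> R \<Longrightarrow> t (a * b) = t (b * a)"
    and t_nonneg: "a \<in> R \<Longrightarrow> 0 \<le> a \<Longrightarrow> 0 \<le> t a"
    and t_one: "t 1 = 1"
  using assms by (simp_all add: tracial_def)

lemma t_uminus: "tracial t \<Longrightarrow> a \<in> R \<Longrightarrow> t (- a) = - t a"
  using t_scaleR[of t a "-1"] by simp

lemma t_diff: "tracial t \<Longrightarrow> a \<in> R \<Longrightarrow> b \<in> R \<Longrightarrow> t (a - b) = t a - t b"
  using t_add[of t a "- b"] t_uminus[of t b] by (simp add: uminus_in)

lemma t_mono: "tracial t \<Longrightarrow> a \<in> R \<Longrightarrow> b \<in> R \<Longrightarrow> a \<le> b \<Longrightarrow> t a \<le> t b"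
  using t_nonneg[of t "b - a"] t_diff[of t b a] by (simp add: diff_in)

lemma t_abs_le: "tracial t \<Longrightarrow> a \<in> R \<Longrightarrow> adj a = a \<Longrightarrow> \<bar>t a\<bar> \<le> norm a"
proof -
  assume t: "tracial t" and a: "a \<in> R" "adj a = a"
  have "between a (- norm a) (norm a)" using a(2) by (intro sa_between_norm) auto
  then have "t a \<le> t (norm a *\<^sub>R 1)" "t ((- norm a) *\<^sub>R 1) \<le> t a"
    unfolding between_def by (intro t_mono[OF t] alg_in a(1); simp)+
  then show ?thesis by (simp add: t_scaleR[OF t one_in] t_one[OF t] t_uminus[OF t] one_in scaleR_in)
qed

end

context factor_alg
begin

text \<open>Let \<open>e\<close> be the support of the positive part of \<open>a\<close>, and \<open>f = 1 - e\<close>. If \<open>e\<close> is equivalent to \<open>p \<le> f\<close>,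
  then moving \<open>\<parallel>a\<parallel>/2\<close> from \<open>e\<close> to \<open>p\<close> does not change \<open>t1 a - t2 a\<close> but puts the spectrum into an interval
  of length \<open>3\<parallel>a\<parallel>/2\<close>, which is then centred by subtracting a scalar; similarly with the roles exchanged.\<close>

lemma trace_diff_shrink:
  assumes t1: "tracial t1" and t2: "tracial t2"
    and K: "\<And>a. a \<in> R \<Longrightarrow> adj a = a \<Longrightarrow> \<bar>t1 a - t2 a\<bar> \<le> K * norm a"
    and a: "a \<in> R" "adj a = a"
  shows "\<bar>t1 a - t2 a\<bar> \<le> (3/4) * K * norm a"
proof -
  define d where "d x = t1 x - t2 x" for x
  have dadd: "d (x + y) = d x + d y" if "x \<in> R" "y \<in> R" for x y
    using that by (simp add: d_def t_add[OF t1] t_add[OF t2])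
  have dsc: "d (r *\<^sub>R x) = r * d x" if "x \<in> R" for r x
    using that by (simp add: d_def t_scaleR[OF t1] t_scaleR[OF t2] algebra_simps)
  have ddiff: "d (x - y) = d x - d y" if "x \<in> R" "y \<in> R" for x y
    using that by (simp add: d_def t_diff[OF t1] t_diff[OF t2])
  have d1: "d 1 = 0" by (simp add: d_def t_one[OF t1] t_one[OF t2])
  have dcomm: "d (x * y) = d (y * x)" if "x \<in> R" "y \<in> R" for x y
    using that by (simp add: d_def t_commute[OF t1, of x y] t_commute[OF t2, of x y])
  define N where "N = norm a"
  have N0: "0 \<le> N" by (simp add: N_def)
  have btw: "between a (- N) N" using a(2) by (intro sa_between_norm) (auto simp: N_def)
  have c1: "continuous_on S (\<lambda>t::real. max t 0)" "continuous_on S (\<lambda>t::real. max (- t) 0)" for S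
    by (intro continuous_intros)+
  have c0: "continuous_on S (\<lambda>t::real. t)" for S by (rule continuous_on_id)
  define P where "P = fc (\<lambda>t. max t 0) a"
  define M where "M = fc (\<lambda>t. max (- t) 0) a"
  have PR: "P \<in> R" unfolding P_def by (intro fc_in[OF a(1) btw] c1)
  have Psa: "adj P = P" "adj M = M" unfolding P_def M_def by (intro fc_sa[OF btw] c1)+
  have PM: "P * M = 0"
  proof -
    have "P * M = fc (\<lambda>t. max t 0 * max (- t) 0) a" unfolding P_def M_def by (rule fc_mult[OF btw c1, symmetric])
    also have "\<dots> = fc (\<lambda>t. 0) a" by (rule fc_cong[OF btw]) (simp add: max_def)
    finally show ?thesis by (simp add: fc_const[OF btw])
  qed
  have aPM: "a \<le> P" "- M \<le> a"
  proof -
    have "fc (\<lambda>t. t) a \<le> P" unfolding P_def by (intro fc_mono[OF btw] c0 c1) simp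
    then show "a \<le> P" by (simp add: fc_id[OF btw])
    have "fc (\<lambda>t. - 1 * t) a \<le> M" unfolding M_def by (intro fc_mono[OF btw] continuous_on_mult continuous_on_const c0 c1) simp
    then have "- a \<le> M" by (simp only: fc_scaleR[OF btw c0] fc_id[OF btw] scaleR_minus1_left)
    then show "- M \<le> a" by (simp add: minus_le_iff)
  qed
  have PN: "P \<le> N *\<^sub>R 1" "M \<le> N *\<^sub>R 1"
    unfolding P_def M_def fc_const[OF btw, symmetric]
    using N0 by (intro fc_mono[OF btw] c1 continuous_on_const; simp)+
  \<comment> \<open>\<open>f\<close> projects onto the kernel of the positive part \<open>P\<close>.
    The range of the negative part \<open>M\<close> lies in that kernel because
    \<open>P * M = 0\<close>; hence \<open>a\<close> is at most \<open>N e\<close> and at least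
    \<open>-N f\<close>.\<close>
  obtain f where f: "f \<in> R" "adj f = f" "f * f = f" "P * f = 0" "\<And>x. P \<cdot> x = 0 \<Longrightarrow> f \<cdot> x = x"
    using kernel_projection[of "{P}"] PR by auto
  define e where "e = 1 - f"
  have e: "e \<in> R" "adj e = e" "e * e = e" using f(1,2,3) by (simp_all add: e_def diff_in one_in algebra_simps)
  have ef: "e + f = 1" by (simp add: e_def)
  have Pe: "e * P * e = P"
  proof -
    have "adj (P * f) = 0" by (simp add: f(4))
    then have "f * P = 0" using f(2) Psa by simp
    then show ?thesis using f(4) by (simp add: e_def left_diff_distrib right_diff_distrib mult.assoc)
  qed
  have Mf: "f * M * f = M"
  proof -
    have fM: "f * M = M"
    proof (rule app_ext)
      fix x
      have "(P * M) \<cdot> x = 0" by (simp only: PM app_simps)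
      then show "(f * M) \<cdot> x = M \<cdot> x" using f(5)[of "M \<cdot> x"] by simp
    qed
    have "adj (f * M) = adj M" by (simp only: fM)
    then have "M * f = M" using f(2) Psa by simp
    then show ?thesis by (simp only: fM mult.assoc)
  qed
  have Pe': "P \<le> N *\<^sub>R e"
  proof -
    have "adj e * P * e \<le> adj e * (N *\<^sub>R 1) * e" by (rule sandwich_mono[OF PN(1)])
    then show ?thesis by (simp only: e Pe mult_scaleR_left mult_scaleR_right mult_1_right)
  qed
  have Mf': "M \<le> N *\<^sub>R f"
  proof -
    have "adj f * M * f \<le> adj f * (N *\<^sub>R 1) * f" by (rule sandwich_mono[OF PN(2)])
    then show ?thesis by (simp only: f(2,3) Mf mult_scaleR_left mult_scaleR_right mult_1_right)
  qed
  have au: "a \<le> N *\<^sub>R e" using aPM(1) Pe' by (rule order_trans)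
  have al: "- (N *\<^sub>R f) \<le> a" using Mf' aPM(2) by (meson neg_le_iff_le order_trans)
  have N2: "0 \<le> N / 2" using N0 by simp
  \<comment> \<open>The difference \<open>d\<close> vanishes on scalars, so an element within
    \<open>3/4 * N\<close> of the scalar \<open>l\<close> may be centred before the assumed bound is
    applied.\<close>
  have key: "\<bar>d a\<bar> \<le> (3/4) * K * N"
    if b: "b \<in> R" "d b = d a" and lo: "(l - 3/4 * N) *\<^sub>R 1 \<le> b" and hi: "b \<le> (l + 3/4 * N) *\<^sub>R 1" for b l
  proof -
    define b' where "b' = b - l *\<^sub>R 1"
    have b'R: "b' \<in> R" using b(1) by (simp add: b'_def diff_in scaleR_in one_in)
    have "- ((3/4 * N) *\<^sub>R 1) \<le> b'"
      using add_right_mono[OF lo, of "- (l *\<^sub>R 1)"] by (simp add: b'_def scaleR_diff_left)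
    moreover have "b' \<le> (3/4 * N) *\<^sub>R 1"
      using add_right_mono[OF hi, of "- (l *\<^sub>R 1)"] by (simp add: b'_def scaleR_add_left)
    ultimately have n: "norm b' \<le> \<bar>3/4 * N\<bar>" by (rule norm_le_of_le)
    have sa: "adj b' = b'" using ge_scal_sa[OF lo] by (simp add: b'_def)
    have "d a = d b'" using b by (simp add: b'_def ddiff dsc d1 one_in scaleR_in)
    then have dle: "\<bar>d a\<bar> \<le> K * norm b'" using K[OF b'R sa] by (simp add: d_def)
    show ?thesis
    proof (cases "0 \<le> K")
      case True
      have "K * norm b' \<le> K * (3/4 * N)" using n N0 True by (intro mult_left_mono) auto
      then show ?thesis using dle by simp
    next
      \<comment> \<open>For negative \<open>K\<close> the hypothesis at \<open>a\<close> itself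
        forces \<open>d a = 0\<close> and \<open>K * N = 0\<close>.\<close>
      case False
      have "\<bar>d a\<bar> \<le> K * N" using K[OF a] by (simp add: d_def N_def)
      moreover have "K * N \<le> 0" using False N0 by (simp add: mult_nonpos_nonneg)
      ultimately have kn: "K * N = 0" and da: "\<bar>d a\<bar> \<le> 0" by linarith+
      show ?thesis using da by (simp only: mult.assoc kn mult_zero_right)
    qed
  qed
  have "\<bar>d a\<bar> \<le> (3/4) * K * N"
  proof (rule comparison[OF e f(1,2,3)])
    fix u assume u: "u \<in> R" "adj u * u = e" "f * (u * adj u) = u * adj u" "u * adj u * u = u"
    define p where "p = u * adj u"
    have pR: "p \<in> R" using u(1) by (simp add: p_def mult_in adj_in)
    have pp: "adj p = p" "p * p = p" using u(4) by (simp_all add: p_def flip: mult.assoc)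
    have pf: "p \<le> f" using u(3) by (intro projection_le pp f(2,3)) (simp add: p_def)
    have p0: "0 \<le> p" using pp by (rule projection_nonneg)
    have dp: "d p = d e" using dcomm[OF u(1) adj_in[OF u(1)]] u(2) by (simp add: p_def)
    \<comment> \<open>Now \<open>b\<close> lies between \<open>-N\<close> and \<open>N/2\<close>:
      centre \<open>-N/4\<close>, half-length \<open>3N/4\<close>.\<close>
    define b where "b = a - (N/2) *\<^sub>R e + (N/2) *\<^sub>R p"
    have bR: "b \<in> R" using a(1) e(1) pR by (simp add: b_def add_in diff_in scaleR_in)
    have db: "d b = d a" using a(1) e(1) pR dp by (simp add: b_def dadd ddiff dsc diff_in scaleR_in)
    have "b \<le> N *\<^sub>R e - (N/2) *\<^sub>R e + (N/2) *\<^sub>R f"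
      unfolding b_def using au pf N2 by (intro add_mono diff_right_mono scaleR_left_mono)
    also have "\<dots> = (N/2) *\<^sub>R (e + f)"
      using scaleR_diff_left[of N "N/2" e] by (simp add: scaleR_add_right)
    finally have hi: "b \<le> (- N/4 + 3/4 * N) *\<^sub>R 1" by (simp add: ef)
    have m1: "- (N *\<^sub>R f) - (N/2) *\<^sub>R e + (N/2) *\<^sub>R 0 \<le> b"
      unfolding b_def using al p0 N2 by (intro add_mono diff_right_mono scaleR_left_mono)
    have m2: "- (N *\<^sub>R f) - N *\<^sub>R e \<le> - (N *\<^sub>R f) - (N/2) *\<^sub>R e + (N/2) *\<^sub>R 0"
    proof -
      have "(N/2) *\<^sub>R e \<le> N *\<^sub>R e" using N0 by (intro scaleR_right_mono projection_nonneg e) simp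
      then show ?thesis by simp
    qed
    have m3: "- (N *\<^sub>R f) - N *\<^sub>R e = (- N/4 - 3/4 * N) *\<^sub>R 1"
      by (simp flip: ef add: scaleR_add_right)
    have lo: "(- N/4 - 3/4 * N) *\<^sub>R 1 \<le> b" using order_trans[OF m2 m1] by (simp only: m3)
    show ?thesis by (rule key[OF bR db lo hi])
  next
    fix u assume u: "u \<in> R" "u * adj u = f" "e * (adj u * u) = adj u * u" "u * adj u * u = u"
    define p where "p = adj u * u"
    have pR: "p \<in> R" using u(1) by (simp add: p_def mult_in adj_in)
    have pp: "adj p = p" "p * p = p" using partial_isometry_adj[OF u(4)] by (simp_all add: p_def flip: mult.assoc)
    have pe: "p \<le> e" using u(3) by (intro projection_le pp e(2,3)) (simp add: p_def)
    have p0: "0 \<le> p" using pp by (rule projection_nonneg)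
    have dp: "d p = d f" using dcomm[OF u(1) adj_in[OF u(1)]] u(2) by (simp add: p_def)
    \<comment> \<open>The mirror image: \<open>b\<close> lies between \<open>-N/2\<close> and
      \<open>N\<close>, with centre \<open>N/4\<close>.\<close>
    define b where "b = a + (N/2) *\<^sub>R f - (N/2) *\<^sub>R p"
    have bR: "b \<in> R" using a(1) f(1) pR by (simp add: b_def add_in diff_in scaleR_in)
    have db: "d b = d a" using a(1) f(1) pR dp by (simp add: b_def dadd ddiff dsc add_in scaleR_in)
    have m1: "b \<le> N *\<^sub>R e + (N/2) *\<^sub>R f - (N/2) *\<^sub>R 0"
      unfolding b_def using au p0 N2 by (intro add_right_mono diff_mono scaleR_left_mono)
    have m2: "N *\<^sub>R e + (N/2) *\<^sub>R f - (N/2) *\<^sub>R 0 \<le> N *\<^sub>R e + N *\<^sub>R f"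
    proof -
      have "(N/2) *\<^sub>R f \<le> N *\<^sub>R f" using N0 by (intro scaleR_right_mono projection_nonneg f(2,3)) simp
      then show ?thesis by simp
    qed
    have m3: "N *\<^sub>R e + N *\<^sub>R f = (N/4 + 3/4 * N) *\<^sub>R 1"
      by (simp flip: ef add: scaleR_add_right)
    have hi: "b \<le> (N/4 + 3/4 * N) *\<^sub>R 1" using order_trans[OF m1 m2] by (simp only: m3)
    have "- (N *\<^sub>R f) + (N/2) *\<^sub>R f - (N/2) *\<^sub>R e \<le> b"
      unfolding b_def using al pe N2 by (intro add_right_mono diff_mono scaleR_left_mono)
    moreover have "- (N *\<^sub>R f) + (N/2) *\<^sub>R f - (N/2) *\<^sub>R e = (- (N/2)) *\<^sub>R (e + f)"
      using scaleR_diff_left[of "N/2" N f] by (simp add: scaleR_add_right)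
    ultimately have lo: "(N/4 - 3/4 * N) *\<^sub>R 1 \<le> b" by (simp add: ef)
    show ?thesis by (rule key[OF bR db lo hi])
  qed
  then show ?thesis by (simp add: d_def N_def)
qed

text \<open>Each trace is bounded by the norm, so the difference starts with the constant 2; every
  application of the shrinking step multiplies the constant by 3/4.\<close>

theorem trace_unique:
  assumes t1: "tracial t1" and t2: "tracial t2" and a: "a \<in> R" "adj a = a"
  shows "t1 a = t2 a"
proof -
  have *: "\<bar>t1 a - t2 a\<bar> \<le> (2 * (3/4) ^ n) * norm a" if "a \<in> R" "adj a = a" for n a
    using that
  proof (induct n arbitrary: a)
    case 0
    then show ?case using t_abs_le[OF t1, of a] t_abs_le[OF t2, of a] by simp
  next
    case (Suc n)
    have "\<bar>t1 a - t2 a\<bar> \<le> (3/4) * (2 * (3/4) ^ n) * norm a"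
      by (rule trace_diff_shrink[OF t1 t2]) (use Suc in auto)
    then show ?case by simp
  qed
  have "(\<lambda>n. (2 * (3/4::real) ^ n) * norm a) \<longlonglongrightarrow> (2 * 0) * norm a"
    by (intro tendsto_mult tendsto_const LIMSEQ_power_zero) simp
  then have "\<bar>t1 a - t2 a\<bar> \<le> (2 * 0) * norm a"
    by (rule LIMSEQ_le_const) (use *[OF a] in blast)
  then show ?thesis by simp
qed

end

section \<open>Positive invertible elements\<close>

context vn_alg
begin

text \<open>A positive lower bound is the form of positivity with invertibility that passes directly
  to sums and positive multiples, and it supplies the interval on which logarithms and inverses are
  continuous. \<open>gl_iff\<close> identifies it with the usual description.\<close>

definition gl :: "'h cop set" where
  "gl = {a \<in> R. \<exists>c>0. c *\<^sub>R 1 \<le> a}"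

lemma glI: "a \<in> R \<Longrightarrow> 0 < c \<Longrightarrow> c *\<^sub>R 1 \<le> a \<Longrightarrow> a \<in> gl"
  by (auto simp: gl_def)

lemma gl_in: "a \<in> gl \<Longrightarrow> a \<in> R"
  by (simp add: gl_def)

lemma gl_sa: "a \<in> gl \<Longrightarrow> adj a = a"
  using ge_scal_sa by (auto simp: gl_def)

lemma gl_unit: "a \<in> gl \<Longrightarrow> unit a"
  using unit_positive by (auto simp: gl_def)

text \<open>The interval is chosen to contain 1, so it is nonempty, serves for segments starting at
  the identity, and meets the condition \<open>1 \<le> M\<close> of
  \<open>concave_gap\<close>.\<close>

lemma gl_between:
  assumes "a \<in> gl"
  obtains m M where "0 < m" "m \<le> 1" "1 \<le> M" "between a m M"
proof -
  obtain c where c: "0 < c" "c *\<^sub>R 1 \<le> a" using assms by (auto simp: gl_def)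
  have "min c 1 *\<^sub>R 1 \<le> a" using scal_mono[of "min c 1" c] c(2) by (meson min.cobounded1 order_trans)
  moreover have "a \<le> max (norm a) 1 *\<^sub>R 1" by (rule sa_le_norm[OF gl_sa[OF assms]]) simp
  ultimately have "between a (min c 1) (max (norm a) 1)" by (simp add: between_def)
  then show ?thesis by (rule that[rotated 3]) (use c in auto)
qed

lemma one_gl: "1 \<in> gl"
  by (rule glI[of _ 1]) (simp_all add: one_in)

lemma gl_nonneg: "a \<in> gl \<Longrightarrow> 0 \<le> a"
proof -
  assume "a \<in> gl"
  then obtain m M where m: "0 < m" "between a m M" using gl_between by blast
  have "(0::'h cop) \<le> m *\<^sub>R 1" using scal_mono[of 0 m] m(1) by simp
  also have "\<dots> \<le> a" using m(2) by (simp add: between_def)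
  finally show "0 \<le> a" .
qed

lemma gl_add_nonneg: "a \<in> gl \<Longrightarrow> b \<in> R \<Longrightarrow> 0 \<le> b \<Longrightarrow> a + b \<in> gl"
proof -
  assume h: "a \<in> gl" "b \<in> R" "0 \<le> b"
  then obtain c where c: "0 < c" "c *\<^sub>R 1 \<le> a" by (auto simp: gl_def)
  have "c *\<^sub>R 1 + 0 \<le> a + b" by (rule add_mono) (use c h in auto)
  then show ?thesis using h by (intro glI[OF _ c(1)]) (simp_all add: add_in gl_in)
qed

lemma gl_add: "a \<in> gl \<Longrightarrow> b \<in> gl \<Longrightarrow> a + b \<in> gl"
  by (rule gl_add_nonneg) (simp_all add: gl_in gl_nonneg)

lemma gl_scaleR: "0 < r \<Longrightarrow> a \<in> gl \<Longrightarrow> r *\<^sub>R a \<in> gl"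
proof -
  assume h: "0 < r" "a \<in> gl"
  then obtain c where c: "0 < c" "c *\<^sub>R 1 \<le> a" by (auto simp: gl_def)
  have "r *\<^sub>R c *\<^sub>R 1 \<le> r *\<^sub>R a" using h(1) by (intro scaleR_left_mono c) simp
  then show ?thesis using c(1) h by (intro glI[of _ "r * c"]) (simp_all add: scaleR_in gl_in)
qed

lemma gl_fc:
  assumes a: "a \<in> R" "between a \<alpha> \<beta>" and f: "continuous_on {\<alpha>..\<beta>} f"
    and c: "0 < c" "\<And>x. \<alpha> \<le> x \<Longrightarrow> x \<le> \<beta> \<Longrightarrow> c \<le> f x"
  shows "fc f a \<in> gl"
proof (rule glI[OF _ c(1)])
  show "fc f a \<in> R" by (rule fc_in[OF a f])
  show "c *\<^sub>R 1 \<le> fc f a"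
    unfolding fc_const[OF a(2), symmetric] by (intro fc_mono[OF a(2)] continuous_on_const f c(2))
qed

lemma continuous_on_inverse_pos: "0 < m \<Longrightarrow> continuous_on {m..M} (\<lambda>x::real. 1 / x)"
  by (intro continuous_intros) auto

lemma continuous_on_ln_pos: "0 < m \<Longrightarrow> continuous_on {m..M} (\<lambda>x::real. ln x)"
  by (intro continuous_intros) auto

lemma cinv_fc:
  assumes "0 < m" "between a m M"
  shows "cinv a = fc (\<lambda>x. 1 / x) a"
proof (rule cinv_eq)
  note c = continuous_on_inverse_pos[OF assms(1), of M]
  have "a * fc (\<lambda>x. 1 / x) a = fc (\<lambda>x. x) a * fc (\<lambda>x. 1 / x) a" by (simp add: fc_id[OF assms(2)])
  also have "\<dots> = fc (\<lambda>x. x * (1 / x)) a" by (rule fc_mult[OF assms(2) continuous_on_id c, symmetric])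
  also have "\<dots> = fc (\<lambda>x. 1) a" using assms(1) by (intro fc_cong[OF assms(2)]) simp
  finally show "a * fc (\<lambda>x. 1 / x) a = 1" by (simp add: fc_const[OF assms(2)])
  then show "fc (\<lambda>x. 1 / x) a * a = 1" using fc_commute[OF assms(2) c, of a] by simp
qed

lemma gl_cinv: "a \<in> gl \<Longrightarrow> cinv a \<in> gl"
proof -
  assume a: "a \<in> gl"
  then obtain m M where m: "0 < m" "m \<le> 1" "1 \<le> M" "between a m M" using gl_between by blast
  show ?thesis
    unfolding cinv_fc[OF m(1,4)]
    by (rule gl_fc[OF gl_in[OF a] m(4) continuous_on_inverse_pos[OF m(1)], of "1/M"])
       (use m in \<open>auto intro!: divide_left_mono\<close>)
qed

section \<open>Square roots, conjugation, and the description of positive invertible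
  elements\<close>

definition rt :: "'h cop \<Rightarrow> 'h cop" where
  "rt a = fc sqrt a"

lemma rt_gl: "a \<in> gl \<Longrightarrow> rt a \<in> gl"
proof -
  assume a: "a \<in> gl"
  then obtain m M where m: "0 < m" "m \<le> 1" "1 \<le> M" "between a m M" using gl_between by blast
  show ?thesis
    unfolding rt_def
    by (rule gl_fc[OF gl_in[OF a] m(4), of _ "sqrt m"]) (use m in \<open>auto intro!: continuous_intros\<close>)
qed

lemma rt_sq: "a \<in> gl \<Longrightarrow> rt a * rt a = a"
proof -
  assume a: "a \<in> gl"
  then obtain m M where m: "0 < m" "m \<le> 1" "1 \<le> M" "between a m M" using gl_between by blast
  have c: "continuous_on {m..M} sqrt" by (intro continuous_intros)
  have "rt a * rt a = fc (\<lambda>x. sqrt x * sqrt x) a" unfolding rt_def by (rule fc_mult[OF m(4) c c, symmetric])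
  also have "\<dots> = fc (\<lambda>x. x) a" using m(1) by (intro fc_cong[OF m(4)]) simp
  finally show ?thesis by (simp add: fc_id[OF m(4)])
qed

text \<open>A left inverse \<open>d\<close> bounds \<open>norm x\<close> by
  \<open>norm d * norm (c \<cdot> x)\<close>. Adding 1 to \<open>norm d\<close> keeps the resulting
  constant well defined when \<open>d = 0\<close>.\<close>

lemma gram_ge:
  assumes "d * c = (1 :: 'h cop)"
  shows "\<exists>k>0. k *\<^sub>R 1 \<le> adj c * c"
proof (intro exI conjI)
  define k where "k = 1 / (norm d + 1)\<^sup>2"
  have np: "norm d + 1 > 0" by (smt (verit) norm_ge_zero)
  then show "0 < k" by (simp add: k_def)
  show "k *\<^sub>R 1 \<le> adj c * c"
  proof (subst le_iff)
    show "\<forall>x. inner ((k *\<^sub>R 1) \<cdot> x) x \<le> inner ((adj c * c) \<cdot> x) x"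
    proof
      fix x
      have "norm x = norm (d \<cdot> c \<cdot> x)" using app_simps(7)[of d c x] by (simp add: assms del: app_simps(7))
      also have "\<dots> \<le> norm d * norm (c \<cdot> x)" by (rule norm_app)
      also have "\<dots> \<le> (norm d + 1) * norm (c \<cdot> x)" by (intro mult_right_mono) auto
      finally have "(norm x)\<^sup>2 \<le> ((norm d + 1) * norm (c \<cdot> x))\<^sup>2" by (intro power_mono) auto
      then have "k * (norm x)\<^sup>2 \<le> (norm (c \<cdot> x))\<^sup>2"
        using np by (simp add: k_def power_mult_distrib divide_le_eq mult.commute)
      then show "inner ((k *\<^sub>R 1) \<cdot> x) x \<le> inner ((adj c * c) \<cdot> x) x"
        by (simp add: power2_norm_eq_inner norm_app_sq[symmetric])
    qed
  qed auto
qed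

lemma gl_conj: "c \<in> gl \<Longrightarrow> a \<in> gl \<Longrightarrow> c * a * c \<in> gl"
proof -
  assume c: "c \<in> gl" and a: "a \<in> gl"
  obtain k where k: "0 < k" "k *\<^sub>R 1 \<le> adj c * c" using gram_ge[OF cinv_left[OF gl_unit[OF c]]] by blast
  obtain m where m: "0 < m" "m *\<^sub>R 1 \<le> a" using a by (auto simp: gl_def)
  have "(m * k) *\<^sub>R 1 = m *\<^sub>R k *\<^sub>R (1 :: 'h cop)" by simp
  also have "\<dots> \<le> m *\<^sub>R (adj c * c)" using m(1) by (intro scaleR_left_mono k) simp
  also have "\<dots> = adj c * (m *\<^sub>R 1) * c" by simp
  also have "\<dots> \<le> adj c * a * c" by (rule sandwich_mono[OF m(2)])
  finally show ?thesis using k(1) m(1) c a by (intro glI[of _ "m * k"]) (simp_all add: gl_sa mult_in gl_in)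
qed

lemma square_ge: "0 \<le> k \<Longrightarrow> between a k K \<Longrightarrow> k\<^sup>2 *\<^sub>R 1 \<le> a * a"
proof -
  assume k: "0 \<le> k" and b: "between a k K"
  have c: "continuous_on S (\<lambda>x::real. x * x)" for S by (intro continuous_intros)
  have "fc (\<lambda>x. k\<^sup>2) a \<le> fc (\<lambda>x. x * x) a"
    using k by (intro fc_mono[OF b] continuous_on_const c) (simp add: power2_eq_square mult_mono)
  then show ?thesis by (simp add: fc_const[OF b] fc_mult[OF b continuous_on_id continuous_on_id] fc_id[OF b])
qed

text \<open>Positive operators with an inverse are bounded below: \<open>c \<le> a\<^sup>2 \<le> \<parallel>a\<parallel> a\<close>.\<close>

lemma gl_iff: "a \<in> gl \<longleftrightarrow> a \<in> R \<and> 0 \<le> a \<and> (\<exists>b\<in>R. a * b = 1 \<and> b * a = 1)"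
proof
  assume a: "a \<in> gl"
  then show "a \<in> R \<and> 0 \<le> a \<and> (\<exists>b\<in>R. a * b = 1 \<and> b * a = 1)"
    using gl_in gl_nonneg cinv_left[OF gl_unit[OF a]] cinv_right[OF gl_unit[OF a]] gl_in[OF gl_cinv[OF a]] by blast
next
  assume "a \<in> R \<and> 0 \<le> a \<and> (\<exists>b\<in>R. a * b = 1 \<and> b * a = 1)"
  then obtain b where a: "a \<in> R" "0 \<le> a" and b: "b * a = 1" by blast
  obtain k where k: "0 < k" "k *\<^sub>R 1 \<le> adj a * a" using gram_ge[OF b] by blast
  define N where "N = norm a + 1"
  have N: "0 < N" by (simp add: N_def add_nonneg_pos)
  have btw: "between a 0 N"
    unfolding between_def N_def using a(2) sa_le_norm[OF nonneg_sa[OF a(2)], of "norm a + 1"] by simp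
  have "fc (\<lambda>x. x * x) a \<le> fc (\<lambda>x. N * x) a"
    by (intro fc_mono[OF btw] continuous_intros mult_right_mono)
  then have "a * a \<le> N *\<^sub>R a"
    by (simp only: fc_mult[OF btw continuous_on_id continuous_on_id] fc_scaleR[OF btw continuous_on_id] fc_id[OF btw])
  then have "k *\<^sub>R 1 \<le> N *\<^sub>R a" using k(2) nonneg_sa[OF a(2)] by simp
  then have "(1/N) *\<^sub>R k *\<^sub>R 1 \<le> (1/N) *\<^sub>R N *\<^sub>R a" using N by (intro scaleR_left_mono) auto
  then show "a \<in> gl" using N k(1) by (intro glI[OF a(1), of "1/N * k"]) simp_all
qed

end

section \<open>The logarithmic trace\<close>

locale traced_alg = vn_alg R for R :: "'h::chilbert_space cop set" +
  fixes t :: "'h cop \<Rightarrow> real"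
  assumes tr: "tracial t"
    and t_adj: "a \<in> R \<Longrightarrow> t (adj a) = t a"
    and faithful: "a \<in> R \<Longrightarrow> 0 \<le> a \<Longrightarrow> t a = 0 \<Longrightarrow> a = 0"
begin

lemmas tadd = t_add[OF tr] and tscale = t_scaleR[OF tr] and tcomm = t_commute[OF tr]
  and tnonneg = t_nonneg[OF tr] and tone = t_one[OF tr] and tdiff = t_diff[OF tr] and tmono = t_mono[OF tr]

section \<open>Differentiating traces along a path of operators\<close>

lemma t_norm: "a \<in> R \<Longrightarrow> \<bar>t a\<bar> \<le> norm a"
proof -
  assume a: "a \<in> R"
  define b where "b = (1/2) *\<^sub>R (a + adj a)"
  have "t b = t a" using a by (simp add: b_def tscale tadd t_adj alg_in)
  moreover have "\<bar>t b\<bar> \<le> norm b" using a by (intro t_abs_le[OF tr]) (simp_all add: b_def alg_in add.commute)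
  moreover have "norm b \<le> norm a" using norm_triangle_ineq[of a "adj a"] by (simp add: b_def)
  ultimately show ?thesis by simp
qed

text \<open>\<open>t\<close> is linear and bounded only on \<open>R\<close>, so it is not a bounded
  linear map of the whole type. The bound by the norm is therefore applied directly to the error
  quotient.\<close>

lemma t_has_derivative:
  assumes F: "(F has_vector_derivative D) (at s within S)" "\<And>s. s \<in> S \<Longrightarrow> F s \<in> R" "s \<in> S" "D \<in> R"
  shows "((\<lambda>s. t (F s)) has_vector_derivative t D) (at s within S)"
proof -
  have lim: "((\<lambda>y. (1 / norm (y - s)) *\<^sub>R (F y - (F s + (y - s) *\<^sub>R D))) \<longlongrightarrow> 0) (at s within S)"
    using F(1) by (simp add: has_vector_derivative_def has_derivative_within)
  have "((\<lambda>y. (1 / norm (y - s)) *\<^sub>R (t (F y) - (t (F s) + (y - s) *\<^sub>R t D))) \<longlongrightarrow> 0) (at s within S)"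
  proof (rule Lim_null_comparison[OF _ tendsto_norm_zero[OF lim]])
    have "\<forall>\<^sub>F y in at s within S. y \<in> S" by (simp add: eventually_at_filter)
    then show "\<forall>\<^sub>F y in at s within S. norm ((1 / norm (y - s)) *\<^sub>R (t (F y) - (t (F s) + (y - s) *\<^sub>R t D)))
        \<le> norm ((1 / norm (y - s)) *\<^sub>R (F y - (F s + (y - s) *\<^sub>R D)))"
    proof (rule eventually_mono)
      fix y assume y: "y \<in> S"
      have "t (F y) - (t (F s) + (y - s) *\<^sub>R t D) = t (F y - (F s + (y - s) *\<^sub>R D))"
        using F(2)[OF y] F(2)[OF F(3)] F(4) by (simp add: tdiff tadd tscale alg_in)
      moreover have "\<bar>t (F y - (F s + (y - s) *\<^sub>R D))\<bar> \<le> norm (F y - (F s + (y - s) *\<^sub>R D))"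
        using F(2)[OF y] F(2)[OF F(3)] F(4) by (intro t_norm) (simp add: alg_in)
      ultimately show "norm ((1 / norm (y - s)) *\<^sub>R (t (F y) - (t (F s) + (y - s) *\<^sub>R t D)))
        \<le> norm ((1 / norm (y - s)) *\<^sub>R (F y - (F s + (y - s) *\<^sub>R D)))"
        by (simp add: mult_left_mono divide_right_mono)
    qed
  qed
  then show ?thesis
    by (simp add: has_vector_derivative_def has_derivative_within bounded_linear_mult_left)
qed

text \<open>When \<open>X s\<close> and \<open>X'\<close> do not commute, the derivative of
  \<open>p(X)\<close> is not \<open>p'(X) X'\<close>, but the two agree under the trace. The
  induction over \<open>p\<close> multiplies by a further \<open>X s\<close>, so the claim is
  strengthened by a weight \<open>y\<close> commuting with \<open>X s\<close>.\<close>

lemma rpev_has_derivative: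
  assumes X: "(X has_vector_derivative X') (at s within S)" "X s \<in> R" "X' \<in> R"
  shows "\<exists>D\<in>R. ((\<lambda>s. rpev p (X s)) has_vector_derivative D) (at s within S) \<and>
    (\<forall>y\<in>R. y * X s = X s * y \<longrightarrow> t (D * y) = t (rpev (pderiv p) (X s) * X' * y))"
proof (induct p)
  case 0
  show ?case by (intro bexI[of _ 0]) (auto simp: zero_in)
next
  case (pCons c p)
  then obtain D where D: "D \<in> R" "((\<lambda>s. rpev p (X s)) has_vector_derivative D) (at s within S)"
    "\<And>y. y \<in> R \<Longrightarrow> y * X s = X s * y \<Longrightarrow> t (D * y) = t (rpev (pderiv p) (X s) * X' * y)" by blast
  let ?P = "rpev p (X s)" and ?P' = "rpev (pderiv p) (X s)"
  have PR: "?P \<in> R" "?P' \<in> R" using X(2) by (simp_all add: rpev_in)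
  have d: "((\<lambda>s. c *\<^sub>R 1 + X s * rpev p (X s)) has_vector_derivative (0 + (X s * D + X' * ?P))) (at s within S)"
    by (intro has_vector_derivative_add has_vector_derivative_const has_vector_derivative_mult X(1) D(2))
  show ?case
  proof (intro bexI[of _ "X s * D + X' * ?P"] conjI ballI impI)
    show "((\<lambda>s. rpev (pCons c p) (X s)) has_vector_derivative (X s * D + X' * ?P)) (at s within S)"
      using d by (simp add: rpev_pCons)
    show "X s * D + X' * ?P \<in> R" using X D(1) PR by (simp add: alg_in)
    fix y assume y: "y \<in> R" "y * X s = X s * y"
    have yX: "y * X s \<in> R" "y * X s * X s = X s * (y * X s)" using y X(2) by (simp_all add: mult_in mult.assoc)
    have Py: "?P * y = y * ?P" using y(2) by (intro rpev_commute) simp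
    have XP': "?P' * X s = X s * ?P'" by (rule rpev_commute) simp
    have 1: "t (X s * D * y) = t (X s * ?P' * X' * y)"
    proof -
      have "t (X s * (D * y)) = t (D * y * X s)" using X(2) D(1) y(1) by (intro tcomm mult_in)
      also have "\<dots> = t (?P' * X' * (y * X s))" using D(3)[OF yX] by (simp add: mult.assoc)
      also have "\<dots> = t (X s * (?P' * X' * y))"
        using tcomm[of "?P' * X' * y" "X s"] X PR y(1) by (simp add: mult_in mult.assoc)
      finally show ?thesis by (simp add: mult.assoc)
    qed
    have 2: "t (X' * ?P * y) = t (?P * X' * y)"
    proof -
      have "t (X' * ?P * y) = t ((X' * y) * ?P)" by (simp add: mult.assoc Py)
      also have "\<dots> = t (?P * (X' * y))" using X PR y(1) by (intro tcomm mult_in)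
      finally show ?thesis by (simp add: mult.assoc)
    qed
    have "t ((X s * D + X' * ?P) * y) = t (X s * D * y) + t (X' * ?P * y)"
      using X D(1) PR y(1) by (simp add: distrib_right tadd mult_in)
    also have "\<dots> = t (?P * X' * y) + t (X s * ?P' * X' * y)" using 1 2 by simp
    also have "\<dots> = t (?P * X' * y + X s * ?P' * X' * y)" using X PR y(1) by (intro tadd[symmetric] mult_in)
    also have "?P * X' * y + X s * ?P' * X' * y = rpev (pderiv (pCons c p)) (X s) * X' * y"
      by (simp add: pderiv_pCons rpev_add rpev_pCons distrib_right)
    finally show "t ((X s * D + X' * ?P) * y) = t (rpev (pderiv (pCons c p)) (X s) * X' * y)" .
  qed
qed

lemma t_rpev_derivative:
  assumes X: "(X has_vector_derivative X') (at s within S)" "\<And>s. s \<in> S \<Longrightarrow> X s \<in> R" "s \<in> S" "X' \<in> R"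
  shows "((\<lambda>s. t (rpev p (X s))) has_vector_derivative t (rpev (pderiv p) (X s) * X')) (at s within S)"
proof -
  obtain D where D: "D \<in> R" "((\<lambda>s. rpev p (X s)) has_vector_derivative D) (at s within S)"
    "\<And>y. y \<in> R \<Longrightarrow> y * X s = X s * y \<Longrightarrow> t (D * y) = t (rpev (pderiv p) (X s) * X' * y)"
    using rpev_has_derivative[OF X(1) X(2)[OF X(3)] X(4), of p] by blast
  have "t D = t (rpev (pderiv p) (X s) * X')" using D(3)[OF one_in] by simp
  then show ?thesis using t_has_derivative[OF D(2) _ X(3) D(1)] X(2) by (simp add: rpev_in)
qed

lemma pderiv_sum: "pderiv (sum f A) = (\<Sum>i\<in>A. pderiv (f i))"
  by (induct A rule: infinite_finite_induct) (simp_all add: pderiv_add)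

lemma antiderivative_poly: "\<exists>p :: real poly. pderiv p = q"
proof -
  have "pderiv (\<Sum>i\<le>degree q. monom (coeff q i / real (Suc i)) (Suc i)) = (\<Sum>i\<le>degree q. monom (coeff q i) i)"
    by (simp add: pderiv_sum pderiv_monom del: of_nat_Suc)
  also have "\<dots> = q" by (rule poly_as_sum_of_monoms)
  finally show ?thesis by blast
qed

text \<open>The derivative 1/x is approximated first and then integrated, so that logarithm and
  derivative are approximated at once. The constant of integration makes the value at
  \<open>m\<close> exact.\<close>

lemma ln_poly_approx:
  assumes m: "0 < m" "m \<le> (M::real)"
  shows "\<exists>p. uniform_limit {m..M} (\<lambda>n. poly (p n)) ln sequentially \<and>
     uniform_limit {m..M} (\<lambda>n. poly (pderiv (p n))) (\<lambda>x. 1 / x) sequentially"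
proof -
  obtain q where q: "uniform_limit {m..M} (\<lambda>n. poly (q n)) (\<lambda>x. 1 / x) sequentially"
    using poly_approx[OF continuous_on_inverse_pos[OF m(1)]] by blast
  have "\<forall>n. \<exists>p. pderiv p = q n" using antiderivative_poly by blast
  then obtain P where P: "\<And>n. pderiv (P n) = q n" by metis
  define p where "p n = P n + [:ln m - poly (P n) m:]" for n
  have p: "pderiv (p n) = q n" "poly (p n) m = ln m" for n by (simp_all add: p_def pderiv_add pderiv_pCons P)
  have "uniform_limit {m..M} (\<lambda>n. poly (p n)) ln sequentially"
  proof (rule uniform_limitI)
    fix e :: real assume e: "0 < e"
    \<comment> \<open>The mean value estimate multiplies the error by at most \<open>M - m\<close>;
      the added 1 keeps the denominator positive when \<open>m = M\<close>.\<close>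
    define e' where "e' = e / (2 * (M - m + 1))"
    have e': "0 < e'" using e m by (simp add: e'_def)
    show "\<forall>\<^sub>F n in sequentially. \<forall>x\<in>{m..M}. dist (poly (p n) x) (ln x) < e"
      using uniform_limitD[OF q e']
    proof (rule eventually_mono)
      fix n assume n: "\<forall>x\<in>{m..M}. dist (poly (q n) x) (1 / x) < e'"
      show "\<forall>x\<in>{m..M}. dist (poly (p n) x) (ln x) < e"
      proof
        fix x assume x: "x \<in> {m..M}"
        have "norm ((poly (p n) x - ln x) - (poly (p n) m - ln m)) \<le> e' * norm (x - m)"
        proof (rule field_differentiable_bound[where S = "{m..M}" and f' = "\<lambda>x. poly (q n) x - 1 / x"])
          fix z assume z: "z \<in> {m..M}"
          then have "0 < z" using m by auto
          then show "((\<lambda>x. poly (p n) x - ln x) has_field_derivative poly (q n) z - 1 / z) (at z within {m..M})"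
            unfolding p(1)[of n, symmetric]
            by (intro DERIV_diff DERIV_subset[OF poly_DERIV] DERIV_subset[OF DERIV_ln_divide]) auto
          show "norm (poly (q n) z - 1 / z) \<le> e'" using n z by (auto simp: dist_real_def less_imp_le)
        qed (use x m in auto)
        also have "\<dots> \<le> e' * (M - m + 1)" using x e' by (intro mult_left_mono) auto
        also have "\<dots> = e / 2"
        proof -
          have gen: "e / (2 * k) * k = e / 2" if "k \<noteq> 0" for k :: real using that by simp
          show ?thesis unfolding e'_def by (rule gen) (use m in simp)
        qed
        finally show "dist (poly (p n) x) (ln x) < e" using e by (simp add: p dist_real_def)
      qed
    qed
  qed
  then show ?thesis using q p(1) by (intro exI[of _ p]) simp
qed

definition L :: "'h cop \<Rightarrow> real" where
  "L a = t (fc ln a)"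

lemma fc_ln_in: "a \<in> gl \<Longrightarrow> fc ln a \<in> R"
proof -
  assume a: "a \<in> gl"
  then obtain m M where m: "0 < m" "m \<le> 1" "1 \<le> M" "between a m M" using gl_between by blast
  show ?thesis by (rule fc_in[OF gl_in[OF a] m(4) continuous_on_ln_pos[OF m(1)]])
qed

text \<open>The functions \<open>t (rpev (p n) (X s))\<close> converge to \<open>L (X s)\<close> and
  their derivatives converge uniformly, so limit and derivative may be interchanged. The bounds
  \<open>m\<close>, \<open>M\<close> and \<open>B\<close> are independent of \<open>s\<close> to
  secure this uniformity.\<close>

lemma L_derivative:
  assumes X: "\<And>s. s \<in> {0..1} \<Longrightarrow> (X has_vector_derivative X' s) (at s within {0..1})"
      "\<And>s. s \<in> {0..1} \<Longrightarrow> X s \<in> R" "\<And>s. s \<in> {0..1} \<Longrightarrow> X' s \<in> R"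
    and b: "0 < m" "m \<le> M" "\<And>s. s \<in> {0..1} \<Longrightarrow> between (X s) m M"
    and B: "\<And>s. s \<in> {0..1} \<Longrightarrow> norm (X' s) \<le> B"
    and s: "s \<in> {0..1::real}"
  shows "((\<lambda>s. L (X s)) has_vector_derivative t (cinv (X s) * X' s)) (at s within {0..1})"
proof -
  obtain p where p: "uniform_limit {m..M} (\<lambda>n. poly (p n)) ln sequentially"
    "uniform_limit {m..M} (\<lambda>n. poly (pderiv (p n))) (\<lambda>x. 1 / x) sequentially"
    using ln_poly_approx[OF b(1,2)] by blast
  note ci = continuous_on_inverse_pos[OF b(1), of M]
  have B0: "0 \<le> B" by (rule order_trans[OF norm_ge_zero B[OF s]])
  define f where "f n s = t (rpev (p n) (X s))" for n s
  have lim: "(\<lambda>n. f n s) \<longlonglongrightarrow> L (X s)" if s: "s \<in> {0..1}" for s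
  proof (rule LIM_zero_cancel, rule Lim_null_comparison)
    have l: "(\<lambda>n. rpev (p n) (X s)) \<longlonglongrightarrow> fc ln (X s)" by (rule fc_lim[OF b(3)[OF s] p(1)])
    show "(\<lambda>n. norm (rpev (p n) (X s) - fc ln (X s))) \<longlonglongrightarrow> 0"
      using l by (intro tendsto_norm_zero LIM_zero)
    have lR: "fc ln (X s) \<in> R" by (rule fc_in[OF X(2)[OF s] b(3)[OF s] continuous_on_ln_pos[OF b(1)]])
    show "\<forall>\<^sub>F n in sequentially. norm (f n s - L (X s)) \<le> norm (rpev (p n) (X s) - fc ln (X s))"
    proof (rule always_eventually, rule allI)
      fix n
      have "f n s - L (X s) = t (rpev (p n) (X s) - fc ln (X s))"
        using lR X(2)[OF s] by (simp add: f_def L_def tdiff rpev_in)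
      then show "norm (f n s - L (X s)) \<le> norm (rpev (p n) (X s) - fc ln (X s))"
        using t_norm[of "rpev (p n) (X s) - fc ln (X s)"] lR X(2)[OF s] by (simp add: rpev_in diff_in)
    qed
  qed
  have cR: "cinv (X s) \<in> R" if s: "s \<in> {0..1}" for s
    using b(3)[OF s] by (intro cinv_in[OF X(2)[OF s] b(1)]) (simp add: between_def)
  have "\<exists>g. \<forall>x\<in>{0..1}. (\<lambda>n. f n x) \<longlonglongrightarrow> g x \<and>
      (g has_derivative (\<lambda>h. h *\<^sub>R t (cinv (X x) * X' x))) (at x within {0..1})"
  proof (rule has_derivative_sequence)
    show "convex {0..1::real}" by simp
    show "(f n has_derivative (\<lambda>h. h *\<^sub>R t (rpev (pderiv (p n)) (X x) * X' x))) (at x within {0..1})"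
      if x: "x \<in> {0..1}" for n x
      using t_rpev_derivative[OF X(1)[OF x] X(2) x X(3)[OF x], of "p n"]
      unfolding has_vector_derivative_def f_def by simp
    show "\<forall>\<^sub>F n in sequentially. \<forall>x\<in>{0..1}. \<forall>h. norm (h *\<^sub>R t (rpev (pderiv (p n)) (X x) * X' x)
        - h *\<^sub>R t (cinv (X x) * X' x)) \<le> e * norm h" if e: "0 < e" for e
    proof -
      define e' where "e' = e / (B + 1)"
      have e': "0 < e'" using e B0 by (simp add: e'_def)
      show ?thesis
        using uniform_limitD[OF p(2) e']
      proof (rule eventually_mono, intro ballI allI)
        fix n x h assume n: "\<forall>z\<in>{m..M}. dist (poly (pderiv (p n)) z) (1 / z) < e'" and x: "x \<in> {0..1::real}"
        let ?q = "pderiv (p n)"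
        note bx = b(3)[OF x]
        have cq: "continuous_on S (poly ?q)" for S by (intro continuous_intros)
        have "rpev ?q (X x) - cinv (X x) = fc (\<lambda>z. poly ?q z - 1 / z) (X x)"
          by (simp only: fc_diff[OF bx cq ci] cinv_fc[OF b(1) bx] fc_poly[OF between_sa[OF bx]])
        also have "norm \<dots> \<le> e'"
          using n e' by (intro fc_norm_le[OF bx] continuous_on_diff cq ci) (auto simp: dist_real_def less_imp_le)
        finally have nq: "norm (rpev ?q (X x) - cinv (X x)) \<le> e'" .
        have "t (rpev ?q (X x) * X' x) - t (cinv (X x) * X' x) = t ((rpev ?q (X x) - cinv (X x)) * X' x)"
          using X(2,3)[OF x] cR[OF x] by (simp add: left_diff_distrib tdiff mult_in rpev_in)
        also have "\<bar>\<dots>\<bar> \<le> norm ((rpev ?q (X x) - cinv (X x)) * X' x)"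
          using X(2,3)[OF x] cR[OF x] by (intro t_norm mult_in diff_in rpev_in)
        also have "\<dots> \<le> norm (rpev ?q (X x) - cinv (X x)) * norm (X' x)" by (rule norm_mult_ineq)
        also have "\<dots> \<le> e' * B" using nq B[OF x] e' by (intro mult_mono) auto
        also have "\<dots> \<le> e" using e B0 by (simp add: e'_def field_simps)
        finally have "\<bar>t (rpev ?q (X x) * X' x) - t (cinv (X x) * X' x)\<bar> \<le> e" .
        then have "\<bar>h\<bar> * \<bar>t (rpev ?q (X x) * X' x) - t (cinv (X x) * X' x)\<bar> \<le> \<bar>h\<bar> * e" by (intro mult_left_mono) auto
        then show "norm (h *\<^sub>R t (rpev ?q (X x) * X' x) - h *\<^sub>R t (cinv (X x) * X' x)) \<le> e * norm h"
          by (simp add: abs_mult[symmetric] right_diff_distrib mult.commute)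
      qed
    qed
    show "s \<in> {0..1}" by (rule s)
    show "(\<lambda>n. f n s) \<longlonglongrightarrow> L (X s)" by (rule lim[OF s])
  qed
  then obtain g where g: "\<And>x. x \<in> {0..1} \<Longrightarrow> (\<lambda>n. f n x) \<longlonglongrightarrow> g x"
    "\<And>x. x \<in> {0..1} \<Longrightarrow> (g has_derivative (\<lambda>h. h *\<^sub>R t (cinv (X x) * X' x))) (at x within {0..1})" by blast
  have "L (X x) = g x" if "x \<in> {0..1}" for x using lim[OF that] g(1)[OF that] by (rule LIMSEQ_unique)
  then show ?thesis
    unfolding has_vector_derivative_def by (intro has_derivative_transform[OF s _ g(2)[OF s]])
qed

section \<open>Scaling, conjugation, inversion and strict concavity\<close>

lemma L_one: "L 1 = 0"
proof -
  have b: "between (1::'h cop) 1 1" by (simp add: between_def)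
  have "fc ln (1::'h cop) = fc (\<lambda>x. 0) 1" by (rule fc_cong[OF b]) simp
  then show ?thesis using tscale[OF one_in, of 0] by (simp add: L_def fc_const[OF b])
qed

lemma L_scaleR: "0 < r \<Longrightarrow> a \<in> gl \<Longrightarrow> L (r *\<^sub>R a) = ln r + L a"
proof -
  assume r: "0 < r" and a: "a \<in> gl"
  obtain m M where m: "0 < m" "m \<le> 1" "1 \<le> M" "between a m M" using gl_between[OF a] by blast
  note cl = continuous_on_ln_pos[OF m(1), of M]
  have "r *\<^sub>R a = fc (\<lambda>x. r * x) a" by (simp add: fc_scaleR[OF m(4) continuous_on_id] fc_id[OF m(4)])
  then have "fc ln (r *\<^sub>R a) = fc ln (fc (\<lambda>x. r * x) a)" by simp
  also have "\<dots> = fc (\<lambda>x. ln (r * x)) a"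
    by (rule fc_comp[OF m(4), where \<gamma> = "r * m" and \<delta> = "r * M"])
       (use r m in \<open>auto intro!: continuous_intros continuous_on_ln_pos\<close>)
  also have "\<dots> = fc (\<lambda>x. ln r + ln x) a"
    using r m(1) by (intro fc_cong[OF m(4)]) (simp add: ln_mult)
  also have "\<dots> = ln r *\<^sub>R 1 + fc ln a"
    by (simp only: fc_add[OF m(4) continuous_on_const cl] fc_const[OF m(4)])
  finally show ?thesis using fc_ln_in[OF a] by (simp add: L_def tadd tscale tone one_in scaleR_in)
qed

text \<open>Along the segment \<open>P s\<close> from 1 to \<open>T\<close>, the derivative of
  \<open>L (P s * C * P s)\<close> has two terms. Cancellation in one and cyclicity of the trace in
  the other reduce each to \<open>t (cinv (P s) * E)\<close>, the derivative of
  \<open>L (P s)\<close>. So \<open>F\<close> is constant, and at 0 it equals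
  \<open>L C\<close>.\<close>

lemma L_conj:
  assumes T: "T \<in> gl" and C: "C \<in> gl"
  shows "L (T * C * T) = 2 * L T + L C"
proof -
  define P where "P s = (1 - s) *\<^sub>R 1 + s *\<^sub>R T" for s :: real
  define Y where "Y s = P s * C * P s" for s
  define E where "E = T - 1"
  define Y' where "Y' s = P s * C * E + E * C * P s" for s
  have ER: "E \<in> R" and CR: "C \<in> R" and TR: "T \<in> R"
    using T C by (simp_all add: E_def gl_in diff_in one_in)
  have PR: "P s \<in> R" for s using TR by (simp add: P_def add_in scaleR_in one_in)
  have YR: "Y s \<in> R" "Y' s \<in> R" for s using PR CR ER by (simp_all add: Y_def Y'_def mult_in add_in)
  have dP: "(P has_vector_derivative E) (at s within S)" for s S
  proof -
    have "((\<lambda>s. (1 - s) *\<^sub>R 1 + s *\<^sub>R T) has_vector_derivative ((0 - 1) *\<^sub>R 1 + 1 *\<^sub>R T)) (at s within S)"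
      by (intro derivative_intros has_vector_derivative_scaleR[where g' = 0, simplified])
    then show ?thesis by (simp add: P_def[abs_def] E_def)
  qed
  have dY: "(Y has_vector_derivative Y' s) (at s within S)" for s S
  proof -
    have "((\<lambda>s. P s * C) has_vector_derivative (E * C)) (at s within S)"
      by (rule has_vector_derivative_mult_left[OF dP])
    from has_vector_derivative_mult[OF this dP] show ?thesis by (simp add: Y_def[abs_def] Y'_def)
  qed
  obtain m M where m: "0 < m" "m \<le> 1" "1 \<le> M" "between T m M" using gl_between[OF T] by blast
  obtain k K where k: "0 < k" "k \<le> 1" "1 \<le> K" "between C k K" using gl_between[OF C] by blast
  have PB: "between (P s) m M" if s: "s \<in> {0..1}" for s
  proof -
    have comb: "(1 - s) *\<^sub>R c *\<^sub>R 1 + s *\<^sub>R c *\<^sub>R 1 = c *\<^sub>R (1::'h cop)" for c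
      unfolding scaleR_scaleR scaleR_left_distrib[symmetric] by (simp add: left_diff_distrib)
    have m1: "m *\<^sub>R 1 \<le> (1::'h cop)" "1 \<le> M *\<^sub>R (1::'h cop)"
      using m scal_mono[of m 1] scal_mono[of 1 M] by simp_all
    have "(1 - s) *\<^sub>R m *\<^sub>R 1 + s *\<^sub>R m *\<^sub>R 1 \<le> P s"
      unfolding P_def using s m m1 by (intro add_mono scaleR_left_mono) (auto simp: between_def)
    moreover have "P s \<le> (1 - s) *\<^sub>R M *\<^sub>R 1 + s *\<^sub>R M *\<^sub>R 1"
      unfolding P_def using s m m1 by (intro add_mono scaleR_left_mono) (auto simp: between_def)
    ultimately show ?thesis by (simp only: between_def comb)
  qed
  have Pn: "norm (P s) \<le> M" if "s \<in> {0..1}" for s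
  proof -
    have "- (M *\<^sub>R 1) \<le> (0::'h cop)" using scal_mono[of 0 M] m by simp
    also have "\<dots> \<le> m *\<^sub>R 1" using scal_mono[of 0 m] m by simp
    also have "\<dots> \<le> P s" using PB[OF that] by (simp add: between_def)
    finally have "norm (P s) \<le> \<bar>M\<bar>" using PB[OF that] by (intro norm_le_of_le) (simp_all add: between_def)
    then show ?thesis using m by simp
  qed
  have Psa: "adj (P s) = P s" if "s \<in> {0..1}" for s using between_sa[OF PB[OF that]] .
  have n3: "norm (a * C * b) \<le> norm a * norm C * norm b" for a b :: "'h cop"
  proof -
    have "norm (a * C * b) \<le> norm (a * C) * norm b" by (rule norm_mult_ineq)
    also have "\<dots> \<le> norm a * norm C * norm b" by (intro mult_right_mono norm_mult_ineq norm_ge_zero)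
    finally show ?thesis .
  qed
  \<comment> \<open>The first entry bounds the norm along the path; the second only ensures that the
    interval from the lower bound to \<open>N\<close> is nonempty.\<close>
  define N where "N = max (M * norm C * M) (k * m\<^sup>2)"
  have YB: "between (Y s) (k * m\<^sup>2) N" if s: "s \<in> {0..1}" for s
  proof -
    have "(k * m\<^sup>2) *\<^sub>R 1 = k *\<^sub>R m\<^sup>2 *\<^sub>R (1::'h cop)" by simp
    also have "\<dots> \<le> k *\<^sub>R (P s * P s)" using k m by (intro scaleR_left_mono square_ge[OF _ PB[OF s]]) auto
    also have "\<dots> = adj (P s) * (k *\<^sub>R 1) * P s" by (simp add: Psa[OF s])
    also have "\<dots> \<le> adj (P s) * C * P s" using k(4) by (intro sandwich_mono) (simp add: between_def)
    finally have lo: "(k * m\<^sup>2) *\<^sub>R 1 \<le> Y s" by (simp add: Y_def Psa[OF s])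
    have "norm (Y s) \<le> norm (P s) * norm C * norm (P s)" unfolding Y_def by (rule n3)
    also have "\<dots> \<le> M * norm C * M" using Pn[OF s] m by (intro mult_mono) auto
    finally have "norm (Y s) \<le> N" by (simp add: N_def)
    then have "Y s \<le> N *\<^sub>R 1" by (intro sa_le_norm ge_scal_sa[OF lo])
    then show ?thesis using lo by (simp add: between_def)
  qed
  have Y'B: "norm (Y' s) \<le> 2 * (M * norm C * norm E)" if s: "s \<in> {0..1}" for s
  proof -
    have "norm (Y' s) \<le> norm (P s * C * E) + norm (E * C * P s)" unfolding Y'_def by (rule norm_triangle_ineq)
    also have "\<dots> \<le> norm (P s) * norm C * norm E + norm E * norm C * norm (P s)" by (intro add_mono n3)
    also have "\<dots> \<le> M * norm C * norm E + norm E * norm C * M"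
      using Pn[OF s] by (intro add_mono mult_right_mono mult_left_mono) auto
    finally show ?thesis by (simp add: mult_ac)
  qed
  define F where "F s = L (Y s) - 2 * L (P s)" for s
  have dF: "(F has_field_derivative 0) (at s within {0..1})" if s: "s \<in> {0..1}" for s
  proof -
    have km: "0 < k * m\<^sup>2" "k * m\<^sup>2 \<le> N" using k m by (simp_all add: N_def)
    have 1: "((\<lambda>s. L (Y s)) has_vector_derivative t (cinv (Y s) * Y' s)) (at s within {0..1})"
      by (rule L_derivative[OF dY YR km YB Y'B s])
    have 2: "((\<lambda>s. L (P s)) has_vector_derivative t (cinv (P s) * E)) (at s within {0..1})"
      using m by (intro L_derivative[OF dP PR ER m(1) _ PB order_refl s]) auto
    have uP: "unit (P s)" using PB[OF s] m(1) by (intro unit_positive[of m]) (simp_all add: between_def)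
    have uC: "unit C" by (rule gl_unit[OF C])
    let ?p = "cinv (P s)" and ?c = "cinv C"
    have pR: "?p \<in> R" using PB[OF s] by (intro cinv_in[OF PR m(1)]) (simp add: between_def)
    have cR: "?c \<in> R" by (rule gl_in[OF gl_cinv[OF C]])
    have iY: "cinv (Y s) = ?p * (?c * ?p)" unfolding Y_def by (simp add: cinv_mult unit_mult uP uC)
    have canc: "?p * (P s * x) = x" "?c * (C * x) = x" "C * (?c * x) = x" "P s * (?p * x) = x" for x
      using cinv_left[OF uP] cinv_left[OF uC] cinv_right[OF uC] cinv_right[OF uP]
      by (simp_all flip: mult.assoc)
    have "cinv (Y s) * (P s * C * E) = ?p * E" by (simp add: iY mult.assoc canc)
    moreover have "t (cinv (Y s) * (E * C * P s)) = t (?p * E)"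
    proof -
      have "t ((?p * (?c * (?p * E))) * (C * P s)) = t ((C * P s) * (?p * (?c * (?p * E))))"
        using pR cR ER CR PR by (intro tcomm mult_in)
      also have "(C * P s) * (?p * (?c * (?p * E))) = ?p * E" by (simp add: mult.assoc canc)
      finally show ?thesis by (simp add: iY mult.assoc)
    qed
    moreover have "t (cinv (Y s) * Y' s) = t (cinv (Y s) * (P s * C * E)) + t (cinv (Y s) * (E * C * P s))"
      unfolding Y'_def distrib_left using pR cR ER CR PR by (intro tadd) (simp_all add: iY mult_in)
    ultimately have "t (cinv (Y s) * Y' s) = 2 * t (?p * E)" by simp
    then show ?thesis
      using has_vector_derivative_diff[OF 1 has_vector_derivative_mult_right[OF 2, of 2]]
      unfolding F_def[abs_def] has_real_derivative_iff_has_vector_derivative by simp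
  qed
  have "F 0 = F 1"
    by (rule has_field_derivative_zero_constant[of "{0..1}" F, THEN exE]) (use dF in auto)
  moreover have "P 0 = 1" "P 1 = T" by (simp_all add: P_def)
  ultimately show ?thesis by (simp add: F_def Y_def L_one)
qed

text \<open>For the square root \<open>s\<close> of the inverse, \<open>s * a * s = 1\<close> and
  \<open>s * 1 * s\<close> is the inverse; applying the conjugation formula to both gives the
  sign.\<close>

lemma L_cinv: "a \<in> gl \<Longrightarrow> L (cinv a) = - L a"
proof -
  assume a: "a \<in> gl"
  have c: "cinv a \<in> gl" by (rule gl_cinv[OF a])
  have s: "rt (cinv a) \<in> gl" by (rule rt_gl[OF c])
  have eq: "rt (cinv a) * a * rt (cinv a) = 1"
  proof -
    let ?s = "rt (cinv a)"
    have ss: "?s * ?s = cinv a" by (rule rt_sq[OF c])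
    have "?s * a * ?s * ?s = ?s" using ss cinv_right[OF gl_unit[OF a]] by (simp add: mult.assoc)
    then have "?s * a * ?s * (?s * cinv ?s) = ?s * cinv ?s" by (simp flip: mult.assoc)
    then show ?thesis using cinv_right[OF gl_unit[OF s]] by simp
  qed
  have "2 * L (rt (cinv a)) + L a = 0" using L_conj[OF s a] by (simp add: eq L_one)
  moreover have "L (cinv a) = 2 * L (rt (cinv a))" using L_conj[OF s one_gl] by (simp add: rt_sq[OF c] L_one)
  ultimately show ?thesis by simp
qed

text \<open>Strict concavity of the logarithm at \<open>x\<close> and 1 with weights
  \<open>r / (r + 1)\<close> and \<open>1 / (r + 1)\<close>, made quantitative by a quadratic term.
  The difference \<open>h\<close> of the two sides vanishes at 1, and its derivative is
  \<open>x - 1\<close> times a nonnegative factor.\<close>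

lemma concave_gap:
  fixes r x M :: real
  assumes r: "0 < r" and x: "0 < x" "x \<le> M" and M: "1 \<le> M"
  shows "(r / (r + 1) / (M * (r * M + 1))) / 2 * (x - 1)\<^sup>2 \<le> ln (r * x + 1) - ln (r + 1) - r / (r + 1) * ln x"
proof -
  \<comment> \<open>The value at \<open>x = M\<close> of
    \<open>r / (r + 1) / (x * (r * x + 1))\<close>, which decreases in \<open>x\<close>; it is the
    largest constant that keeps the second factor of \<open>h'\<close> nonnegative up to
    \<open>M\<close>.\<close>
  define \<kappa> where "\<kappa> = r / (r + 1) / (M * (r * M + 1))"
  define h where "h x = ln (r * x + 1) - ln (r + 1) - r / (r + 1) * ln x - \<kappa> / 2 * (x - 1)\<^sup>2" for x
  define h' where "h' x = (x - 1) * (r / (r + 1) / (x * (r * x + 1)) - \<kappa>)" for x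
  have d: "(h has_field_derivative h' x) (at x)" if x: "0 < x" for x
  proof -
    have p: "0 < r * x + 1" using r x by (simp add: add_pos_pos)
    have d1: "((\<lambda>x. ln (r * x + 1)) has_field_derivative r / (r * x + 1)) (at x)"
      using p by (auto intro!: derivative_eq_intros)
    have d2: "((\<lambda>x. \<kappa> / 2 * (x - 1)\<^sup>2) has_field_derivative \<kappa> * (x - 1)) (at x)"
      by (auto intro!: derivative_eq_intros)
    have "(h has_field_derivative (r / (r * x + 1) - 0 - r / (r + 1) * (1 / x) - \<kappa> * (x - 1))) (at x)"
      unfolding h_def[abs_def] using x
      by (intro DERIV_diff d1 d2 DERIV_const DERIV_cmult DERIV_ln_divide)
    moreover have "r / (r * x + 1) - r / (r + 1) * (1 / x) = (x - 1) * (r / (r + 1) / (x * (r * x + 1)))"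
      using p x r by (simp add: divide_simps) (simp add: algebra_simps)
    ultimately show ?thesis by (simp add: h'_def right_diff_distrib mult.commute)
  qed
  have pos: "0 \<le> r / (r + 1) / (x * (r * x + 1)) - \<kappa>" if "0 < x" "x \<le> M" for x
  proof -
    have "x * (r * x + 1) \<le> M * (r * M + 1)" using that r by (intro mult_mono add_mono mult_left_mono) auto
    moreover have "0 < x * (r * x + 1)" using that r by (simp add: add_pos_pos)
    ultimately show ?thesis unfolding \<kappa>_def using r by (simp add: divide_left_mono)
  qed
  have h1: "h 1 = 0" by (simp add: h_def)
  have "0 \<le> h x"
  proof (cases "1 \<le> x")
    case True
    have "h 1 \<le> h x"
    proof (rule DERIV_nonneg_imp_nondecreasing[OF True])
      fix z assume z: "1 \<le> z" "z \<le> x"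
      show "\<exists>y. DERIV h z :> y \<and> 0 \<le> y"
        using d[of z] pos[of z] z x by (intro exI[of _ "h' z"]) (auto simp: h'_def)
    qed
    then show ?thesis by (simp add: h1)
  next
    case False
    have "h x \<ge> h 1"
    proof (rule DERIV_nonpos_imp_nonincreasing[of x 1 h])
      show "x \<le> 1" using False by simp
      fix z assume z: "x \<le> z" "z \<le> 1"
      show "\<exists>y. DERIV h z :> y \<and> y \<le> 0"
        using d[of z] pos[of z] z x M by (intro exI[of _ "h' z"]) (auto simp: h'_def mult_nonpos_nonneg)
    qed
    then show ?thesis by (simp add: h1)
  qed
  then show ?thesis by (simp add: h_def \<kappa>_def)
qed

text \<open>Equality case of \<open>\<Delta>(A + B) \<ge> \<Delta>(A) + \<Delta>(B)\<close>: after conjugating \<open>B\<close> to the identity it is the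
  strict concavity of the logarithm.\<close>

lemma minkowski_equality:
  assumes A: "A \<in> gl" and B: "B \<in> gl" and r: "0 < r"
    and LA: "L A = ln r + L B" and LAB: "L (A + B) = ln (r + 1) + L B"
  shows "A = r *\<^sub>R B"
proof -
  have iB: "cinv B \<in> gl" by (rule gl_cinv[OF B])
  \<comment> \<open>The inverse square root of \<open>B\<close>: conjugation by \<open>S\<close>
    sends \<open>B\<close> to 1, and \<open>C\<close>, the image of \<open>A\<close> divided by
    \<open>r\<close>, is normalized to \<open>L C = 0\<close>.\<close>
  define S where "S = rt (cinv B)"
  have S: "S \<in> gl" "S * S = cinv B" unfolding S_def by (rule rt_gl[OF iB]) (rule rt_sq[OF iB])
  define C where "C = (1/r) *\<^sub>R (S * A * S)"
  have LS: "2 * L S = - L B" using L_conj[OF S(1) one_gl] L_cinv[OF B] by (simp add: S(2) L_one)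
  have Cgl: "C \<in> gl" unfolding C_def using r by (intro gl_scaleR gl_conj S(1) A) simp
  have LC: "L C = 0"
    using r L_scaleR[OF _ gl_conj[OF S(1) A], of "1/r"] L_conj[OF S(1) A] LS LA by (simp add: C_def ln_div)
  have uS: "unit S" by (rule gl_unit[OF S(1)])
  have SBS: "S * B * S = 1"
  proof -
    have "S * (B * (S * S)) = S" using S(2) cinv_right[OF gl_unit[OF B]] by simp
    then have "(S * B * S) * S = S" by (simp add: mult.assoc)
    then have "(S * B * S) * (S * cinv S) = S * cinv S" by (simp flip: mult.assoc)
    then show ?thesis by (simp add: cinv_right[OF uS])
  qed
  have C1: "r *\<^sub>R C + 1 = S * (A + B) * S"
    using r by (simp add: C_def distrib_left distrib_right SBS)
  have LC1: "L (r *\<^sub>R C + 1) = ln (r + 1)"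
    using L_conj[OF S(1) gl_add[OF A B]] LS LAB by (simp add: C1)
  obtain m M where m: "0 < m" "m \<le> 1" "1 \<le> M" "between C m M" using gl_between[OF Cgl] by blast
  define w where "w = r / (r + 1)"
  define \<kappa> where "\<kappa> = r / (r + 1) / (M * (r * M + 1)) / 2"
  have kp: "0 < \<kappa>" using r m by (simp add: \<kappa>_def add_pos_pos)
  define u where "u x = ln (r * x + 1)" for x
  have cl: "continuous_on {m..M} ln" by (rule continuous_on_ln_pos[OF m(1)])
  have pos: "0 < r * x + 1" if "m \<le> x" for x using r m(1) that by (simp add: add_pos_pos)
  have cu: "continuous_on {m..M} u" unfolding u_def using pos by (intro continuous_intros) force
  have cu': "continuous_on {m..M} (\<lambda>x. u x - ln (r + 1))" by (intro continuous_on_diff cu continuous_on_const)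
  have cwl: "continuous_on {m..M} (\<lambda>x. w * ln x)" by (intro continuous_on_mult cl continuous_on_const)
  \<comment> \<open>The concavity defect. At \<open>C\<close> its trace is
    \<open>L (r C + 1) - ln (r + 1) - w L C\<close>, which is 0, while the defect dominates \<kappa>
    times the square of \<open>C - 1\<close>; faithfulness then forces \<open>C = 1\<close>.\<close>
  define g where "g x = u x - ln (r + 1) - w * ln x" for x
  have cg: "continuous_on {m..M} g" unfolding g_def by (intro continuous_on_diff cu' cwl)
  have fu: "fc u C = fc ln (r *\<^sub>R C + 1)"
  proof -
    have "r *\<^sub>R C + 1 = fc (\<lambda>x. r * x + 1) C"
      by (simp add: fc_add[OF m(4) continuous_on_mult[OF continuous_on_const continuous_on_id] continuous_on_const]
          fc_scaleR[OF m(4) continuous_on_id] fc_id[OF m(4)] fc_const[OF m(4)])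
    then have "fc ln (r *\<^sub>R C + 1) = fc ln (fc (\<lambda>x. r * x + 1) C)" by simp
    also have "\<dots> = fc (\<lambda>x. ln (r * x + 1)) C"
      by (rule fc_comp[OF m(4), where \<gamma> = "r * m + 1" and \<delta> = "r * M + 1"])
         (use r m pos[of m] in \<open>auto intro!: continuous_intros\<close>)
    finally show ?thesis by (simp add: u_def[abs_def])
  qed
  have gR: "fc g C \<in> R" by (rule fc_in[OF gl_in[OF Cgl] m(4) cg])
  have lR: "fc ln C \<in> R" by (rule fc_ln_in[OF Cgl])
  have uR: "fc u C \<in> R" by (rule fc_in[OF gl_in[OF Cgl] m(4) cu])
  have "fc g C = fc u C - ln (r + 1) *\<^sub>R 1 - w *\<^sub>R fc ln C"
    unfolding g_def[abs_def]
    by (simp only: fc_diff[OF m(4) cu' cwl] fc_diff[OF m(4) cu continuous_on_const] fc_const[OF m(4)] fc_scaleR[OF m(4) cl])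
  then have tg: "t (fc g C) = 0"
    using uR lR LC LC1 by (simp add: tdiff tscale tone one_in scaleR_in diff_in L_def fu)
  have csq: "continuous_on S (\<lambda>x::real. (x - 1)\<^sup>2)" for S by (intro continuous_intros)
  have gap: "fc (\<lambda>x. \<kappa> * (x - 1)\<^sup>2) C \<le> fc g C"
  proof (rule fc_mono[OF m(4) continuous_on_mult[OF continuous_on_const csq] cg])
    fix x assume "m \<le> x" "x \<le> M"
    then show "\<kappa> * (x - 1)\<^sup>2 \<le> g x"
      using concave_gap[OF r _ _ m(3), of x] m(1) by (simp add: \<kappa>_def g_def u_def w_def)
  qed
  have cd: "continuous_on S (\<lambda>x::real. x - 1)" for S by (intro continuous_intros)
  have sq: "fc (\<lambda>x. \<kappa> * (x - 1)\<^sup>2) C = \<kappa> *\<^sub>R ((C - 1) * (C - 1))"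
  proof -
    have "fc (\<lambda>x. \<kappa> * (x - 1)\<^sup>2) C = \<kappa> *\<^sub>R fc (\<lambda>x. (x - 1)\<^sup>2) C" by (rule fc_scaleR[OF m(4) csq])
    also have "fc (\<lambda>x. (x - 1)\<^sup>2) C = fc (\<lambda>x. (x - 1) * (x - 1)) C" by (simp only: power2_eq_square)
    also have "\<dots> = fc (\<lambda>x. x - 1) C * fc (\<lambda>x. x - 1) C" by (rule fc_mult[OF m(4) cd cd])
    also have "fc (\<lambda>x. x - 1) C = C - 1"
      by (simp add: fc_diff[OF m(4) continuous_on_id continuous_on_const] fc_id[OF m(4)] fc_const[OF m(4)])
    finally show ?thesis .
  qed
  have adC: "adj (C - 1) = C - 1" using gl_sa[OF Cgl] by simp
  have sq0: "0 \<le> (C - 1) * (C - 1)" using adj_mult_nonneg[of "C - 1"] by (simp only: adC)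
  then have "0 \<le> \<kappa> *\<^sub>R ((C - 1) * (C - 1))" using kp by (intro scaleR_nonneg_nonneg) auto
  then have "0 \<le> fc g C" using gap unfolding sq by (rule order_trans)
  then have "fc g C = 0" by (rule faithful[OF gR _ tg])
  then have "\<kappa> *\<^sub>R ((C - 1) * (C - 1)) \<le> 0" using gap unfolding sq by simp
  then have "\<kappa> *\<^sub>R ((C - 1) * (C - 1)) = 0"
    using \<open>0 \<le> \<kappa> *\<^sub>R ((C - 1) * (C - 1))\<close> by (rule antisym)
  then have "adj (C - 1) * (C - 1) = 0" using kp adC by simp
  then have "C - 1 = 0" by (rule adj_mult_eq_0)
  then have "r *\<^sub>R C = r *\<^sub>R 1" by simp
  then have SAS: "S * A * S = r *\<^sub>R 1" using r by (simp add: C_def)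
  have "cinv S * (S * A * S) * cinv S = A"
  proof -
    have "cinv S * (S * A * S) * cinv S = (cinv S * S) * A * (S * cinv S)" by (simp only: mult.assoc)
    then show ?thesis by (simp add: cinv_left[OF uS] cinv_right[OF uS])
  qed
  moreover have "cinv S * (S * B * S) * cinv S = B"
  proof -
    have "cinv S * (S * B * S) * cinv S = (cinv S * S) * B * (S * cinv S)" by (simp only: mult.assoc)
    then show ?thesis by (simp add: cinv_left[OF uS] cinv_right[OF uS])
  qed
  ultimately show ?thesis unfolding SAS SBS by simp
qed

text \<open>One-sided, because for \<open>s \<ge> 0\<close> every point of the line keeps the lower
  bound of \<open>A\<close>.\<close>

lemma L_line_derivative:
  assumes A: "A \<in> gl" and B: "B \<in> gl"
  shows "((\<lambda>s. L (A + s *\<^sub>R B)) has_vector_derivative t (cinv A * B)) (at 0 within {0..1})"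
proof -
  obtain m M where m: "0 < m" "m \<le> 1" "1 \<le> M" "between A m M" using gl_between[OF A] by blast
  obtain k K where k: "0 < k" "k \<le> 1" "1 \<le> K" "between B k K" using gl_between[OF B] by blast
  have d: "((\<lambda>s. A + s *\<^sub>R B) has_vector_derivative B) (at s within {0..1})" for s
    by (auto intro!: derivative_eq_intros has_vector_derivative_scaleR[where g' = 0, simplified])
  have b: "between (A + s *\<^sub>R B) m (M + K)" if s: "s \<in> {0..1}" for s
  proof -
    have "m *\<^sub>R 1 + 0 \<le> A + s *\<^sub>R B"
      using s m gl_nonneg[OF B] by (intro add_mono scaleR_nonneg_nonneg) (auto simp: between_def)
    moreover have "A + s *\<^sub>R B \<le> M *\<^sub>R 1 + 1 *\<^sub>R K *\<^sub>R 1"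
    proof (intro add_mono)
      show "A \<le> M *\<^sub>R 1" using m by (simp add: between_def)
      have "s *\<^sub>R B \<le> 1 *\<^sub>R B" using s gl_nonneg[OF B] by (intro scaleR_right_mono) auto
      also have "\<dots> \<le> 1 *\<^sub>R K *\<^sub>R 1" using k by (intro scaleR_left_mono) (auto simp: between_def)
      finally show "s *\<^sub>R B \<le> 1 *\<^sub>R K *\<^sub>R 1" .
    qed
    ultimately show ?thesis by (simp add: between_def scaleR_left_distrib)
  qed
  have "((\<lambda>s. L (A + s *\<^sub>R B)) has_vector_derivative t (cinv (A + 0 *\<^sub>R B) * B)) (at 0 within {0..1})"
    by (rule L_derivative[where m = m and M = "M + K" and B = "norm B", OF d _ _ m(1) _ b])
       (use A B m k in \<open>simp_all add: add_in scaleR_in gl_in\<close>)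
  then show ?thesis by simp
qed

end

section \<open>Jordan maps of factors\<close>

definition star_bij :: "'h::chilbert_space cop set \<Rightarrow> ('h cop \<Rightarrow> 'h cop) \<Rightarrow> bool" where
  "star_bij R \<theta> \<longleftrightarrow> bij_betw \<theta> R R \<and> (\<forall>a\<in>R. \<forall>b\<in>R. \<theta> (a + b) = \<theta> a + \<theta> b) \<and>
     (\<forall>c. \<forall>a\<in>R. \<theta> (cscale c a) = cscale c (\<theta> a)) \<and> (\<forall>a\<in>R. \<theta> (adj a) = adj (\<theta> a))"

text \<open>A group is not the union of two proper subgroups; only the closure properties used are assumed.\<close>

lemma additive_group_cover:
  fixes P Q :: "'a::ab_group_add \<Rightarrow> bool"
  assumes closed: "\<And>x y. x \<in> S \<Longrightarrow> y \<in> S \<Longrightarrow> x + y \<in> S"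
    and P: "\<And>x y. x \<in> S \<Longrightarrow> y \<in> S \<Longrightarrow> P (x + y) \<Longrightarrow> P x \<Longrightarrow> P y"
    and Q: "\<And>x y. x \<in> S \<Longrightarrow> y \<in> S \<Longrightarrow> Q (x + y) \<Longrightarrow> Q y \<Longrightarrow> Q x"
    and cover: "\<And>x. x \<in> S \<Longrightarrow> P x \<or> Q x"
  shows "(\<forall>x\<in>S. P x) \<or> (\<forall>x\<in>S. Q x)"
proof (rule ccontr)
  assume "\<not> ?thesis"
  then obtain x y where xy: "x \<in> S" "\<not> Q x" "y \<in> S" "\<not> P y" by blast
  then have "P x" "Q y" using cover by blast+
  then show False using closed[OF xy(1,3)] cover P[OF xy(1,3)] Q[OF xy(1,3)] xy by blast
qed

context factor_alg
begin

text \<open>The hypothesis lets \<open>u\<close> and \<open>v\<close> trade places at the cost of a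
  sign. Doing this in two ways inside \<open>(u * x * v) * y * (u * x * v)\<close> gives the same
  word with opposite signs, so it is 0. Primeness then yields \<open>u * x * v = 0\<close>, and a
  second time the claim.\<close>

lemma prime_sym:
  assumes u: "u \<in> R" and v: "v \<in> R" and uv: "\<And>x. x \<in> R \<Longrightarrow> u * x * v + v * x * u = 0"
  shows "u = 0 \<or> v = 0"
proof -
  have sw: "u * x * v = - (v * x * u)" if "x \<in> R" for x
    using uv[OF that] by (simp add: add_eq_0_iff2)
  have "u * x * v = 0" if x: "x \<in> R" for x
  proof -
    have z: "(u * x * v) * y * (u * x * v) = 0" if y: "y \<in> R" for y
    proof -
      have 1: "(u * x * v) * y * (u * x * v) = - (u * x * (u * y * v) * x * v)"
      proof -
        have "(u * x * v) * y * (u * x * v) = u * x * (v * y * u) * x * v" by (simp only: mult.assoc)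
        also have "v * y * u = - (u * y * v)" using sw[OF y] by simp
        finally show ?thesis by simp
      qed
      have 2: "(u * x * v) * y * (u * x * v) = u * x * (u * y * v) * x * v"
      proof -
        have xuy: "x * u * y \<in> R" using x u y by (simp add: mult_in)
        have "(u * x * v) * y * (u * x * v) = (- (v * x * u)) * y * (u * x * v)" by (simp only: sw[OF x])
        also have "\<dots> = - ((v * (x * u * y) * u) * x * v)" by (simp add: mult.assoc)
        also have "v * (x * u * y) * u = - (u * (x * u * y) * v)" using sw[OF xuy] by simp
        finally show ?thesis by (simp add: mult.assoc)
      qed
      have "(u * x * v) * y * (u * x * v) = - ((u * x * v) * y * (u * x * v))" by (rule 1[folded 2])
      then have "(u * x * v) * y * (u * x * v) + (u * x * v) * y * (u * x * v) = 0"
        by (rule eq_neg_iff_add_eq_0[THEN iffD1])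
      then have "2 *\<^sub>R ((u * x * v) * y * (u * x * v)) = 0" by (simp add: scaleR_2)
      then show ?thesis by simp
    qed
    have "u * x * v \<in> R" using u v x by (simp add: mult_in)
    from prime[OF this z] show ?thesis by simp
  qed
  then show ?thesis using prime[OF u] by blast
qed

text \<open>Let \<open>w\<close> be the image of \<open>a * b\<close>, and \<open>p\<close>,
  \<open>q\<close> the two products of the images. The Jordan triple products show that
  \<open>w - p\<close> and \<open>w - q\<close> satisfy the hypothesis of \<open>prime_sym\<close>,
  so \<open>w\<close> is one of \<open>p\<close> and \<open>q\<close>. The choice is made uniform by
  the covering argument, first in \<open>b\<close> and then in \<open>a\<close>.\<close>

lemma jordan_factor:
  assumes img: "\<theta> ` R = R"
    and add: "\<And>a b. a \<in> R \<Longrightarrow> b \<in> R \<Longrightarrow> \<theta> (a + b) = \<theta> a + \<theta> b"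
    and sc: "\<And>r a. a \<in> R \<Longrightarrow> \<theta> (r *\<^sub>R a) = r *\<^sub>R \<theta> a"
    and jordan: "\<And>a b. a \<in> R \<Longrightarrow> b \<in> R \<Longrightarrow> \<theta> (a * b + b * a) = \<theta> a * \<theta> b + \<theta> b * \<theta> a"
  shows "(\<forall>a\<in>R. \<forall>b\<in>R. \<theta> (a * b) = \<theta> a * \<theta> b) \<or> (\<forall>a\<in>R. \<forall>b\<in>R. \<theta> (a * b) = \<theta> b * \<theta> a)"
proof -
  have diff: "\<theta> (a - b) = \<theta> a - \<theta> b" if "a \<in> R" "b \<in> R" for a b
    using add[of a "(-1) *\<^sub>R b"] sc[of b "-1"] that by (simp add: uminus_in)
  have sq: "\<theta> (a * a) = \<theta> a * \<theta> a" if a: "a \<in> R" for a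
  proof -
    have "\<theta> (2 *\<^sub>R (a * a)) = 2 *\<^sub>R (\<theta> a * \<theta> a)" using jordan[OF a a] by (simp add: scaleR_2)
    then show ?thesis using sc[of "a * a" 2] a by (simp add: mult_in)
  qed
  have triple: "\<theta> (a * b * a) = \<theta> a * \<theta> b * \<theta> a" if a: "a \<in> R" and b: "b \<in> R" for a b
  proof -
    define s where "s = a * b + b * a"
    have s: "s \<in> R" and aa: "a * a \<in> R" and ab: "a * a * b + b * (a * a) \<in> R" and aba: "a * b * a \<in> R"
      using a b by (simp_all add: s_def mult_in add_in)
    \<comment> \<open>Writes the triple product through Jordan products alone, so that \<theta> can
      be applied term by term.\<close>
    have "2 *\<^sub>R (a * b * a) = (s * a + a * s) - (a * a * b + b * (a * a))"
      by (simp add: s_def distrib_left distrib_right scaleR_2 mult.assoc)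
    then have "\<theta> (2 *\<^sub>R (a * b * a)) = \<theta> (s * a + a * s) - \<theta> (a * a * b + b * (a * a))"
      using s a ab by (simp only: diff add_in mult_in)
    also have "\<dots> = (\<theta> s * \<theta> a + \<theta> a * \<theta> s) - (\<theta> a * \<theta> a * \<theta> b + \<theta> b * (\<theta> a * \<theta> a))"
      by (simp only: jordan[OF s a] jordan[OF aa b] sq[OF a])
    also have "\<theta> s = \<theta> a * \<theta> b + \<theta> b * \<theta> a" unfolding s_def by (rule jordan[OF a b])
    also have "((\<theta> a * \<theta> b + \<theta> b * \<theta> a) * \<theta> a + \<theta> a * (\<theta> a * \<theta> b + \<theta> b * \<theta> a)) - (\<theta> a * \<theta> a * \<theta> b + \<theta> b * (\<theta> a * \<theta> a))
      = 2 *\<^sub>R (\<theta> a * \<theta> b * \<theta> a)"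
      by (simp add: distrib_left distrib_right scaleR_2 mult.assoc)
    finally show ?thesis by (simp add: sc[OF aba])
  qed
  have triple2: "\<theta> (a * b * c + c * b * a) = \<theta> a * \<theta> b * \<theta> c + \<theta> c * \<theta> b * \<theta> a"
    if a: "a \<in> R" and b: "b \<in> R" and c: "c \<in> R" for a b c
  proof -
    have ac: "a + c \<in> R" using a c by (rule add_in)
    have e: "a * b * c + c * b * a = ((a + c) * b * (a + c) - a * b * a) - c * b * c"
      by (simp add: distrib_left distrib_right)
    have "\<theta> (a * b * c + c * b * a) = (\<theta> ((a + c) * b * (a + c)) - \<theta> (a * b * a)) - \<theta> (c * b * c)"
      unfolding e using a b c ac by (simp only: diff diff_in mult_in)
    also have "\<dots> = ((\<theta> a + \<theta> c) * \<theta> b * (\<theta> a + \<theta> c) - \<theta> a * \<theta> b * \<theta> a) - \<theta> c * \<theta> b * \<theta> c"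
      by (simp only: triple[OF ac b] triple[OF a b] triple[OF c b] add[OF a c])
    finally show ?thesis by (simp add: distrib_left distrib_right)
  qed
  have \<theta>R: "\<theta> a \<in> R" if "a \<in> R" for a using img that by blast
  have either: "\<theta> (a * b) = \<theta> a * \<theta> b \<or> \<theta> (a * b) = \<theta> b * \<theta> a" if a: "a \<in> R" and b: "b \<in> R" for a b
  proof -
    define p where "p = \<theta> a * \<theta> b"
    define q where "q = \<theta> b * \<theta> a"
    define w where "w = \<theta> (a * b)"
    have R: "p \<in> R" "q \<in> R" "w \<in> R" using a b by (simp_all add: p_def q_def w_def mult_in \<theta>R)
    have ba: "\<theta> (b * a) = p + q - w"
      using jordan[OF a b] add[OF mult_in[OF a b] mult_in[OF b a]] by (simp add: p_def q_def w_def algebra_simps)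
    have "(w - p) * y * (w - q) + (w - q) * y * (w - p) = 0" if "y \<in> R" for y
    proof -
      have "y \<in> \<theta> ` R" using that by (simp only: img)
      then obtain x where x: "x \<in> R" "y = \<theta> x" by blast
      have axa: "a * x * a \<in> R" and bxb: "b * x * b \<in> R" using a b x by (simp_all add: mult_in)
      \<comment> \<open>The same element is a symmetrized triple product of \<open>a * b\<close>,
        \<open>x\<close>, \<open>b * a\<close> and also a sum of two nested triple products; the two
        evaluations of \<theta> give the identity in \<open>y\<close>.\<close>
      have e: "(a * b) * x * (b * a) + (b * a) * x * (a * b) = a * (b * x * b) * a + b * (a * x * a) * b"
        by (simp add: mult.assoc)
      have "\<theta> ((a * b) * x * (b * a) + (b * a) * x * (a * b)) = w * y * (p + q - w) + (p + q - w) * y * w"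
        using triple2[OF mult_in[OF a b] x(1) mult_in[OF b a]] by (simp only: ba x(2) w_def)
      moreover have "\<theta> ((a * b) * x * (b * a) + (b * a) * x * (a * b)) = p * y * q + q * y * p"
      proof -
        have "\<theta> ((a * b) * x * (b * a) + (b * a) * x * (a * b)) = \<theta> (a * (b * x * b) * a) + \<theta> (b * (a * x * a) * b)"
          unfolding e by (rule add[OF mult_in[OF mult_in[OF a bxb] a] mult_in[OF mult_in[OF b axa] b]])
        also have "\<dots> = \<theta> a * (\<theta> b * y * \<theta> b) * \<theta> a + \<theta> b * (\<theta> a * y * \<theta> a) * \<theta> b"
          by (simp only: triple[OF a bxb] triple[OF b axa] triple[OF a x(1)] triple[OF b x(1)] x(2))
        finally show ?thesis by (simp only: p_def q_def mult.assoc)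
      qed
      ultimately have eq: "p * y * q + q * y * p = w * y * (p + q - w) + (p + q - w) * y * w" by simp
      have "(w - p) * y * (w - q) + (w - q) * y * (w - p)
        = (p * y * q + q * y * p) - (w * y * (p + q - w) + (p + q - w) * y * w)"
        by (simp add: algebra_simps)
      then show ?thesis by (simp only: eq diff_self)
    qed
    then have "w - p = 0 \<or> w - q = 0" using R by (intro prime_sym diff_in)
    then show ?thesis by (auto simp: p_def q_def w_def)
  qed
  \<comment> \<open>For fixed \<open>a\<close>, the elements \<open>b\<close> with the
    multiplicative rule and those with the antimultiplicative rule are each closed under differences
    and together exhaust \<open>R\<close>.\<close>
  have hom: "(\<forall>b\<in>R. \<theta> (a * b) = \<theta> a * \<theta> b) \<or> (\<forall>b\<in>R. \<theta> (a * b) = \<theta> b * \<theta> a)" if a: "a \<in> R" for a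
  proof (rule additive_group_cover)
    show "x + y \<in> R" if "x \<in> R" "y \<in> R" for x y using that by (rule add_in)
    show "\<theta> (a * x) = \<theta> a * \<theta> x \<or> \<theta> (a * x) = \<theta> x * \<theta> a" if "x \<in> R" for x using either[OF a that] .
    show "\<theta> (a * y) = \<theta> a * \<theta> y"
      if h: "x \<in> R" "y \<in> R" "\<theta> (a * (x + y)) = \<theta> a * \<theta> (x + y)" "\<theta> (a * x) = \<theta> a * \<theta> x" for x y
      using h(3,4) by (simp add: distrib_left add[OF h(1,2)] add[OF mult_in[OF a h(1)] mult_in[OF a h(2)]])
    show "\<theta> (a * x) = \<theta> x * \<theta> a"
      if h: "x \<in> R" "y \<in> R" "\<theta> (a * (x + y)) = \<theta> (x + y) * \<theta> a" "\<theta> (a * y) = \<theta> y * \<theta> a" for x y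
      using h(3,4) by (simp add: distrib_left distrib_right add[OF h(1,2)] add[OF mult_in[OF a h(1)] mult_in[OF a h(2)]])
  qed
  show ?thesis
  proof (rule additive_group_cover)
    show "x + y \<in> R" if "x \<in> R" "y \<in> R" for x y using that by (rule add_in)
    show "(\<forall>b\<in>R. \<theta> (x * b) = \<theta> x * \<theta> b) \<or> (\<forall>b\<in>R. \<theta> (x * b) = \<theta> b * \<theta> x)" if "x \<in> R" for x
      using hom[OF that] .
    show "\<forall>b\<in>R. \<theta> (y * b) = \<theta> y * \<theta> b"
      if h: "x \<in> R" "y \<in> R" "\<forall>b\<in>R. \<theta> ((x + y) * b) = \<theta> (x + y) * \<theta> b" "\<forall>b\<in>R. \<theta> (x * b) = \<theta> x * \<theta> b" for x y
    proof
      fix b assume b: "b \<in> R"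
      show "\<theta> (y * b) = \<theta> y * \<theta> b"
        using h(3)[rule_format, OF b] h(4)[rule_format, OF b]
        by (simp add: distrib_right add[OF h(1,2)] add[OF mult_in[OF h(1) b] mult_in[OF h(2) b]])
    qed
    show "\<forall>b\<in>R. \<theta> (x * b) = \<theta> b * \<theta> x"
      if h: "x \<in> R" "y \<in> R" "\<forall>b\<in>R. \<theta> ((x + y) * b) = \<theta> b * \<theta> (x + y)" "\<forall>b\<in>R. \<theta> (y * b) = \<theta> b * \<theta> y" for x y
    proof
      fix b assume b: "b \<in> R"
      show "\<theta> (x * b) = \<theta> b * \<theta> x"
        using h(3)[rule_format, OF b] h(4)[rule_format, OF b]
        by (simp add: distrib_left distrib_right add[OF h(1,2)] add[OF mult_in[OF h(1) b] mult_in[OF h(2) b]])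
    qed
  qed
qed

end

section \<open>Determinant-preserving maps\<close>

lemma zero_of_norm_le_linear:
  fixes u :: "'a::real_normed_vector"
  assumes "\<And>s. 0 < s \<Longrightarrow> s \<le> 1 \<Longrightarrow> norm u \<le> s * K"
  shows "u = 0"
proof (rule ccontr)
  assume "u \<noteq> 0"
  then have n: "0 < norm u" by simp
  have "norm u \<le> 1 * K" by (rule assms) auto
  then have K: "0 < K" using n by linarith
  define s where "s = min 1 (norm u / (2 * K))"
  have s: "0 < s" "s \<le> 1" using n K by (simp_all add: s_def)
  have "s * K \<le> norm u / (2 * K) * K" using K by (intro mult_right_mono) (auto simp: s_def)
  also have "\<dots> = norm u / 2" using K by simp
  finally show False using assms[OF s] n by simp
qed

locale det_map = factor_alg R + traced_alg R t for R :: "'h::chilbert_space cop set" and t +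
  fixes f :: "'h cop \<Rightarrow> 'h cop"
  assumes f_bij: "bij_betw f gl gl" and f_one: "f 1 = 1"
    and f_L: "a \<in> gl \<Longrightarrow> b \<in> gl \<Longrightarrow> L (f a + f b) = L (a + b)"
begin

section \<open>Homogeneity and additivity from the determinant identity\<close>

lemma f_gl: "a \<in> gl \<Longrightarrow> f a \<in> gl"
  using f_bij bij_betwE by blast

lemma f_surj:
  assumes "b \<in> gl"
  obtains a where "a \<in> gl" "b = f a"
  using assms f_bij unfolding bij_betw_def by blast

lemma f_inj: "a \<in> gl \<Longrightarrow> b \<in> gl \<Longrightarrow> f a = f b \<Longrightarrow> a = b"
  using f_bij unfolding bij_betw_def inj_on_def by blast

lemma L_f: "a \<in> gl \<Longrightarrow> L (f a) = L a"
  using f_L[of a a] L_scaleR[of 2 a] L_scaleR[of 2 "f a"] f_gl[of a] by (simp add: scaleR_2)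

text \<open>Since \<open>r a + a\<close> is a multiple of \<open>a\<close>, the determinant identity
  says that the pair \<open>f (r a)\<close>, \<open>f a\<close> attains equality in Minkowski's
  inequality.\<close>

lemma f_scaleR:
  assumes r: "0 < r" and a: "a \<in> gl"
  shows "f (r *\<^sub>R a) = r *\<^sub>R f a"
proof (rule minkowski_equality[OF _ f_gl[OF a] r])
  have ra: "r *\<^sub>R a \<in> gl" using r a by (rule gl_scaleR)
  show "f (r *\<^sub>R a) \<in> gl" by (rule f_gl[OF ra])
  show "L (f (r *\<^sub>R a)) = ln r + L (f a)" using r a ra by (simp add: L_f L_scaleR)
  have "r *\<^sub>R a + a = (r + 1) *\<^sub>R a" by (simp add: scaleR_left_distrib)
  then show "L (f (r *\<^sub>R a) + f a) = ln (r + 1) + L (f a)"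
    using f_L[OF ra a] L_scaleR[of "r + 1" a] r a by (simp add: L_f)
qed

text \<open>Homogeneity moves the factor \<open>s\<close> through \<open>f\<close>, so the functions
  \<open>s \<mapsto> L (f a + s f b)\<close> and \<open>s \<mapsto> L (a + s b)\<close> agree on
  [0, 1]; their one-sided derivatives at 0 are the two traces.\<close>

lemma t_cinv_f:
  assumes a: "a \<in> gl" and b: "b \<in> gl"
  shows "t (cinv (f a) * f b) = t (cinv a * b)"
proof -
  have eq: "L (f a + s *\<^sub>R f b) = L (a + s *\<^sub>R b)" if s: "s \<in> {0..1}" for s
  proof (cases "s = 0")
    case True then show ?thesis by (simp add: L_f[OF a])
  next
    case False
    then have "0 < s" using s by simp
    then show ?thesis using f_L[OF a gl_scaleR[OF _ b]] f_scaleR[OF _ b] by simp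
  qed
  have "((\<lambda>s. L (a + s *\<^sub>R b)) has_vector_derivative t (cinv (f a) * f b)) (at 0 within {0..1})"
    by (rule has_vector_derivative_transform[OF _ _ L_line_derivative[OF f_gl[OF a] f_gl[OF b]]])
       (simp_all add: eq)
  moreover have "at (0::real) within {0..1} \<noteq> bot"
    by (simp add: at_within_Icc_at_right)
  ultimately show ?thesis
    using vector_derivative_unique_within L_line_derivative[OF a b] by blast
qed

text \<open>A self-adjoint \<open>d\<close> is the difference of \<open>d + c\<close> and
  \<open>c\<close>, both in \<open>gl\<close> for large \<open>c\<close>. Testing against both gives
  \<open>t (d * d) = 0\<close>, and faithfulness finishes.\<close>

lemma separation:
  assumes d: "d \<in> R" "adj d = d" and tg: "\<And>g. g \<in> gl \<Longrightarrow> t (g * d) = 0"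
  shows "d = 0"
proof -
  define c where "c = norm d + 1"
  have c: "0 < c" by (simp add: c_def add_nonneg_pos)
  have c1: "c *\<^sub>R 1 \<in> gl" by (rule gl_scaleR[OF c one_gl])
  have "- norm d *\<^sub>R 1 \<le> d" using sa_between_norm[OF d(2) order_refl] by (simp add: between_def)
  then have "- norm d *\<^sub>R 1 + c *\<^sub>R 1 \<le> d + c *\<^sub>R 1" by (rule add_right_mono)
  then have "1 *\<^sub>R 1 \<le> d + c *\<^sub>R 1" by (simp add: c_def scaleR_left_distrib)
  then have dc: "d + c *\<^sub>R 1 \<in> gl" using d(1) by (intro glI[of _ 1]) (simp_all add: alg_in)
  have "d * d = (d + c *\<^sub>R 1) * d - (c *\<^sub>R 1) * d" by (simp add: distrib_right)
  then have "t (d * d) = 0" using tg[OF dc] tg[OF c1] d(1) dc by (simp add: tdiff mult_in alg_in del: mult_scaleR_left)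
  moreover have "0 \<le> d * d" using adj_mult_nonneg[of d] d(2) by simp
  ultimately have "adj d * d = 0" using faithful[of "d * d"] d by (simp add: mult_in)
  then show ?thesis by (rule adj_mult_eq_0)
qed

text \<open>Every \<open>g\<close> in \<open>gl\<close> is the inverse of some \<open>f a\<close>,
  so \<open>t (g * f x)\<close> equals a trace that is additive in \<open>x\<close>; such
  functionals separate self-adjoint elements.\<close>

lemma f_add:
  assumes b: "b \<in> gl" and c: "c \<in> gl"
  shows "f (b + c) = f b + f c"
proof -
  have bc: "b + c \<in> gl" using b c by (rule gl_add)
  have "f (b + c) - f b - f c = 0"
  proof (rule separation)
    show "f (b + c) - f b - f c \<in> R" using b c bc by (simp add: diff_in f_gl gl_in)
    show "adj (f (b + c) - f b - f c) = f (b + c) - f b - f c" using b c bc by (simp add: gl_sa f_gl)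
    fix g assume g: "g \<in> gl"
    obtain a where a: "a \<in> gl" "cinv g = f a" using f_surj[OF gl_cinv[OF g]] by blast
    have ga: "g = cinv (f a)" using a(2) cinv_cinv[OF gl_unit[OF g]] by simp
    have aR: "cinv a \<in> R" and gR: "g \<in> R" using gl_in gl_cinv a(1) g by blast+
    have "t (g * (f (b + c) - f b - f c)) = t (g * f (b + c)) - t (g * f b) - t (g * f c)"
      using gR b c bc by (simp add: right_diff_distrib tdiff mult_in diff_in f_gl gl_in)
    also have "\<dots> = t (cinv a * (b + c)) - t (cinv a * b) - t (cinv a * c)"
      unfolding ga by (simp only: t_cinv_f[OF a(1)] b c bc)
    also have "\<dots> = 0" using aR b c by (simp add: distrib_left tadd mult_in gl_in)
    finally show "t (g * (f (b + c) - f b - f c)) = 0" .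
  qed
  then show ?thesis by (simp add: algebra_simps)
qed

text \<open>The map dual to \<open>f\<close>: the trace identity becomes
  \<open>t (h a * f b) = t (a * b)\<close>. Since \<open>f\<close> is onto, this determines
  \<open>h\<close> and makes it additive like \<open>f\<close>; that \<open>h\<close> and
  \<open>f\<close> coincide comes out of the expansion in \<open>g_square_gl\<close>.\<close>

definition h :: "'h cop \<Rightarrow> 'h cop" where
  "h a = cinv (f (cinv a))"

lemma h_gl: "a \<in> gl \<Longrightarrow> h a \<in> gl"
  unfolding h_def by (intro gl_cinv f_gl)

lemma t_h_f: "a \<in> gl \<Longrightarrow> b \<in> gl \<Longrightarrow> t (h a * f b) = t (a * b)"
  using t_cinv_f[of "cinv a" b] by (simp add: h_def gl_cinv cinv_cinv gl_unit)

lemma h_one: "h 1 = 1"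
  by (simp add: h_def f_one)

lemma h_scaleR: "0 < r \<Longrightarrow> a \<in> gl \<Longrightarrow> h (r *\<^sub>R a) = r *\<^sub>R h a"
  using f_scaleR[of "1/r" "cinv a"]
  by (simp add: h_def gl_cinv cinv_scaleR gl_unit f_gl)

lemma h_add:
  assumes b: "b \<in> gl" and c: "c \<in> gl"
  shows "h (b + c) = h b + h c"
proof -
  have bc: "b + c \<in> gl" using b c by (rule gl_add)
  have hR: "h b \<in> R" "h c \<in> R" "h (b + c) \<in> R" using b c bc by (simp_all add: gl_in h_gl)
  have "h (b + c) - h b - h c = 0"
  proof (rule separation)
    show "h (b + c) - h b - h c \<in> R" using hR by (simp add: diff_in)
    show "adj (h (b + c) - h b - h c) = h (b + c) - h b - h c" using b c bc by (simp add: gl_sa h_gl)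
    fix g assume g: "g \<in> gl"
    obtain a where a: "a \<in> gl" "g = f a" using f_surj[OF g] by blast
    have aR: "a \<in> R" and gR: "g \<in> R" using gl_in a(1) g by blast+
    have "t (g * (h (b + c) - h b - h c)) = t ((h (b + c) - h b - h c) * g)"
      using gR hR by (intro tcomm diff_in)
    also have "\<dots> = t (h (b + c) * g) - t (h b * g) - t (h c * g)"
      using gR hR by (simp add: left_diff_distrib tdiff mult_in diff_in)
    also have "\<dots> = t ((b + c) * a) - t (b * a) - t (c * a)"
      unfolding a(2) by (simp only: t_h_f[OF _ a(1)] b c bc)
    also have "\<dots> = 0" using aR b c by (simp add: distrib_right tadd mult_in gl_in)
    finally show "t (g * (h (b + c) - h b - h c)) = 0" .
  qed
  then show ?thesis by (simp add: algebra_simps)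
qed

subsection \<open>Extension to the self-adjoint part\<close>

definition sa :: "'h cop set" where
  "sa = {a \<in> R. adj a = a}"

lemma sa_in: "a \<in> sa \<Longrightarrow> a \<in> R" and sa_adj: "a \<in> sa \<Longrightarrow> adj a = a"
  by (simp_all add: sa_def)

lemma sa_closed:
  "a \<in> sa \<Longrightarrow> b \<in> sa \<Longrightarrow> a + b \<in> sa" "a \<in> sa \<Longrightarrow> b \<in> sa \<Longrightarrow> a - b \<in> sa" "a \<in> sa \<Longrightarrow> r *\<^sub>R a \<in> sa"
  "a \<in> sa \<Longrightarrow> - a \<in> sa" "1 \<in> sa" "0 \<in> sa" "a \<in> sa \<Longrightarrow> a * a \<in> sa" "a \<in> sa \<Longrightarrow> b \<in> sa \<Longrightarrow> a * b + b * a \<in> sa"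
  by (simp_all add: sa_def alg_in add.commute)

lemma gl_sub_sa: "a \<in> gl \<Longrightarrow> a \<in> sa"
  by (simp add: sa_def gl_in gl_sa)

definition shift :: "'h cop \<Rightarrow> real" where
  "shift a = norm a + 1"

lemma shift_pos: "0 < shift a"
  by (simp add: shift_def add_nonneg_pos)

lemma shift_gl: "a \<in> sa \<Longrightarrow> a + shift a *\<^sub>R 1 \<in> gl"
proof -
  assume a: "a \<in> sa"
  have "- norm a *\<^sub>R 1 \<le> a" using sa_between_norm[OF sa_adj[OF a] order_refl] by (simp add: between_def)
  then have "- norm a *\<^sub>R 1 + shift a *\<^sub>R 1 \<le> a + shift a *\<^sub>R 1" by (rule add_right_mono)
  then have "1 *\<^sub>R 1 \<le> a + shift a *\<^sub>R 1" by (simp add: shift_def scaleR_left_distrib)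
  then show ?thesis using sa_in[OF a] by (intro glI[of _ 1]) (simp_all add: alg_in)
qed

text \<open>The additive extension of \<open>f\<close> to self-adjoint elements. By
  \<open>g_eq\<close> any scalar that lifts \<open>a\<close> into \<open>gl\<close> gives the same
  value; \<open>shift a\<close> is a uniform choice, large enough to lift \<open>a\<close> above
  1.\<close>

definition g :: "'h cop \<Rightarrow> 'h cop" where
  "g a = f (a + shift a *\<^sub>R 1) - shift a *\<^sub>R 1"

lemma scal_gl: "0 < c \<Longrightarrow> c *\<^sub>R 1 \<in> gl"
  by (rule gl_scaleR[OF _ one_gl])

lemma f_scal: "0 < c \<Longrightarrow> f (c *\<^sub>R 1) = c *\<^sub>R 1"
  by (simp add: f_scaleR[OF _ one_gl] f_one)

lemma f_add_scal: "a \<in> gl \<Longrightarrow> 0 < c \<Longrightarrow> f (a + c *\<^sub>R 1) = f a + c *\<^sub>R 1"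
  by (simp add: f_add scal_gl f_scal)

lemma g_eq:
  assumes a: "a \<in> sa" and c: "0 < c" and ac: "a + c *\<^sub>R 1 \<in> gl"
  shows "g a = f (a + c *\<^sub>R 1) - c *\<^sub>R 1"
proof -
  have "f (a + c *\<^sub>R 1) + shift a *\<^sub>R 1 = f (a + c *\<^sub>R 1 + shift a *\<^sub>R 1)"
    by (rule f_add_scal[OF ac shift_pos, symmetric])
  also have "a + c *\<^sub>R 1 + shift a *\<^sub>R 1 = a + shift a *\<^sub>R 1 + c *\<^sub>R 1" by (simp add: add_ac)
  also have "f \<dots> = f (a + shift a *\<^sub>R 1) + c *\<^sub>R 1" by (rule f_add_scal[OF shift_gl[OF a] c])
  finally show ?thesis by (simp add: g_def algebra_simps)
qed

lemma g_gl: "a \<in> gl \<Longrightarrow> g a = f a"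
  using g_eq[of a 1] f_add_scal[of a 1] gl_add[OF _ one_gl, of a] by (simp add: gl_sub_sa)

lemma g_sa: "a \<in> sa \<Longrightarrow> g a \<in> sa"
  unfolding g_def by (intro sa_closed(2)[OF gl_sub_sa[OF f_gl[OF shift_gl]]] sa_closed(3,5))

lemma g_add:
  assumes a: "a \<in> sa" and b: "b \<in> sa"
  shows "g (a + b) = g a + g b"
proof -
  have e: "a + b + (shift a + shift b) *\<^sub>R 1 = (a + shift a *\<^sub>R 1) + (b + shift b *\<^sub>R 1)"
    by (simp add: scaleR_left_distrib add_ac)
  have gl: "a + b + (shift a + shift b) *\<^sub>R 1 \<in> gl"
    unfolding e by (intro gl_add shift_gl a b)
  have "g (a + b) = f (a + b + (shift a + shift b) *\<^sub>R 1) - (shift a + shift b) *\<^sub>R 1"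
    by (rule g_eq[OF sa_closed(1)[OF a b] _ gl]) (simp add: add_pos_pos shift_pos)
  also have "\<dots> = f (a + shift a *\<^sub>R 1) + f (b + shift b *\<^sub>R 1) - (shift a + shift b) *\<^sub>R 1"
    unfolding e by (simp only: f_add[OF shift_gl[OF a] shift_gl[OF b]])
  finally show ?thesis by (simp add: g_def scaleR_left_distrib)
qed

lemma g_zero: "g 0 = 0"
  using g_add[of 0 0] by (simp add: sa_closed)

lemma g_uminus: "a \<in> sa \<Longrightarrow> g (- a) = - g a"
  using g_add[of a "- a"] by (simp add: sa_closed g_zero add_eq_0_iff)

lemma g_diff: "a \<in> sa \<Longrightarrow> b \<in> sa \<Longrightarrow> g (a - b) = g a - g b"
  using g_add[of a "- b"] by (simp add: sa_closed g_uminus)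

lemma g_scaleR_pos:
  assumes r: "0 < r" and a: "a \<in> sa"
  shows "g (r *\<^sub>R a) = r *\<^sub>R g a"
proof -
  have e: "r *\<^sub>R a + (r * shift a) *\<^sub>R 1 = r *\<^sub>R (a + shift a *\<^sub>R 1)" by (simp add: scaleR_right_distrib)
  have gl: "r *\<^sub>R a + (r * shift a) *\<^sub>R 1 \<in> gl" unfolding e by (intro gl_scaleR r shift_gl a)
  have "g (r *\<^sub>R a) = f (r *\<^sub>R a + (r * shift a) *\<^sub>R 1) - (r * shift a) *\<^sub>R 1"
    using r shift_pos[of a] by (intro g_eq[OF sa_closed(3)[OF a] _ gl]) simp
  also have "\<dots> = r *\<^sub>R f (a + shift a *\<^sub>R 1) - (r * shift a) *\<^sub>R 1"
    unfolding e by (simp only: f_scaleR[OF r shift_gl[OF a]])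
  finally show ?thesis by (simp add: g_def scaleR_diff_right)
qed

lemma g_scaleR: "a \<in> sa \<Longrightarrow> g (r *\<^sub>R a) = r *\<^sub>R g a"
proof -
  assume a: "a \<in> sa"
  consider "0 < r" | "r = 0" | "0 < - r" by linarith
  then show ?thesis
  proof cases
    case 1 then show ?thesis using a by (rule g_scaleR_pos)
  next
    case 2 then show ?thesis by (simp add: g_zero)
  next
    case 3
    have "g ((- r) *\<^sub>R a) = (- r) *\<^sub>R g a" by (rule g_scaleR_pos[OF 3 a])
    then show ?thesis using g_uminus[OF sa_closed(3)[OF a], of r] by simp
  qed
qed

lemma g_one: "g 1 = 1"
  by (simp add: g_gl one_gl f_one)

text \<open>A nonnegative \<open>a\<close> need not lie in \<open>gl\<close>, where positivity of
  \<open>f\<close> is known, but \<open>a\<close> plus any positive scalar does; the scalar then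
  tends to 0.\<close>

lemma g_nonneg:
  assumes a: "a \<in> sa" "0 \<le> a"
  shows "0 \<le> g a"
proof -
  have le: "- ((1 / real (Suc n)) *\<^sub>R 1) \<le> g a" for n
  proof -
    have c: "0 < 1 / real (Suc n)" by simp
    have ac: "a + (1 / real (Suc n)) *\<^sub>R 1 \<in> gl"
      using gl_add_nonneg[OF scal_gl[OF c] sa_in[OF a(1)] a(2)] by (simp only: add.commute)
    have "g a = f (a + (1 / real (Suc n)) *\<^sub>R 1) - (1 / real (Suc n)) *\<^sub>R 1" by (rule g_eq[OF a(1) c ac])
    then show ?thesis using gl_nonneg[OF f_gl[OF ac]] by simp
  qed
  have lim: "(\<lambda>n. - ((1 / real (Suc n)) *\<^sub>R (1::'h cop))) \<longlonglongrightarrow> - (0 *\<^sub>R 1)"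
    using LIMSEQ_inverse_real_of_nat by (intro tendsto_intros) (simp add: inverse_eq_divide)
  have "- (0 *\<^sub>R 1) \<le> g a" by (rule tendsto_cop_le[OF lim tendsto_const le])
  then show ?thesis by simp
qed

text \<open>Positivity and \<open>g 1 = 1\<close> preserve the scalar bounds of \<open>a\<close>,
  and these bounds determine the norm of a self-adjoint operator.\<close>

lemma g_norm: "a \<in> sa \<Longrightarrow> norm (g a) \<le> norm a"
proof -
  assume a: "a \<in> sa"
  have b: "- (norm a *\<^sub>R 1) \<le> a" "a \<le> norm a *\<^sub>R 1"
    using sa_between_norm[OF sa_adj[OF a] order_refl] by (simp_all add: between_def)
  have gn: "g (norm a *\<^sub>R 1) = norm a *\<^sub>R 1" by (simp add: g_scaleR sa_closed g_one)
  have "0 \<le> g (norm a *\<^sub>R 1 - a)" using a b(2) by (intro g_nonneg sa_closed) simp_all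
  then have "g a \<le> norm a *\<^sub>R 1" by (simp add: g_diff sa_closed a gn)
  moreover have "- (norm a *\<^sub>R 1) \<le> g a"
  proof -
    have p: "0 \<le> a + norm a *\<^sub>R 1" using b(1) diff_le_eq[of 0 "norm a *\<^sub>R 1" a] by simp
    have "0 \<le> g (a + norm a *\<^sub>R 1)" by (rule g_nonneg[OF sa_closed(1)[OF a sa_closed(3)[OF sa_closed(5)]] p])
    then have "0 \<le> g a + norm a *\<^sub>R 1" by (simp only: g_add[OF a sa_closed(3)[OF sa_closed(5)]] gn)
    then show ?thesis using diff_le_eq[of 0 "norm a *\<^sub>R 1" "g a"] by simp
  qed
  ultimately have "norm (g a) \<le> \<bar>norm a\<bar>" by (rule norm_le_of_le[rotated])
  then show ?thesis by simp
qed

text \<open>Comparing the expansions of \<open>h (1 + s a) * f ((1 + s a)\<^sup>-\<^sup>1) = 1\<close> to second order in \<open>s\<close>: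
  the first-order terms give \<open>h a = g a\<close>, the second-order ones \<open>g (a\<^sup>2) = (g a)\<^sup>2\<close>.\<close>

lemma g_square_gl:
  assumes a: "a \<in> gl"
  shows "g (a * a) = g a * g a"
proof -
  define N where "N = norm a"
  have asa: "a \<in> sa" by (rule gl_sub_sa[OF a])
  have aa: "a * a \<in> sa" by (rule sa_closed(7)[OF asa])
  \<comment> \<open>\<open>U\<close> and \<open>V\<close> are the coefficients of \<open>s\<close>
    and of its square in \<open>h (1 + s a) * f (cinv (1 + s a)) - 1\<close>, and \<open>K\<close>
    bounds what remains.\<close>
  define U where "U = h a - g a"
  define V where "V = g (a * a) - h a * g a"
  define K where "K = N * N * N + norm (h a) * norm (g (a * a)) + norm (h a) * (N * N * N)"
  have N0: "0 \<le> N" by (simp add: N_def)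
  have main: "\<exists>Z. norm Z \<le> K \<and> U + s *\<^sub>R V + s\<^sup>2 *\<^sub>R Z = 0" if s: "0 < s" "s \<le> 1" for s
  proof -
    define b where "b = 1 + s *\<^sub>R a"
    have b: "b \<in> gl" unfolding b_def by (intro gl_add one_gl gl_scaleR s a)
    have ub: "unit b" by (rule gl_unit[OF b])
    define c where "c = cinv b"
    have cgl: "c \<in> gl" unfolding c_def by (rule gl_cinv[OF b])
    have bc: "b * c = 1" "c * b = 1" using cinv_right[OF ub] cinv_left[OF ub] by (simp_all add: c_def)
    have sac: "s *\<^sub>R (a * c) = 1 - c" using bc(1) by (simp add: b_def distrib_right algebra_simps)
    have sca: "s *\<^sub>R (c * a) = 1 - c" using bc(2) by (simp add: b_def distrib_left algebra_simps)
    have "s *\<^sub>R (a * c) = s *\<^sub>R (c * a)" using sac sca by simp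
    then have ac: "a * c = c * a" using s(1) by simp
    define W where "W = a * a * a * c"
    have Wsa: "W \<in> sa"
    proof -
      have "c * (a * (a * a)) = a * (a * (a * c))" using ac by (metis mult.assoc)
      then have "adj W = W" using gl_sa[OF cgl] sa_adj[OF asa] by (simp add: W_def mult.assoc)
      then show ?thesis using gl_in[OF a] gl_in[OF cgl] by (simp add: sa_def W_def mult_in)
    qed
    have "norm c \<le> 1"
    proof (rule norm_cop_bound)
      fix x
      have "0 \<le> s *\<^sub>R a" using s(1) gl_nonneg[OF a] by (intro scaleR_nonneg_nonneg) auto
      then have "1 \<le> b" by (simp add: b_def)
      then have "norm (c \<cdot> x) \<le> norm (b \<cdot> c \<cdot> x)" by (rule norm_app_ge_one)
      also have "b \<cdot> c \<cdot> x = x" using app_cinv_right[OF ub] by (simp add: c_def)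
      finally show "norm (c \<cdot> x) \<le> 1 * norm x" by simp
    qed simp
    then have nW: "norm W \<le> N * N * N"
    proof -
      assume nc: "norm c \<le> 1"
      have "norm W \<le> norm (a * a * a) * norm c" unfolding W_def by (rule norm_mult_ineq)
      also have "\<dots> \<le> norm (a * a * a) * 1" using nc by (intro mult_left_mono) auto
      also have "\<dots> \<le> norm (a * a) * norm a" using norm_mult_ineq[of "a * a" a] by simp
      also have "\<dots> \<le> N * N * N" unfolding N_def by (intro mult_right_mono norm_mult_ineq norm_ge_zero)
      finally show ?thesis .
    qed
    have exp: "c = 1 - s *\<^sub>R a + s\<^sup>2 *\<^sub>R (a * a) - s ^ 3 *\<^sub>R W"
    proof -
      have c1: "c = 1 - s *\<^sub>R (a * c)" using sac by simp
      have "a * c = a - s *\<^sub>R (a * a * c)" by (subst c1) (simp add: right_diff_distrib mult.assoc)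
      moreover have "a * a * c = a * a - s *\<^sub>R (a * a * a * c)" by (subst c1) (simp add: right_diff_distrib mult.assoc)
      ultimately have "c = 1 - s *\<^sub>R (a - s *\<^sub>R (a * a - s *\<^sub>R W))" using c1 by (simp add: W_def)
      then show ?thesis by (simp add: scaleR_diff_right power2_eq_square power3_eq_cube)
    qed
    have fc: "f c = 1 - s *\<^sub>R g a + s\<^sup>2 *\<^sub>R g (a * a) - s ^ 3 *\<^sub>R g W"
    proof -
      have "f c = g (1 - s *\<^sub>R a + s\<^sup>2 *\<^sub>R (a * a) - s ^ 3 *\<^sub>R W)" using g_gl[OF cgl] exp by simp
      then show ?thesis by (simp only: g_diff g_add g_scaleR g_one sa_closed asa aa Wsa)
    qed
    have hb: "h b = 1 + s *\<^sub>R h a"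
      unfolding b_def using s(1) a by (simp add: h_add one_gl gl_scaleR h_one h_scaleR)
    have "h b * f c = 1" unfolding h_def c_def[symmetric] by (rule cinv_left[OF gl_unit[OF f_gl[OF cgl]]])
    define Z where "Z = h a * g (a * a) - g W - s *\<^sub>R (h a * g W)"
    have "h b * f c - 1 = s *\<^sub>R (U + s *\<^sub>R V + s\<^sup>2 *\<^sub>R Z)"
      unfolding hb fc U_def V_def Z_def
      by (simp add: algebra_simps power2_eq_square power3_eq_cube)
    then have "s *\<^sub>R (U + s *\<^sub>R V + s\<^sup>2 *\<^sub>R Z) = 0" using \<open>h b * f c = 1\<close> by simp
    then have eq: "U + s *\<^sub>R V + s\<^sup>2 *\<^sub>R Z = 0" using s(1) by simp
    have ngW: "norm (g W) \<le> N * N * N" using g_norm[OF Wsa] nW by simp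
    have "norm Z \<le> norm (h a * g (a * a)) + norm (g W) + norm (s *\<^sub>R (h a * g W))"
      unfolding Z_def by (intro order_trans[OF norm_triangle_ineq4] add_mono norm_triangle_ineq4 order_refl)
    also have "norm (s *\<^sub>R (h a * g W)) \<le> 1 * norm (h a * g W)" using s by (simp add: mult_left_le_one_le)
    also have "norm (h a * g W) \<le> norm (h a) * (N * N * N)"
      using ngW by (intro order_trans[OF norm_mult_ineq] mult_left_mono) auto
    also have "norm (h a * g (a * a)) \<le> norm (h a) * norm (g (a * a))" by (rule norm_mult_ineq)
    finally have "norm Z \<le> K" using ngW by (simp add: K_def)
    then show ?thesis using eq by blast
  qed
  have "U = 0"
  proof (rule zero_of_norm_le_linear)
    fix s :: real assume s: "0 < s" "s \<le> 1"
    then obtain Z where Z: "norm Z \<le> K" "U + s *\<^sub>R V + s\<^sup>2 *\<^sub>R Z = 0" using main by blast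
    have "U = - (s *\<^sub>R (V + s *\<^sub>R Z))"
      using Z(2) by (simp add: add_eq_0_iff2 scaleR_right_distrib power2_eq_square add.assoc)
    then have "norm U = s * norm (V + s *\<^sub>R Z)" using s by simp
    also have "norm (V + s *\<^sub>R Z) \<le> norm V + s * norm Z" using norm_triangle_ineq[of V "s *\<^sub>R Z"] s by simp
    also have "s * norm Z \<le> 1 * K" using s Z(1) by (intro mult_mono) auto
    finally show "norm U \<le> s * (norm V + K)" using s by simp
  qed
  have "V = 0"
  proof (rule zero_of_norm_le_linear)
    fix s :: real assume s: "0 < s" "s \<le> 1"
    then obtain Z where Z: "norm Z \<le> K" "U + s *\<^sub>R V + s\<^sup>2 *\<^sub>R Z = 0" using main by blast
    have "s *\<^sub>R (V + s *\<^sub>R Z) = 0" using Z(2) \<open>U = 0\<close> by (simp add: scaleR_right_distrib power2_eq_square)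
    then have "V = - (s *\<^sub>R Z)" using s by (simp add: add_eq_0_iff2)
    then have "norm V = s * norm Z" using s by simp
    also have "\<dots> \<le> s * K" using s Z(1) by (intro mult_left_mono) auto
    finally show "norm V \<le> s * K" .
  qed
  then show ?thesis using \<open>U = 0\<close> by (simp add: U_def V_def)
qed

text \<open>A scalar shift moves \<open>a\<close> into \<open>gl\<close>; in the expanded square the
  linear and scalar terms agree on both sides and cancel.\<close>

lemma g_square:
  assumes a: "a \<in> sa"
  shows "g (a * a) = g a * g a"
proof -
  define c where "c = shift a"
  define b where "b = a + c *\<^sub>R 1"
  have b: "b \<in> gl" unfolding b_def c_def by (rule shift_gl[OF a])
  have gb: "g b = g a + c *\<^sub>R 1" unfolding b_def using a by (simp add: g_add g_scaleR sa_closed g_one)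
  have "b * b = a * a + (2 * c) *\<^sub>R a + (c * c) *\<^sub>R 1"
    by (simp add: b_def distrib_left distrib_right scaleR_2 scaleR_add_right flip: scaleR_scaleR)
  then have "g (b * b) = g (a * a) + (2 * c) *\<^sub>R g a + (c * c) *\<^sub>R 1"
    using a by (simp only: g_add g_scaleR sa_closed g_one)
  moreover have "g b * g b = g a * g a + (2 * c) *\<^sub>R g a + (c * c) *\<^sub>R 1"
    unfolding gb by (simp add: distrib_left distrib_right scaleR_2 scaleR_add_right flip: scaleR_scaleR)
  ultimately show ?thesis using g_square_gl[OF b] by simp
qed

lemma g_jordan:
  assumes a: "a \<in> sa" and b: "b \<in> sa"
  shows "g (a * b + b * a) = g a * g b + g b * g a"
proof -
  have e: "(a + b) * (a + b) = a * a + (a * b + b * a) + b * b" by (simp add: distrib_left distrib_right)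
  have "(g a + g b) * (g a + g b) = g ((a + b) * (a + b))" using a b by (simp only: g_square sa_closed g_add)
  also have "\<dots> = g (a * a) + g (a * b + b * a) + g (b * b)"
    unfolding e using a b by (simp only: g_add sa_closed)
  also have "\<dots> = g a * g a + g (a * b + b * a) + g b * g b" using a b by (simp only: g_square)
  finally show ?thesis by (simp add: distrib_left distrib_right algebra_simps)
qed

lemma g_inj: "a \<in> sa \<Longrightarrow> b \<in> sa \<Longrightarrow> g a = g b \<Longrightarrow> a = b"
proof -
  assume a: "a \<in> sa" and b: "b \<in> sa" and eq: "g a = g b"
  have z: "g (a - b) = 0" using a b eq by (simp add: g_diff)
  have ab: "a - b \<in> sa" using a b by (simp add: sa_closed)
  let ?c = "shift (a - b)"
  have "f (a - b + ?c *\<^sub>R 1) = f (?c *\<^sub>R 1)" using z f_scal[OF shift_pos] by (simp add: g_def)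
  then have "a - b + ?c *\<^sub>R 1 = ?c *\<^sub>R 1" by (rule f_inj[OF shift_gl[OF ab] scal_gl[OF shift_pos]])
  then show "a = b" by simp
qed

lemma g_surj:
  assumes b: "b \<in> sa"
  shows "\<exists>a\<in>sa. g a = b"
proof -
  obtain a where a: "a \<in> gl" "b + shift b *\<^sub>R 1 = f a" using f_surj[OF shift_gl[OF b]] by blast
  have sa: "a - shift b *\<^sub>R 1 \<in> sa" using a(1) by (intro sa_closed gl_sub_sa)
  have "g (a - shift b *\<^sub>R 1) = f (a - shift b *\<^sub>R 1 + shift b *\<^sub>R 1) - shift b *\<^sub>R 1"
    by (rule g_eq[OF sa shift_pos]) (simp add: a(1))
  also have "\<dots> = b" using a(2) by (simp add: algebra_simps)
  finally show ?thesis using sa by blast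
qed

subsection \<open>Complexification\<close>

definition re :: "'h cop \<Rightarrow> 'h cop" where "re a = (1/2) *\<^sub>R (a + adj a)"
definition im :: "'h cop \<Rightarrow> 'h cop" where "im a = cscale (- \<i> / 2) (a - adj a)"
definition \<theta> :: "'h cop \<Rightarrow> 'h cop" where "\<theta> a = g (re a) + cscale \<i> (g (im a))"

lemma half_scale: "cscale (1/2) a = (1/2) *\<^sub>R (a :: 'h cop)"
  using cscale_of_real[of "1/2" a] by simp

lemma re_sa: "a \<in> R \<Longrightarrow> re a \<in> sa"
  by (simp add: re_def sa_def alg_in add.commute)

lemma im_sa: "a \<in> R \<Longrightarrow> im a \<in> sa"
  by (simp add: im_def sa_def alg_in cscale_diff cscale_minus)

lemma re_im: "re a + cscale \<i> (im a) = a"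
proof -
  have "cscale \<i> (im a) = (1/2) *\<^sub>R (a - adj a)"
    by (simp add: im_def cscale_simps half_scale)
  then have "re a + cscale \<i> (im a) = (1/2) *\<^sub>R (a + a)" by (simp add: re_def scaleR_right_distrib scaleR_diff_right)
  then show ?thesis by (simp flip: scaleR_2)
qed

lemma re_im_unique:
  assumes "adj x = (x :: 'h cop)" "adj y = y"
  shows "re (x + cscale \<i> y) = x" "im (x + cscale \<i> y) = y"
proof -
  have "x + cscale \<i> y + adj (x + cscale \<i> y) = 2 *\<^sub>R x"
    by (simp add: assms cscale_minus scaleR_2)
  then show "re (x + cscale \<i> y) = x" by (simp add: re_def)
  have "x + cscale \<i> y - adj (x + cscale \<i> y) = cscale \<i> y + cscale \<i> y"
    by (simp add: assms cscale_minus)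
  then show "im (x + cscale \<i> y) = y"
    by (simp add: im_def cscale_simps cscale_one flip: cscale_simps(2))
qed

lemma \<theta>_eq: "x \<in> sa \<Longrightarrow> y \<in> sa \<Longrightarrow> \<theta> (x + cscale \<i> y) = g x + cscale \<i> (g y)"
  by (simp add: \<theta>_def re_im_unique sa_adj)

lemma cartesian:
  assumes "a \<in> R"
  obtains x y where "x \<in> sa" "y \<in> sa" "a = x + cscale \<i> y"
  using re_sa[OF assms] im_sa[OF assms] re_im[of a] by metis

lemma \<theta>_sa: "x \<in> sa \<Longrightarrow> \<theta> x = g x"
  using \<theta>_eq[of x 0] by (simp add: sa_closed g_zero)

lemma \<theta>_gl: "a \<in> gl \<Longrightarrow> \<theta> a = f a"
  by (simp add: \<theta>_sa gl_sub_sa g_gl)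

lemma \<theta>_add:
  assumes "a \<in> R" "b \<in> R"
  shows "\<theta> (a + b) = \<theta> a + \<theta> b"
proof -
  obtain x y where a: "x \<in> sa" "y \<in> sa" "a = x + cscale \<i> y" using cartesian[OF assms(1)] .
  obtain z w where b: "z \<in> sa" "w \<in> sa" "b = z + cscale \<i> w" using cartesian[OF assms(2)] .
  have "a + b = (x + z) + cscale \<i> (y + w)" by (simp add: a(3) b(3) cscale_simps)
  then have "\<theta> (a + b) = g (x + z) + cscale \<i> (g (y + w))" using a b by (simp only: \<theta>_eq sa_closed)
  then show ?thesis using a b by (simp add: \<theta>_eq g_add cscale_simps)
qed

lemma \<theta>_cscale:
  assumes "a \<in> R"
  shows "\<theta> (cscale c a) = cscale c (\<theta> a)"
proof -
  obtain x y where a: "x \<in> sa" "y \<in> sa" "a = x + cscale \<i> y" using cartesian[OF assms] .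
  \<comment> \<open>Splitting \<open>c\<close> into real and imaginary parts reduces complex
    homogeneity to real linearity of \<open>g\<close>; the formula is used once before and once
    after applying \<open>g\<close>.\<close>
  have expand: "cscale c (u + cscale \<i> v) = (Re c *\<^sub>R u - Im c *\<^sub>R v) + cscale \<i> (Im c *\<^sub>R u + Re c *\<^sub>R v)" for u v :: "'h cop"
  proof -
    have "cscale c w = Re c *\<^sub>R w + cscale \<i> (Im c *\<^sub>R w)" for w :: "'h cop"
      using cscale_simps(2)[of "of_real (Re c)" "\<i> * of_real (Im c)" w]
      by (simp only: cscale_of_real cscale_simps(3)[symmetric] flip: complex_eq)
    moreover have "cscale \<i> (cscale \<i> w) = - w" for w :: "'h cop"
      using cscale_minus(2)[of 1 w] by (simp add: cscale_simps cscale_one)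
    moreover have "r *\<^sub>R cscale \<i> w = cscale \<i> (r *\<^sub>R w)" for r and w :: "'h cop"
      by (simp add: cscale_simps mult.commute flip: cscale_of_real)
    ultimately show ?thesis by (simp add: cscale_simps(1) algebra_simps)
  qed
  have "\<theta> (cscale c a) = g (Re c *\<^sub>R x - Im c *\<^sub>R y) + cscale \<i> (g (Im c *\<^sub>R x + Re c *\<^sub>R y))"
    unfolding a(3) expand using a by (simp only: \<theta>_eq sa_closed)
  also have "\<dots> = cscale c (g x + cscale \<i> (g y))"
    unfolding expand using a by (simp only: g_add g_diff g_scaleR sa_closed)
  finally show ?thesis using a by (simp add: \<theta>_eq)
qed

lemma \<theta>_adj:
  assumes "a \<in> R"
  shows "\<theta> (adj a) = adj (\<theta> a)"
proof -
  obtain x y where a: "x \<in> sa" "y \<in> sa" "a = x + cscale \<i> y" using cartesian[OF assms] .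
  have "adj a = x + cscale \<i> (- y)" using a by (simp add: sa_adj cscale_minus)
  then have "\<theta> (adj a) = g x + cscale \<i> (g (- y))" using a by (simp only: \<theta>_eq sa_closed)
  then show ?thesis using a by (simp add: \<theta>_eq g_uminus cscale_minus sa_adj[OF g_sa])
qed

lemma \<theta>_in: "a \<in> R \<Longrightarrow> \<theta> a \<in> R"
  unfolding \<theta>_def by (rule add_in[OF sa_in[OF g_sa[OF re_sa]] cscale_in[OF sa_in[OF g_sa[OF im_sa]]]])

lemma \<theta>_bij: "bij_betw \<theta> R R"
  unfolding bij_betw_def
proof
  show "inj_on \<theta> R"
  proof (rule inj_onI)
    fix a b assume ab: "a \<in> R" "b \<in> R" and eq: "\<theta> a = \<theta> b"
    obtain x y where a: "x \<in> sa" "y \<in> sa" "a = x + cscale \<i> y" using cartesian[OF ab(1)] .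
    obtain z w where b: "z \<in> sa" "w \<in> sa" "b = z + cscale \<i> w" using cartesian[OF ab(2)] .
    have e: "g x + cscale \<i> (g y) = g z + cscale \<i> (g w)" using eq a b by (simp add: \<theta>_eq)
    have "g x = g z" using arg_cong[OF e, of re] a b by (simp add: re_im_unique sa_adj g_sa)
    moreover have "g y = g w" using arg_cong[OF e, of im] a b by (simp add: re_im_unique sa_adj g_sa)
    ultimately show "a = b" using a b g_inj by blast
  qed
  show "\<theta> ` R = R"
  proof
    show "\<theta> ` R \<subseteq> R" using \<theta>_in by blast
    show "R \<subseteq> \<theta> ` R"
    proof
      fix b assume "b \<in> R"
      then obtain z w where b: "z \<in> sa" "w \<in> sa" "b = z + cscale \<i> w" by (rule cartesian)
      obtain x y where xy: "x \<in> sa" "y \<in> sa" "g x = z" "g y = w" using g_surj[OF b(1)] g_surj[OF b(2)] by blast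
      have "b = \<theta> (x + cscale \<i> y)" using xy b(3) by (simp add: \<theta>_eq)
      moreover have "x + cscale \<i> y \<in> R" by (rule add_in[OF sa_in[OF xy(1)] cscale_in[OF sa_in[OF xy(2)]]])
      ultimately show "b \<in> \<theta> ` R" by (rule image_eqI)
    qed
  qed
qed

lemma \<theta>_square:
  assumes "a \<in> R"
  shows "\<theta> (a * a) = \<theta> a * \<theta> a"
proof -
  obtain x y where a: "x \<in> sa" "y \<in> sa" "a = x + cscale \<i> y" using cartesian[OF assms] .
  \<comment> \<open>The imaginary part of the square is the Jordan product of \<open>u\<close> and
    \<open>v\<close>, so the Jordan structure of \<open>g\<close> suffices.\<close>
  have sq: "(u + cscale \<i> v) * (u + cscale \<i> v) = (u * u - v * v) + cscale \<i> (u * v + v * u)" for u v :: "'h cop"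
  proof -
    have "cscale \<i> v * cscale \<i> v = - (v * v)"
      using cscale_minus(2)[of 1 "v * v"] by (simp add: cscale_simps cscale_one)
    then show ?thesis by (simp add: distrib_left distrib_right cscale_simps(1,4,5))
  qed
  have "\<theta> (a * a) = g (x * x - y * y) + cscale \<i> (g (x * y + y * x))"
    unfolding a(3) sq using a by (simp only: \<theta>_eq sa_closed)
  also have "\<dots> = (g x + cscale \<i> (g y)) * (g x + cscale \<i> (g y))"
    unfolding sq using a by (simp only: g_diff g_square g_jordan sa_closed)
  finally show ?thesis using a by (simp add: \<theta>_eq)
qed

theorem extension:
  "star_bij R \<theta>" "(\<forall>a\<in>R. \<forall>b\<in>R. \<theta> (a * b) = \<theta> a * \<theta> b) \<or> (\<forall>a\<in>R. \<forall>b\<in>R. \<theta> (a * b) = \<theta> b * \<theta> a)"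
proof -
  show "star_bij R \<theta>"
    unfolding star_bij_def using \<theta>_bij \<theta>_add \<theta>_cscale \<theta>_adj by blast
  show "(\<forall>a\<in>R. \<forall>b\<in>R. \<theta> (a * b) = \<theta> a * \<theta> b) \<or> (\<forall>a\<in>R. \<forall>b\<in>R. \<theta> (a * b) = \<theta> b * \<theta> a)"
  proof (rule jordan_factor)
    show "\<theta> ` R = R" using \<theta>_bij by (simp add: bij_betw_def)
    show "\<theta> (r *\<^sub>R a) = r *\<^sub>R \<theta> a" if "a \<in> R" for r a
      using \<theta>_cscale[OF that, of "of_real r"] by (simp add: cscale_of_real)
    show "\<theta> (a * b + b * a) = \<theta> a * \<theta> b + \<theta> b * \<theta> a" if ab: "a \<in> R" "b \<in> R" for a b
    proof -
      have e: "(a + b) * (a + b) = a * a + (a * b + b * a) + b * b" by (simp add: distrib_left distrib_right)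
      have "(\<theta> a + \<theta> b) * (\<theta> a + \<theta> b) = \<theta> ((a + b) * (a + b))" using ab by (simp only: \<theta>_square add_in \<theta>_add)
      also have "\<dots> = \<theta> (a * a) + \<theta> (a * b + b * a) + \<theta> (b * b)"
        unfolding e using ab by (simp only: \<theta>_add add_in mult_in)
      also have "\<dots> = \<theta> a * \<theta> a + \<theta> (a * b + b * a) + \<theta> b * \<theta> b" using ab by (simp only: \<theta>_square)
      finally show ?thesis by (simp add: distrib_left distrib_right algebra_simps)
    qed
  qed (rule \<theta>_add)
qed

end

section \<open>Automorphisms preserve the logarithmic trace\<close>

context vn_alg
begin

lemma nonneg_between: "0 \<le> a \<Longrightarrow> between a 0 (norm a)"
  unfolding between_def using sa_le_norm[OF nonneg_sa order_refl] by simp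

lemma nonneg_square:
  assumes "a \<in> R" "0 \<le> a"
  obtains s where "s \<in> R" "adj s = s" "s * s = a"
proof -
  note b = nonneg_between[OF assms(2)]
  have c: "continuous_on S sqrt" for S by (intro continuous_intros)
  have "fc sqrt a * fc sqrt a = fc (\<lambda>x. sqrt x * sqrt x) a" by (rule fc_mult[OF b c c, symmetric])
  also have "\<dots> = fc (\<lambda>x. x) a" by (rule fc_cong[OF b]) simp
  finally have "fc sqrt a * fc sqrt a = a" by (simp add: fc_id[OF b])
  then show ?thesis using fc_in[OF assms(1) b c] fc_sa[OF b c] by (rule that[rotated 2])
qed

end

locale traced_factor = factor_alg R + traced_alg R t for R :: "'h::chilbert_space cop set" and t

locale star_morphism = traced_factor R t for R :: "'h::chilbert_space cop set" and t +
  fixes \<theta> :: "'h cop \<Rightarrow> 'h cop"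
  assumes sb: "star_bij R \<theta>"
    and mult: "(\<forall>a\<in>R. \<forall>b\<in>R. \<theta> (a * b) = \<theta> a * \<theta> b) \<or> (\<forall>a\<in>R. \<forall>b\<in>R. \<theta> (a * b) = \<theta> b * \<theta> a)"
begin

lemma th_add: "a \<in> R \<Longrightarrow> b \<in> R \<Longrightarrow> \<theta> (a + b) = \<theta> a + \<theta> b"
  using sb by (simp add: star_bij_def)

lemma th_scaleR: "a \<in> R \<Longrightarrow> \<theta> (r *\<^sub>R a) = r *\<^sub>R \<theta> a"
  using sb by (simp add: star_bij_def flip: cscale_of_real)

lemma th_adj: "a \<in> R \<Longrightarrow> \<theta> (adj a) = adj (\<theta> a)"
  using sb by (simp add: star_bij_def)

lemma th_in: "a \<in> R \<Longrightarrow> \<theta> a \<in> R"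
  using sb unfolding star_bij_def by (meson bij_betwE)

lemma th_diff: "a \<in> R \<Longrightarrow> b \<in> R \<Longrightarrow> \<theta> (a - b) = \<theta> a - \<theta> b"
  using th_add[of a "(-1) *\<^sub>R b"] th_scaleR[of b "-1"] by (simp add: uminus_in)

lemma th_square: "a \<in> R \<Longrightarrow> \<theta> (a * a) = \<theta> a * \<theta> a"
  using mult by blast

text \<open>Apply \<theta> to the product of a preimage of 1 with 1; either order of multiplication
  leaves \<open>\<theta> 1\<close>.\<close>

lemma th_one: "\<theta> 1 = 1"
proof -
  obtain e where e: "e \<in> R" "\<theta> e = 1"
    using sb one_in unfolding star_bij_def bij_betw_def by (metis imageE)
  have "\<theta> (e * 1) = \<theta> e * \<theta> 1 \<or> \<theta> (e * 1) = \<theta> 1 * \<theta> e" using mult e(1) one_in by blast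
  then show ?thesis by (simp add: e(2))
qed

lemma th_nonneg: "a \<in> R \<Longrightarrow> 0 \<le> a \<Longrightarrow> 0 \<le> \<theta> a"
proof -
  assume a: "a \<in> R" "0 \<le> a"
  then obtain s where s: "s \<in> R" "adj s = s" "s * s = a" by (rule nonneg_square)
  have "\<theta> a = adj (\<theta> s) * \<theta> s" using th_square[OF s(1)] th_adj[OF s(1)] s by simp
  then show ?thesis by (simp add: adj_mult_nonneg)
qed

lemma th_between: "a \<in> R \<Longrightarrow> between a \<alpha> \<beta> \<Longrightarrow> between (\<theta> a) \<alpha> \<beta>"
  using th_nonneg[of "a - \<alpha> *\<^sub>R 1"] th_nonneg[of "\<beta> *\<^sub>R 1 - a"]
  by (simp add: between_def th_diff th_scaleR th_one alg_in)

lemma th_norm: "a \<in> R \<Longrightarrow> adj a = a \<Longrightarrow> norm (\<theta> a) \<le> norm a"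
proof -
  assume a: "a \<in> R" "adj a = a"
  have "between (\<theta> a) (- norm a) (norm a)" by (rule th_between[OF a(1) sa_between_norm[OF a(2) order_refl]])
  then have "norm (\<theta> a) \<le> \<bar>norm a\<bar>" by (intro norm_le_of_le) (simp_all add: between_def)
  then show ?thesis by simp
qed

text \<open>Powers of a single operator commute, so the antimultiplicative case produces the same
  polynomial.\<close>

lemma th_rpev: "a \<in> R \<Longrightarrow> \<theta> (rpev p a) = rpev p (\<theta> a)"
proof (induct p)
  case 0
  then show ?case using th_scaleR[OF one_in, of 0] by simp
next
  case (pCons c p)
  have P: "rpev p a \<in> R" using pCons by (simp add: rpev_in)
  have "\<theta> (a * rpev p a) = \<theta> a * \<theta> (rpev p a) \<or> \<theta> (a * rpev p a) = \<theta> (rpev p a) * \<theta> a"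
    using mult pCons.prems P by blast
  moreover have "rpev p (\<theta> a) * \<theta> a = \<theta> a * rpev p (\<theta> a)" by (rule rpev_commute) simp
  ultimately have "\<theta> (a * rpev p a) = \<theta> a * rpev p (\<theta> a)" using pCons by auto
  then show ?case using pCons.prems P by (simp add: rpev_pCons th_add th_scaleR th_one mult_in scaleR_in one_in)
qed

text \<open>\<theta> is a contraction on self-adjoint elements, so the polynomial identity passes to
  norm limits.\<close>

lemma th_fc:
  assumes a: "a \<in> R" "between a \<alpha> \<beta>" and f: "continuous_on {\<alpha>..\<beta>} f"
  shows "\<theta> (fc f a) = fc f (\<theta> a)"
proof -
  obtain p where p: "uniform_limit {\<alpha>..\<beta>} (\<lambda>n. poly (p n)) f sequentially"
    using poly_approx[OF f] by blast
  have l: "(\<lambda>n. rpev (p n) a) \<longlonglongrightarrow> fc f a" by (rule fc_lim[OF a(2) p])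
  have "(\<lambda>n. \<theta> (rpev (p n) a)) \<longlonglongrightarrow> \<theta> (fc f a)"
  proof (rule LIM_zero_cancel, rule Lim_null_comparison)
    show "(\<lambda>n. norm (rpev (p n) a - fc f a)) \<longlonglongrightarrow> 0" using l by (intro tendsto_norm_zero LIM_zero)
    show "\<forall>\<^sub>F n in sequentially. norm (\<theta> (rpev (p n) a) - \<theta> (fc f a)) \<le> norm (rpev (p n) a - fc f a)"
    proof (rule always_eventually, rule allI)
      fix n
      have R: "rpev (p n) a \<in> R" "fc f a \<in> R" using a f by (simp_all add: rpev_in fc_in)
      have "adj (rpev (p n) a - fc f a) = rpev (p n) a - fc f a"
        using rpev_sa[OF between_sa[OF a(2)]] fc_sa[OF a(2) f] by simp
      then have "norm (\<theta> (rpev (p n) a - fc f a)) \<le> norm (rpev (p n) a - fc f a)"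
        using R by (intro th_norm diff_in)
      then show "norm (\<theta> (rpev (p n) a) - \<theta> (fc f a)) \<le> norm (rpev (p n) a - fc f a)"
        using R by (simp add: th_diff)
    qed
  qed
  moreover have "(\<lambda>n. \<theta> (rpev (p n) a)) \<longlonglongrightarrow> fc f (\<theta> a)"
    unfolding th_rpev[OF a(1)] by (rule fc_lim[OF th_between[OF a] p])
  ultimately show ?thesis by (rule LIMSEQ_unique)
qed

text \<open>The composition of \<open>t\<close> with \<theta> is again a normalized trace:
  antimultiplicativity merely exchanges the two sides of the trace identity.\<close>

lemma t_th: "a \<in> R \<Longrightarrow> adj a = a \<Longrightarrow> t (\<theta> a) = t a"
proof (rule trace_unique[OF _ tr])
  show "tracial (\<lambda>a. t (\<theta> a))"
    unfolding tracial_def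
  proof (intro conjI ballI allI impI)
    fix a b assume ab: "a \<in> R" "b \<in> R"
    show "t (\<theta> (a + b)) = t (\<theta> a) + t (\<theta> b)" using ab by (simp add: th_add tadd th_in)
    have "t (\<theta> a * \<theta> b) = t (\<theta> b * \<theta> a)" using ab by (intro tcomm th_in)
    then show "t (\<theta> (a * b)) = t (\<theta> (b * a))" using mult ab by auto
  qed (simp_all add: th_scaleR tscale th_in tnonneg th_nonneg th_one tone)
qed

lemma th_gl: "a \<in> gl \<Longrightarrow> \<theta> a \<in> gl"
proof -
  assume a: "a \<in> gl"
  then obtain m M where m: "0 < m" "m \<le> 1" "1 \<le> M" "between a m M" using gl_between by blast
  have "m *\<^sub>R 1 \<le> \<theta> a" using th_between[OF gl_in[OF a] m(4)] by (simp add: between_def)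
  then show ?thesis by (rule glI[OF th_in[OF gl_in[OF a]] m(1)])
qed

lemma L_th: "a \<in> gl \<Longrightarrow> L (\<theta> a) = L a"
proof -
  assume a: "a \<in> gl"
  then obtain m M where m: "0 < m" "m \<le> 1" "1 \<le> M" "between a m M" using gl_between by blast
  note c = continuous_on_ln_pos[OF m(1), of M]
  have "L (\<theta> a) = t (\<theta> (fc ln a))" by (simp add: L_def th_fc[OF gl_in[OF a] m(4) c])
  also have "\<dots> = L a" unfolding L_def by (rule t_th[OF fc_ln_in[OF a] fc_sa[OF m(4) c]])
  finally show ?thesis .
qed

end

context traced_factor
begin

theorem L_preserving_iff:
  assumes bij: "bij_betw \<phi> gl gl"
  shows "(\<forall>a\<in>gl. \<forall>b\<in>gl. L (\<phi> a + \<phi> b) = L (\<phi> 1) + L (a + b)) \<longleftrightarrow>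
    (\<exists>\<theta> T. star_bij R \<theta> \<and> ((\<forall>a\<in>R. \<forall>b\<in>R. \<theta> (a * b) = \<theta> a * \<theta> b) \<or> (\<forall>a\<in>R. \<forall>b\<in>R. \<theta> (a * b) = \<theta> b * \<theta> a)) \<and>
      T \<in> gl \<and> (\<forall>a\<in>gl. \<phi> a = T * \<theta> a * T))"
  (is "?lhs \<longleftrightarrow> ?rhs")
proof
  assume ?lhs
  then have hyp: "\<And>a b. a \<in> gl \<Longrightarrow> b \<in> gl \<Longrightarrow> L (\<phi> a + \<phi> b) = L (\<phi> 1) + L (a + b)" by blast
  have \<phi>gl: "\<phi> a \<in> gl" if "a \<in> gl" for a using bij that bij_betwE by blast
  define T where "T = rt (\<phi> 1)"
  define S where "S = cinv T"
  have T: "T \<in> gl" "T * T = \<phi> 1" unfolding T_def by (rule rt_gl[OF \<phi>gl[OF one_gl]]) (rule rt_sq[OF \<phi>gl[OF one_gl]])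
  have S: "S \<in> gl" unfolding S_def by (rule gl_cinv[OF T(1)])
  have ST: "S * T = 1" "T * S = 1" using cinv_left[OF gl_unit[OF T(1)]] cinv_right[OF gl_unit[OF T(1)]] by (simp_all add: S_def)
  have undo: "T * (S * x * S) * T = x" "S * (T * x * T) * S = x" for x
  proof -
    have "T * (S * x * S) * T = (T * S) * x * (S * T)" by (simp only: mult.assoc)
    then show "T * (S * x * S) * T = x" by (simp add: ST)
    have "S * (T * x * T) * S = (S * T) * x * (T * S)" by (simp only: mult.assoc)
    then show "S * (T * x * T) * S = x" by (simp add: ST)
  qed
  have LST: "2 * L S = - L (\<phi> 1)"
    using L_conj[OF T(1) one_gl] L_cinv[OF T(1)] by (simp add: T(2) L_one S_def)
  define f where "f a = S * \<phi> a * S" for a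
  have f_inv: "bij_betw (\<lambda>x. S * x * S) gl gl"
    by (rule bij_betw_byWitness[where f' = "\<lambda>x. T * x * T"]) (auto simp: undo gl_conj S T(1))
  interpret det_map R t f
  proof
    show "bij_betw f gl gl"
      using bij_betw_trans[OF bij f_inv] by (simp add: f_def[abs_def] o_def)
    have "f 1 = S * (T * 1 * T) * S" by (simp add: f_def T(2))
    then show "f 1 = 1" by (simp only: undo)
    fix a b assume ab: "a \<in> gl" "b \<in> gl"
    have "f a + f b = S * (\<phi> a + \<phi> b) * S" by (simp add: f_def distrib_left distrib_right)
    then show "L (f a + f b) = L (a + b)"
      using L_conj[OF S gl_add[OF \<phi>gl[OF ab(1)] \<phi>gl[OF ab(2)]]] LST hyp[OF ab] by simp
  qed
  have "\<phi> a = T * \<theta> a * T" if "a \<in> gl" for a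
    using undo(1)[of "\<phi> a"] by (simp add: \<theta>_gl[OF that] f_def)
  then show ?rhs using extension T(1) by blast
next
  assume ?rhs
  then obtain \<theta> T where sb: "star_bij R \<theta>"
    and mu: "(\<forall>a\<in>R. \<forall>b\<in>R. \<theta> (a * b) = \<theta> a * \<theta> b) \<or> (\<forall>a\<in>R. \<forall>b\<in>R. \<theta> (a * b) = \<theta> b * \<theta> a)"
    and T: "T \<in> gl" and \<phi>: "\<And>a. a \<in> gl \<Longrightarrow> \<phi> a = T * \<theta> a * T" by blast
  interpret star_morphism R t \<theta> by unfold_locales (rule sb, rule mu)
  show ?lhs
  proof (intro ballI)
    fix a b assume ab: "a \<in> gl" "b \<in> gl"
    have abg: "a + b \<in> gl" using ab by (rule gl_add)
    have "\<phi> a + \<phi> b = T * \<theta> (a + b) * T"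
      using ab by (simp add: \<phi> th_add gl_in distrib_left distrib_right)
    then have "L (\<phi> a + \<phi> b) = 2 * L T + L (a + b)" using L_conj[OF T th_gl[OF abg]] L_th[OF abg] by simp
    moreover have "L (\<phi> 1) = 2 * L T" using L_conj[OF T one_gl] by (simp add: \<phi>[OF one_gl] th_one L_one)
    ultimately show "L (\<phi> a + \<phi> b) = L (\<phi> 1) + L (a + b)" by simp
  qed
qed

end

section \<open>Transfer to bounded operators\<close>

lemma blin_simps:
  "blin (a + b) = blin a + blin b" "blin (a * b) = blin a o\<^sub>L blin b" "blin 1 = id_blinfun" "blin 0 = 0"
  "blin (cscale c a) = scale_op c (blin a)" "blin (a - b) = blin a - blin b" "blin (r *\<^sub>R a) = r *\<^sub>R blin a"
  by (simp_all add: plus_cop.rep_eq times_cop.rep_eq one_cop.rep_eq zero_cop.rep_eq cscale.rep_eq minus_cop.rep_eq scaleR_cop.rep_eq)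

lemma blin_Cop: "complex_linear_op A \<Longrightarrow> blin (Cop A) = A"
  by (simp add: Cop_inverse)

lemma blin_eq_iff: "blin a = blin b \<longleftrightarrow> a = b"
  by (rule blin_inject)

lemma blin_sum: "blin (sum f A) = (\<Sum>i\<in>A. blin (f i))"
  by (induct A rule: infinite_finite_induct) (simp_all add: blin_simps)

lemma blin_power: "blin (a ^ n) = (((o\<^sub>L) (blin a)) ^^ n) id_blinfun"
  by (induct n) (simp_all add: blin_simps)

lemma op_poly_blin: "op_poly p (blin a) = blin (rpev p a)"
  by (simp add: op_poly_def rpev_def blin_sum blin_simps blin_power)

lemma op_spectrum_blin: "{s. complex_of_real s \<in> op_spectrum (blin a)} = rspec a"
proof -
  have eq: "(\<exists>B. complex_linear_op B \<and> B o\<^sub>L (blin a - scale_op (of_real s) id_blinfun) = id_blinfun \<and>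
     (blin a - scale_op (of_real s) id_blinfun) o\<^sub>L B = id_blinfun) \<longleftrightarrow> unit (a - s *\<^sub>R 1)" for s
  proof -
    have e: "blin a - scale_op (of_real s) id_blinfun = blin (a - s *\<^sub>R 1)"
      by (simp add: blin_simps flip: cscale_of_real)
    show ?thesis
      unfolding e unit_def
    proof
      assume "\<exists>B. complex_linear_op B \<and> B o\<^sub>L blin (a - s *\<^sub>R 1) = id_blinfun \<and> blin (a - s *\<^sub>R 1) o\<^sub>L B = id_blinfun"
      then obtain B where B: "complex_linear_op B" "B o\<^sub>L blin (a - s *\<^sub>R 1) = id_blinfun" "blin (a - s *\<^sub>R 1) o\<^sub>L B = id_blinfun" by blast
      have "blin (Cop B * (a - s *\<^sub>R 1)) = blin 1" using B by (simp only: blin_simps(2,3) blin_Cop[OF B(1)])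
      moreover have "blin ((a - s *\<^sub>R 1) * Cop B) = blin 1" using B by (simp only: blin_simps(2,3) blin_Cop[OF B(1)])
      ultimately show "\<exists>b. (a - s *\<^sub>R 1) * b = 1 \<and> b * (a - s *\<^sub>R 1) = 1" unfolding blin_eq_iff by blast
    next
      assume "\<exists>b. (a - s *\<^sub>R 1) * b = 1 \<and> b * (a - s *\<^sub>R 1) = 1"
      then obtain b where b: "(a - s *\<^sub>R 1) * b = 1" "b * (a - s *\<^sub>R 1) = 1" by blast
      show "\<exists>B. complex_linear_op B \<and> B o\<^sub>L blin (a - s *\<^sub>R 1) = id_blinfun \<and> blin (a - s *\<^sub>R 1) o\<^sub>L B = id_blinfun"
      proof (intro exI[of _ "blin b"] conjI)
        show "blin b o\<^sub>L blin (a - s *\<^sub>R 1) = id_blinfun" by (simp only: b flip: blin_simps(2,3))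
        show "blin (a - s *\<^sub>R 1) o\<^sub>L blin b = id_blinfun" by (simp only: b flip: blin_simps(2,3))
      qed (rule blin_complex_linear)
    qed
  qed
  show ?thesis unfolding op_spectrum_def rspec_def mem_Collect_eq eq ..
qed

lemma fun_calc_blin:
  assumes b: "between a \<alpha> \<beta>" and f: "continuous_on {\<alpha>..\<beta>} f"
  shows "fun_calc f (blin a) = blin (fc f a)"
  unfolding fun_calc_def op_spectrum_blin op_poly_blin
proof (rule the_equality)
  have lim: "(\<lambda>n. blin (rpev (p n) a)) \<longlonglongrightarrow> blin (fc f a)"
    if "uniform_limit (rspec a) (\<lambda>n. poly (p n)) f sequentially" for p
    using fc_tendsto[OF between_sa[OF b] that] by (simp add: tendsto_iff dist_blin)
  then show "\<forall>p. uniform_limit (rspec a) (\<lambda>n. poly (p n)) f sequentially \<longrightarrow>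
    (\<lambda>n. blin (rpev (p n) a)) \<longlonglongrightarrow> blin (fc f a)" by blast
  fix B assume B: "\<forall>p. uniform_limit (rspec a) (\<lambda>n. poly (p n)) f sequentially \<longrightarrow>
    (\<lambda>n. blin (rpev (p n) a)) \<longlonglongrightarrow> B"
  \<comment> \<open>An approximating sequence exists; without one the description of
    \<open>B\<close> would hold vacuously for every operator.\<close>
  obtain p where "uniform_limit {\<alpha>..\<beta>} (\<lambda>n. poly (p n)) f sequentially" using poly_approx[OF f] by blast
  then have "uniform_limit (rspec a) (\<lambda>n. poly (p n)) f sequentially"
    by (rule uniform_limit_on_subset[OF _ rspec_between[OF b]])
  then show "B = blin (fc f a)" using B lim LIMSEQ_unique by blast
qed

text \<open>The strong topology is pulled back from the product topology, where a basic
  neighbourhood restricts only finitely many coordinates. These coordinates are the vectors at which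
  approximation is required.\<close>

lemma sot_closed_approx:
  fixes R :: "('h::chilbert_space \<Rightarrow>\<^sub>L 'h) set"
  assumes cl: "closedin strong_operator_topology R"
    and ap: "\<And>F e. finite F \<Longrightarrow> 0 < e \<Longrightarrow> \<exists>B\<in>R. \<forall>x\<in>F. norm (blinfun_apply B x - blinfun_apply A x) < e"
  shows "A \<in> R"
proof (rule ccontr)
  assume nA: "A \<notin> R"
  have "openin strong_operator_topology (UNIV - R)"
    using cl by (simp add: closedin_def strong_operator_topology_topspace)
  then obtain U where U: "open U" "UNIV - R = blinfun_apply -` U \<inter> UNIV"
    unfolding strong_operator_topology_def openin_pullback_topology by auto
  have "blinfun_apply A \<in> U" using nA U(2) by blast
  then obtain X where X: "blinfun_apply A \<in> (\<Pi>\<^sub>E i\<in>UNIV. X i)" "\<And>i. open (X i)"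
      "finite {i. X i \<noteq> UNIV}" "(\<Pi>\<^sub>E i\<in>UNIV. X i) \<subseteq> U"
    using product_topology_open_contains_basis[of "\<lambda>i. euclidean" UNIV U "blinfun_apply A"] U(1)
    by (auto simp: open_fun_def)
  define F where "F = {i. X i \<noteq> UNIV}"
  have "\<forall>i. \<exists>e>0. \<forall>y. norm (y - blinfun_apply A i) < e \<longrightarrow> y \<in> X i"
  proof
    fix i
    have "blinfun_apply A i \<in> X i" using X(1) by (simp add: PiE_iff)
    then show "\<exists>e>0. \<forall>y. norm (y - blinfun_apply A i) < e \<longrightarrow> y \<in> X i"
      using X(2)[of i] unfolding open_dist dist_norm by blast
  qed
  then obtain e where e: "\<And>i. e i > 0" "\<And>i y. norm (y - blinfun_apply A i) < e i \<Longrightarrow> y \<in> X i" by metis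
  \<comment> \<open>The inserted 1 keeps the minimum meaningful when no coordinate is
    restricted.\<close>
  define d where "d = Min (insert 1 (e ` F))"
  have fF: "finite F" using X(3) by (simp add: F_def)
  have d: "0 < d" unfolding d_def using fF e(1) by (subst Min_gr_iff) auto
  obtain B where B: "B \<in> R" "\<forall>x\<in>F. norm (blinfun_apply B x - blinfun_apply A x) < d" using ap[OF fF d] by blast
  have "blinfun_apply B i \<in> X i" for i
  proof (cases "i \<in> F")
    case True
    have "d \<le> e i" unfolding d_def using fF True by (intro Min_le) auto
    then show ?thesis using B(2) True by (intro e(2)) force
  qed (simp add: F_def)
  then have "blinfun_apply B \<in> U" using X(4) by (auto simp: PiE_iff)
  then show False using U(2) B(1) by blast
qed

lemma nonneg_Reals_iff_Re: "z \<in> \<real>\<^sub>\<ge>\<^sub>0 \<longleftrightarrow> Im z = 0 \<and> 0 \<le> Re z"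
  by (auto simp: complex_nonneg_Reals_iff)

text \<open>Transport along \<open>blin\<close>: \<open>R'\<close> consists of the elements lying
  over \<open>R\<close>, and \<open>t\<close> is the real part of \<tau>. Injectivity of the real
  exponential turns the determinant identity into the additive identity for \<open>L\<close>, and
  maps on \<open>R\<close> and on \<open>R'\<close> correspond by composing with \<open>blin\<close>
  and \<open>Cop\<close>.\<close>

theorem corollary4p5:
  fixes R :: "('h :: chilbert_space \<Rightarrow>\<^sub>L 'h) set"
    and \<tau> :: "('h \<Rightarrow>\<^sub>L 'h) \<Rightarrow> complex"
    and \<phi> :: "('h \<Rightarrow>\<^sub>L 'h) \<Rightarrow> 'h \<Rightarrow>\<^sub>L 'h"
  assumes separable: "separable_space (euclidean :: 'h topology)"
    and factor: "finite_factor R"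
    and trace: "faithful_tracial_state R \<tau>"
    and bij: "bij_betw \<phi> (GL1_pos R) (GL1_pos R)"
  shows "(\<forall>A\<in>GL1_pos R. \<forall>B\<in>GL1_pos R.
            FK_det \<tau> (\<phi> A + \<phi> B) = FK_det \<tau> (\<phi> id_blinfun) * FK_det \<tau> (A + B))
     \<longleftrightarrow>
     (\<exists>\<theta> T. (star_automorphism R \<theta> \<or> star_anti_automorphism R \<theta>) \<and> T \<in> GL1_pos R \<and>
            (\<forall>A\<in>GL1_pos R. \<phi> A = T o\<^sub>L \<theta> A o\<^sub>L T))"
proof -
  have vn: "von_neumann_algebra R" using factor by (simp add: finite_factor_def)
  have cl: "complex_linear_op A" if "A \<in> R" for A using vn that by (simp add: von_neumann_algebra_def)
  define R' where "R' = {a. blin a \<in> R}"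
  have R'D: "a \<in> R' \<longleftrightarrow> blin a \<in> R" for a by (simp add: R'_def)
  have CopR: "Cop A \<in> R'" "blin (Cop A) = A" if "A \<in> R" for A
    using that blin_Cop[OF cl[OF that]] by (simp_all add: R'_def)
  interpret A: vn_alg R'
  proof
    fix a assume ap: "\<And>F e. finite F \<Longrightarrow> 0 < e \<Longrightarrow> \<exists>b\<in>R'. \<forall>x\<in>F. norm (b \<cdot> x - a \<cdot> x) < e"
    have "blin a \<in> R"
    proof (rule sot_closed_approx)
      show "closedin strong_operator_topology R" using vn by (simp add: von_neumann_algebra_def)
      fix F :: "'h set" and e :: real assume "finite F" "0 < e"
      then obtain b where "b \<in> R'" "\<forall>x\<in>F. norm (b \<cdot> x - a \<cdot> x) < e" using ap by blast
      then show "\<exists>B\<in>R. \<forall>x\<in>F. norm (blinfun_apply B x - blinfun_apply (blin a) x) < e"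
        by (intro bexI[of _ "blin b"]) (simp_all add: app.rep_eq R'D)
    qed
    then show "a \<in> R'" by (simp add: R'D)
  qed (use vn in \<open>simp_all add: R'D blin_simps von_neumann_algebra_def flip: adj_op_blin\<close>)
  have \<tau>: "\<And>a b. a \<in> R' \<Longrightarrow> b \<in> R' \<Longrightarrow> \<tau> (blin (a + b)) = \<tau> (blin a) + \<tau> (blin b)"
      "\<And>c a. a \<in> R' \<Longrightarrow> \<tau> (blin (cscale c a)) = c * \<tau> (blin a)"
      "\<And>a b. a \<in> R' \<Longrightarrow> b \<in> R' \<Longrightarrow> \<tau> (blin (a * b)) = \<tau> (blin (b * a))"
      "\<And>a. a \<in> R' \<Longrightarrow> \<tau> (blin (adj a * a)) \<in> \<real>\<^sub>\<ge>\<^sub>0"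
      "\<And>a. a \<in> R' \<Longrightarrow> \<tau> (blin (adj a * a)) = 0 \<Longrightarrow> a = 0" "\<tau> (blin 1) = 1"
    using trace
    by (simp_all add: faithful_tracial_state_def blin_simps R'D flip: adj_op_blin)
       (metis blin_eq_iff blin_simps(4))
  have \<tau>sc: "\<tau> (blin (r *\<^sub>R a)) = of_real r * \<tau> (blin a)" if "a \<in> R'" for r a
    using \<tau>(2)[OF that, of "of_real r"] by (simp add: cscale_of_real)
  have \<tau>pos: "\<tau> (blin a) \<in> \<real>\<^sub>\<ge>\<^sub>0" if a: "a \<in> R'" "0 \<le> a" for a
  proof -
    obtain s where "s \<in> R'" "adj s = s" "s * s = a" using A.nonneg_square[OF a] .
    then show ?thesis using \<tau>(4)[of s] by simp
  qed
  \<comment> \<open>\<open>norm a - a\<close> is positive, so its trace is real, and hence so is the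
    trace of \<open>a\<close>.\<close>
  have \<tau>real: "Im (\<tau> (blin a)) = 0" if a: "a \<in> R'" "adj a = a" for a
  proof -
    have "between a (- norm a) (norm a)" by (rule sa_between_norm[OF a(2) order_refl])
    then have "0 \<le> norm a *\<^sub>R 1 - a" by (simp add: between_def)
    then have "\<tau> (blin (norm a *\<^sub>R 1 - a)) \<in> \<real>\<^sub>\<ge>\<^sub>0" using a(1) by (intro \<tau>pos) (simp_all add: A.alg_in)
    moreover have "\<tau> (blin (norm a *\<^sub>R 1 + (-1) *\<^sub>R a)) = of_real (norm a) - \<tau> (blin a)"
      using a(1) by (simp only: \<tau>(1) \<tau>sc \<tau>(6) A.alg_in) simp
    ultimately show ?thesis by (simp add: nonneg_Reals_iff_Re)
  qed
  define t where "t a = Re (\<tau> (blin a))" for a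
  interpret F: traced_factor R' t
  proof
    show "A.tracial t"
      unfolding A.tracial_def t_def using \<tau>(1,3,6) \<tau>sc \<tau>pos by (simp add: nonneg_Reals_iff_Re)
    \<comment> \<open>\<open>\<i>\<close> times \<open>a - adj a\<close> is self-adjoint, so its
      trace is real; this says that the traces of \<open>a\<close> and \<open>adj a\<close> have
      equal real parts.\<close>
    show "t (adj a) = t a" if a: "a \<in> R'" for a
    proof -
      have aR: "adj a \<in> R'" using a by (rule A.adj_in)
      have "Im (\<tau> (blin (cscale \<i> (a + cscale (-1) (adj a))))) = 0"
        using a by (intro \<tau>real) (simp_all add: A.alg_in cscale_minus cscale_one cscale_diff)
      then show ?thesis using a aR by (simp only: \<tau>(1,2) A.alg_in t_def) simp
    qed
    show "a = 0" if a: "a \<in> R'" "0 \<le> a" "t a = 0" for a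
    proof -
      obtain s where s: "s \<in> R'" "adj s = s" "s * s = a" using A.nonneg_square[OF a(1,2)] .
      have "\<tau> (blin a) = 0" using \<tau>pos[OF a(1,2)] a(3) by (simp add: nonneg_Reals_iff_Re t_def complex_eq_iff)
      then have "s = 0" using \<tau>(5)[OF s(1)] s by simp
      then show ?thesis using s(3) by simp
    qed
    fix z assume z: "z \<in> R'" "\<And>b. b \<in> R' \<Longrightarrow> z * b = b * z"
    have "blin z o\<^sub>L B = B o\<^sub>L blin z" if "B \<in> R" for B
      using arg_cong[OF z(2)[OF CopR(1)[OF that]], of blin] by (simp add: blin_simps CopR(2)[OF that])
    then have "blin z \<in> center_op R" using z(1) by (simp add: center_op_def R'D)
    then obtain c where "blin z = scale_op c id_blinfun" using factor by (auto simp: finite_factor_def)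
    then have "blin z = blin (cscale c 1)" by (simp add: blin_simps)
    then show "\<exists>c. z = cscale c 1" unfolding blin_eq_iff by blast
  qed
  have GL: "blin a \<in> GL1_pos R \<longleftrightarrow> a \<in> A.gl" for a
  proof -
    have "(\<exists>B\<in>R. blin a o\<^sub>L B = id_blinfun \<and> B o\<^sub>L blin a = id_blinfun) \<longleftrightarrow> (\<exists>b\<in>R'. a * b = 1 \<and> b * a = 1)"
    proof
      assume "\<exists>B\<in>R. blin a o\<^sub>L B = id_blinfun \<and> B o\<^sub>L blin a = id_blinfun"
      then obtain B where B: "B \<in> R" "blin a o\<^sub>L B = id_blinfun" "B o\<^sub>L blin a = id_blinfun" by blast
      have "blin (a * Cop B) = blin 1" "blin (Cop B * a) = blin 1"
        by (simp_all only: blin_simps(2,3) CopR(2)[OF B(1)] B(2,3))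
      then show "\<exists>b\<in>R'. a * b = 1 \<and> b * a = 1" unfolding blin_eq_iff using CopR(1)[OF B(1)] by blast
    next
      assume "\<exists>b\<in>R'. a * b = 1 \<and> b * a = 1"
      then obtain b where b: "b \<in> R'" "a * b = 1" "b * a = 1" by blast
      then show "\<exists>B\<in>R. blin a o\<^sub>L B = id_blinfun \<and> B o\<^sub>L blin a = id_blinfun"
        by (intro bexI[of _ "blin b"]) (simp_all add: R'D flip: blin_simps(2,3))
    qed
    then show ?thesis by (simp add: GL1_pos_def A.gl_iff R'D positive_op_blin)
  qed
  have GLR: "A \<in> R" if "A \<in> GL1_pos R" for A using that by (simp add: GL1_pos_def)
  have GLC: "Cop A \<in> A.gl" if "A \<in> GL1_pos R" for A
    using that CopR(2)[OF GLR[OF that]] GL[of "Cop A"] by simp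
  \<comment> \<open>For a positive \<open>a\<close> the square root of \<open>adj a * a\<close> is
    \<open>a\<close> again, and the trace of the self-adjoint \<open>ln a\<close> is real.\<close>
  have FK: "FK_det \<tau> (blin a) = of_real (exp (F.L a))" if a: "a \<in> A.gl" for a
  proof -
    obtain m M where m: "0 < m" "m \<le> 1" "1 \<le> M" "between a m M" using A.gl_between[OF a] .
    have cs: "continuous_on S sqrt" "continuous_on S (\<lambda>x::real. x * x)" for S by (intro continuous_intros)+
    have aa: "a * a = fc (\<lambda>x. x * x) a"
      by (simp add: fc_mult[OF m(4) continuous_on_id continuous_on_id] fc_id[OF m(4)])
    have mm: "m * m \<le> x * x \<and> x * x \<le> M * M" if "m \<le> x" "x \<le> M" for x
      using that m by (intro conjI mult_mono) auto
    have b2: "between (a * a) (m * m) (M * M)" unfolding aa by (rule fc_between[OF m(4) cs(2) mm])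
    have "fc sqrt (a * a) = fc (\<lambda>x. sqrt (x * x)) a"
      unfolding aa by (rule fc_comp[OF m(4) cs(2) mm cs(1)])
    also have "\<dots> = fc (\<lambda>x. x) a" using m(1) by (intro fc_cong[OF m(4)]) simp
    also have "\<dots> = a" by (rule fc_id[OF m(4)])
    finally have sq: "fc sqrt (a * a) = a" .
    have "fun_calc sqrt (adj_op (blin a) o\<^sub>L blin a) = fun_calc sqrt (blin (a * a))"
      by (simp add: adj_op_blin A.gl_sa[OF a] blin_simps)
    also have "\<dots> = blin a" by (simp add: fun_calc_blin[OF b2 cs(1)] sq)
    finally have "FK_det \<tau> (blin a) = exp (\<tau> (blin (fc ln a)))"
      by (simp add: FK_det_def fun_calc_blin[OF m(4) A.continuous_on_ln_pos[OF m(1)]])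
    moreover have "\<tau> (blin (fc ln a)) = of_real (F.L a)"
      using \<tau>real[OF F.fc_ln_in[OF a] fc_sa[OF m(4) A.continuous_on_ln_pos[OF m(1)]]]
      by (simp add: F.L_def t_def complex_eq_iff)
    ultimately show ?thesis by (simp add: exp_of_real)
  qed
  define \<phi>' where "\<phi>' a = Cop (\<phi> (blin a))" for a
  have \<phi>GL: "\<phi> A \<in> GL1_pos R" if "A \<in> GL1_pos R" for A by (rule bspec[OF bij_betwE[OF bij] that])
  have \<phi>': "blin (\<phi>' a) = \<phi> (blin a)" "\<phi>' a \<in> A.gl" if "a \<in> A.gl" for a
  proof -
    have g: "\<phi> (blin a) \<in> GL1_pos R" using that by (intro \<phi>GL) (simp add: GL)
    show "blin (\<phi>' a) = \<phi> (blin a)" unfolding \<phi>'_def by (rule CopR(2)[OF GLR[OF g]])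
    show "\<phi>' a \<in> A.gl" unfolding \<phi>'_def by (rule GLC[OF g])
  qed
  have "bij_betw \<phi>' A.gl A.gl"
    unfolding bij_betw_def
  proof
    show "inj_on \<phi>' A.gl"
    proof (rule inj_onI)
      fix a b assume ab: "a \<in> A.gl" "b \<in> A.gl" "\<phi>' a = \<phi>' b"
      then have "\<phi> (blin a) = \<phi> (blin b)" using \<phi>'(1) by metis
      then have "blin a = blin b" using inj_onD[OF bij_betw_imp_inj_on[OF bij]] ab(1,2) by (simp add: GL)
      then show "a = b" by (simp only: blin_eq_iff)
    qed
    show "\<phi>' ` A.gl = A.gl"
    proof
      show "\<phi>' ` A.gl \<subseteq> A.gl" using \<phi>'(2) by blast
      show "A.gl \<subseteq> \<phi>' ` A.gl"
      proof
        fix b assume b: "b \<in> A.gl"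
        then have "blin b \<in> \<phi> ` GL1_pos R" using bij GL by (simp add: bij_betw_def)
        then obtain A where A: "A \<in> GL1_pos R" "blin b = \<phi> A" by blast
        have "blin (\<phi>' (Cop A)) = blin b" using \<phi>'(1)[OF GLC[OF A(1)]] A(2) CopR(2)[OF GLR[OF A(1)]] by simp
        then have "b = \<phi>' (Cop A)" by (simp only: blin_eq_iff)
        then show "b \<in> \<phi>' ` A.gl" using GLC[OF A(1)] by blast
      qed
    qed
  qed
  note main = F.L_preserving_iff[OF this]
  have lhs: "(\<forall>A\<in>GL1_pos R. \<forall>B\<in>GL1_pos R. FK_det \<tau> (\<phi> A + \<phi> B) = FK_det \<tau> (\<phi> id_blinfun) * FK_det \<tau> (A + B))
    \<longleftrightarrow> (\<forall>a\<in>A.gl. \<forall>b\<in>A.gl. F.L (\<phi>' a + \<phi>' b) = F.L (\<phi>' 1) + F.L (a + b))"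
  proof -
    have eq: "FK_det \<tau> (\<phi> (blin a) + \<phi> (blin b)) = FK_det \<tau> (\<phi> id_blinfun) * FK_det \<tau> (blin a + blin b)
      \<longleftrightarrow> F.L (\<phi>' a + \<phi>' b) = F.L (\<phi>' 1) + F.L (a + b)" if ab: "a \<in> A.gl" "b \<in> A.gl" for a b
    proof -
      have "FK_det \<tau> (\<phi> (blin a) + \<phi> (blin b)) = of_real (exp (F.L (\<phi>' a + \<phi>' b)))"
        using FK[OF A.gl_add[OF \<phi>'(2)[OF ab(1)] \<phi>'(2)[OF ab(2)]]] by (simp add: blin_simps \<phi>'(1) ab)
      moreover have "FK_det \<tau> (\<phi> id_blinfun) = of_real (exp (F.L (\<phi>' 1)))"
        using FK[OF \<phi>'(2)[OF A.one_gl]] \<phi>'(1)[OF A.one_gl] by (simp add: blin_simps)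
      moreover have "FK_det \<tau> (blin a + blin b) = of_real (exp (F.L (a + b)))"
        using FK[OF A.gl_add[OF ab]] by (simp add: blin_simps)
      ultimately show ?thesis by (simp flip: of_real_mult exp_add)
    qed
    show ?thesis
    proof (intro iffI ballI)
      fix a b assume h: "\<forall>A\<in>GL1_pos R. \<forall>B\<in>GL1_pos R. FK_det \<tau> (\<phi> A + \<phi> B) = FK_det \<tau> (\<phi> id_blinfun) * FK_det \<tau> (A + B)"
        and ab: "a \<in> A.gl" "b \<in> A.gl"
      show "F.L (\<phi>' a + \<phi>' b) = F.L (\<phi>' 1) + F.L (a + b)" using h ab by (simp add: GL flip: eq[OF ab])
    next
      fix A B assume h: "\<forall>a\<in>A.gl. \<forall>b\<in>A.gl. F.L (\<phi>' a + \<phi>' b) = F.L (\<phi>' 1) + F.L (a + b)"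
        and AB: "A \<in> GL1_pos R" "B \<in> GL1_pos R"
      show "FK_det \<tau> (\<phi> A + \<phi> B) = FK_det \<tau> (\<phi> id_blinfun) * FK_det \<tau> (A + B)"
        using eq[OF GLC[OF AB(1)] GLC[OF AB(2)]] h GLC[OF AB(1)] GLC[OF AB(2)]
        by (simp add: CopR(2)[OF GLR[OF AB(1)]] CopR(2)[OF GLR[OF AB(2)]])
    qed
  qed
  show ?thesis
    unfolding lhs main
  proof
    assume "\<exists>\<theta> T. star_bij R' \<theta> \<and> ((\<forall>a\<in>R'. \<forall>b\<in>R'. \<theta> (a * b) = \<theta> a * \<theta> b) \<or> (\<forall>a\<in>R'. \<forall>b\<in>R'. \<theta> (a * b) = \<theta> b * \<theta> a)) \<and>
      T \<in> A.gl \<and> (\<forall>a\<in>A.gl. \<phi>' a = T * \<theta> a * T)"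
    then obtain \<theta> T where sb: "star_bij R' \<theta>"
      and mu: "(\<forall>a\<in>R'. \<forall>b\<in>R'. \<theta> (a * b) = \<theta> a * \<theta> b) \<or> (\<forall>a\<in>R'. \<forall>b\<in>R'. \<theta> (a * b) = \<theta> b * \<theta> a)"
      and T: "T \<in> A.gl" and \<phi>eq: "\<And>a. a \<in> A.gl \<Longrightarrow> \<phi>' a = T * \<theta> a * T" by blast
    define \<Theta> where "\<Theta> A = blin (\<theta> (Cop A))" for A
    have \<Theta>: "\<Theta> (blin a) = blin (\<theta> a)" for a by (simp add: \<Theta>_def blin_inverse)
    have bj: "bij_betw \<theta> R' R'" using sb by (simp add: star_bij_def)
    have \<theta>in: "\<theta> a \<in> R'" if "a \<in> R'" for a by (rule bij_betw_apply[OF bj that])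
    have ex: "\<exists>a\<in>R'. A = blin a" if "A \<in> R" for A using CopR[OF that] by (intro bexI[of _ "Cop A"]) simp_all
    have "bij_betw \<Theta> R R"
    proof (rule bij_betwI')
      fix A B assume "A \<in> R" "B \<in> R"
      then obtain a b where ab: "a \<in> R'" "b \<in> R'" "A = blin a" "B = blin b" using ex by metis
      have "\<theta> a = \<theta> b \<longleftrightarrow> a = b"
        by (rule inj_on_eq_iff[OF bij_betw_imp_inj_on[OF bj] ab(1,2)])
      then show "\<Theta> A = \<Theta> B \<longleftrightarrow> A = B" by (simp only: ab \<Theta> blin_eq_iff)
    next
      fix A assume "A \<in> R"
      then obtain a where "a \<in> R'" "A = blin a" using ex by blast
      then show "\<Theta> A \<in> R" using \<theta>in by (simp add: \<Theta> flip: R'D)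
    next
      fix B assume "B \<in> R"
      then obtain b where b: "b \<in> R'" "B = blin b" using ex by metis
      have "b \<in> \<theta> ` R'" using b(1) bij_betw_imp_surj_on[OF bj] by simp
      then obtain a where "b = \<theta> a" "a \<in> R'" by (rule imageE)
      then show "\<exists>A\<in>R. B = \<Theta> A" using b by (intro bexI[of _ "blin a"]) (simp_all add: \<Theta> flip: R'D)
    qed
    moreover have "\<Theta> (A + B) = \<Theta> A + \<Theta> B" if AB: "A \<in> R" "B \<in> R" for A B
    proof -
      obtain a b where ab: "a \<in> R'" "b \<in> R'" "A = blin a" "B = blin b" using ex AB by metis
      have "\<theta> (a + b) = \<theta> a + \<theta> b" using sb ab by (simp add: star_bij_def)
      then show ?thesis by (simp add: ab \<Theta> blin_simps(1)[symmetric])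
    qed
    moreover have "\<Theta> (scale_op c A) = scale_op c (\<Theta> A)" if A: "A \<in> R" for c A
    proof -
      obtain a where a: "a \<in> R'" "A = blin a" using ex A by metis
      have "\<theta> (cscale c a) = cscale c (\<theta> a)" using sb a by (simp add: star_bij_def)
      then show ?thesis by (simp add: a \<Theta> blin_simps(5)[symmetric])
    qed
    moreover have "\<Theta> (adj_op A) = adj_op (\<Theta> A)" if A: "A \<in> R" for A
    proof -
      obtain a where a: "a \<in> R'" "A = blin a" using ex A by metis
      have "\<theta> (adj a) = adj (\<theta> a)" using sb a by (simp add: star_bij_def)
      then show ?thesis by (simp add: a \<Theta> adj_op_blin)
    qed
    ultimately have "star_linear_bij R \<Theta>" unfolding star_linear_bij_def by blast
    moreover have "(\<forall>A\<in>R. \<forall>B\<in>R. \<Theta> (A o\<^sub>L B) = \<Theta> A o\<^sub>L \<Theta> B) \<or> (\<forall>A\<in>R. \<forall>B\<in>R. \<Theta> (A o\<^sub>L B) = \<Theta> B o\<^sub>L \<Theta> A)"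
      using mu
    proof
      assume h: "\<forall>a\<in>R'. \<forall>b\<in>R'. \<theta> (a * b) = \<theta> a * \<theta> b"
      have "\<Theta> (A o\<^sub>L B) = \<Theta> A o\<^sub>L \<Theta> B" if AB: "A \<in> R" "B \<in> R" for A B
      proof -
        obtain a b where ab: "a \<in> R'" "b \<in> R'" "A = blin a" "B = blin b" using ex AB by metis
        then show ?thesis using h by (simp add: \<Theta> blin_simps(2)[symmetric])
      qed
      then show ?thesis by blast
    next
      assume h: "\<forall>a\<in>R'. \<forall>b\<in>R'. \<theta> (a * b) = \<theta> b * \<theta> a"
      have "\<Theta> (A o\<^sub>L B) = \<Theta> B o\<^sub>L \<Theta> A" if AB: "A \<in> R" "B \<in> R" for A B
      proof -
        obtain a b where ab: "a \<in> R'" "b \<in> R'" "A = blin a" "B = blin b" using ex AB by metis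
        then show ?thesis using h by (simp add: \<Theta> blin_simps(2)[symmetric])
      qed
      then show ?thesis by blast
    qed
    ultimately have "star_automorphism R \<Theta> \<or> star_anti_automorphism R \<Theta>"
      by (simp add: star_automorphism_def star_anti_automorphism_def)
    moreover have "blin T \<in> GL1_pos R" using T by (simp add: GL)
    moreover have "\<phi> A = blin T o\<^sub>L \<Theta> A o\<^sub>L blin T" if A: "A \<in> GL1_pos R" for A
    proof -
      have "\<phi> A = blin (\<phi>' (Cop A))" using \<phi>'(1)[OF GLC[OF A]] CopR(2)[OF GLR[OF A]] by simp
      also have "\<dots> = blin T o\<^sub>L \<Theta> A o\<^sub>L blin T" by (simp add: \<phi>eq[OF GLC[OF A]] \<Theta>_def blin_simps)
      finally show ?thesis .
    qed
    ultimately show "\<exists>\<theta> T. (star_automorphism R \<theta> \<or> star_anti_automorphism R \<theta>) \<and> T \<in> GL1_pos R \<and>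
            (\<forall>A\<in>GL1_pos R. \<phi> A = T o\<^sub>L \<theta> A o\<^sub>L T)" by blast
  next
    assume "\<exists>\<theta> T. (star_automorphism R \<theta> \<or> star_anti_automorphism R \<theta>) \<and> T \<in> GL1_pos R \<and>
            (\<forall>A\<in>GL1_pos R. \<phi> A = T o\<^sub>L \<theta> A o\<^sub>L T)"
    then obtain \<Theta> T where au: "star_automorphism R \<Theta> \<or> star_anti_automorphism R \<Theta>"
      and T: "T \<in> GL1_pos R" and \<phi>eq: "\<And>A. A \<in> GL1_pos R \<Longrightarrow> \<phi> A = T o\<^sub>L \<Theta> A o\<^sub>L T" by blast
    have sb: "star_linear_bij R \<Theta>" using au by (auto simp: star_automorphism_def star_anti_automorphism_def)
    have bj: "bij_betw \<Theta> R R" using sb by (simp add: star_linear_bij_def)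
    have \<Theta>R: "\<Theta> A \<in> R" if "A \<in> R" for A by (rule bij_betw_apply[OF bj that])
    define \<theta> where "\<theta> a = Cop (\<Theta> (blin a))" for a
    have \<theta>: "blin (\<theta> a) = \<Theta> (blin a)" if "a \<in> R'" for a
      unfolding \<theta>_def using that by (intro CopR(2) \<Theta>R) (simp add: R'D)
    have \<theta>in: "\<theta> a \<in> R'" if "a \<in> R'" for a using \<Theta>R[of "blin a"] that by (simp add: R'D \<theta>)
    have "bij_betw \<theta> R' R'"
    proof (rule bij_betwI')
      fix a b assume ab: "a \<in> R'" "b \<in> R'"
      have "\<Theta> (blin a) = \<Theta> (blin b) \<longleftrightarrow> blin a = blin b"
        using ab by (intro inj_on_eq_iff[OF bij_betw_imp_inj_on[OF bj]]) (simp_all add: R'D)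
      then show "\<theta> a = \<theta> b \<longleftrightarrow> a = b" using \<theta>[OF ab(1)] \<theta>[OF ab(2)] by (metis blin_eq_iff)
    next
      fix b assume b: "b \<in> R'"
      have "blin b \<in> \<Theta> ` R" using b bij_betw_imp_surj_on[OF bj] by (simp add: R'D)
      then obtain A where A: "A \<in> R" "blin b = \<Theta> A" by (rule imageE)
      have "blin b = blin (\<theta> (Cop A))" using A \<theta>[OF CopR(1)[OF A(1)]] CopR(2)[OF A(1)] by simp
      then show "\<exists>a\<in>R'. b = \<theta> a" unfolding blin_eq_iff using CopR(1)[OF A(1)] by blast
    qed (rule \<theta>in)
    moreover have "\<theta> (a + b) = \<theta> a + \<theta> b" if ab: "a \<in> R'" "b \<in> R'" for a b
    proof -
      have "blin (\<theta> (a + b)) = blin (\<theta> a + \<theta> b)"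
        using sb ab A.add_in[OF ab] by (simp add: \<theta> blin_simps star_linear_bij_def R'D)
      then show ?thesis by (simp only: blin_eq_iff)
    qed
    moreover have "\<theta> (cscale c a) = cscale c (\<theta> a)" if a: "a \<in> R'" for c a
    proof -
      have "blin (\<theta> (cscale c a)) = blin (cscale c (\<theta> a))"
        using sb a A.cscale_in[OF a] by (simp add: \<theta> blin_simps star_linear_bij_def R'D)
      then show ?thesis by (simp only: blin_eq_iff)
    qed
    moreover have "\<theta> (adj a) = adj (\<theta> a)" if a: "a \<in> R'" for a
    proof -
      have "\<Theta> (adj_op (blin a)) = adj_op (\<Theta> (blin a))" using sb a by (simp add: star_linear_bij_def R'D)
      then have "blin (\<theta> (adj a)) = blin (adj (\<theta> a))"
        by (simp add: \<theta>[OF a] \<theta>[OF A.adj_in[OF a]] flip: adj_op_blin)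
      then show ?thesis by (simp only: blin_eq_iff)
    qed
    ultimately have sb': "star_bij R' \<theta>" unfolding star_bij_def by blast
    have mu: "(\<forall>a\<in>R'. \<forall>b\<in>R'. \<theta> (a * b) = \<theta> a * \<theta> b) \<or> (\<forall>a\<in>R'. \<forall>b\<in>R'. \<theta> (a * b) = \<theta> b * \<theta> a)"
      using au
    proof
      assume h: "star_automorphism R \<Theta>"
      have "\<theta> (a * b) = \<theta> a * \<theta> b" if ab: "a \<in> R'" "b \<in> R'" for a b
      proof -
        have "blin (\<theta> (a * b)) = blin (\<theta> a * \<theta> b)"
          using h ab A.mult_in[OF ab] by (simp add: \<theta> blin_simps star_automorphism_def R'D)
        then show ?thesis by (simp only: blin_eq_iff)
      qed
      then show ?thesis by blast
    next
      assume h: "star_anti_automorphism R \<Theta>"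
      have "\<theta> (a * b) = \<theta> b * \<theta> a" if ab: "a \<in> R'" "b \<in> R'" for a b
      proof -
        have "blin (\<theta> (a * b)) = blin (\<theta> b * \<theta> a)"
          using h ab A.mult_in[OF ab] by (simp add: \<theta> blin_simps star_anti_automorphism_def R'D)
        then show ?thesis by (simp only: blin_eq_iff)
      qed
      then show ?thesis by blast
    qed
    have "\<phi>' a = Cop T * \<theta> a * Cop T" if a: "a \<in> A.gl" for a
    proof -
      have "blin (\<phi>' a) = blin (Cop T * \<theta> a * Cop T)"
        using a by (simp add: \<phi>'(1)[OF a] \<phi>eq GL blin_simps CopR(2)[OF GLR[OF T]] \<theta>[OF A.gl_in[OF a]])
      then show ?thesis by (simp only: blin_eq_iff)
    qed
    then show "\<exists>\<theta> T. star_bij R' \<theta> \<and> ((\<forall>a\<in>R'. \<forall>b\<in>R'. \<theta> (a * b) = \<theta> a * \<theta> b) \<or> (\<forall>a\<in>R'. \<forall>b\<in>R'. \<theta> (a * b) = \<theta> b * \<theta> a)) \<and>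
      T \<in> A.gl \<and> (\<forall>a\<in>A.gl. \<phi>' a = T * \<theta> a * T)"
      using sb' mu GLC[OF T] by blast
  qed
qed

end
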